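(* Let $\mathbb{K}$ be a field, $G$ a finite group acting on a space $M$, and $\mathcal{P}_G(M)=\coprod_{g\in G}(\mathcal{P}_g(M)\times\{g\})$. Suppose that $H^*(\mathcal{P}_G(M);\mathbb{K})$ is locally finite and that the characteristic of $\mathbb{K}$ is coprime with $|G|$. Then, as an algebra, $$H^*(L(EG\times_GM);\mathbb{K})\cong\mathbb{K}\,\Box_{\mathbb{K}[G]^\vee}H^*(\mathcal{P}_G(M);\mathbb{K}).$$
   Context: $LX$ is the space of continuous maps $S^1\to X$; $EG\times_GM$ is the Borel construction. For $g\in G$, $\mathcal{P}_g(M)=\{\gamma:[0,1]\to M\mid\gamma(1)=g\gamma(0)\}$, a subspace of $M^{[0,1]}$ with the compact-open topology. $G$ acts on $\mathcal{P}_G(M)$ by $h\cdot(\gamma,g)=({}_h\gamma,hgh^{-1})$, ${}_h\gamma(t)=h\cdot\gamma(t)$. Locally finite means finite dimensional in each degree. "Characteristic coprime with $|G|$" means $|G|$ is invertible in $\mathbb{K}$ (characteristic $0$ allowed). For a $G$-space $X$, $H^*(X;\mathbb{K})$ is a left comodule over $\mathbb{K}[G]^\vee=H^*(G;\mathbb{K})$ (the dual of the group ring) via the map $\nabla:H^*(X)\to H^*(G\times X)\cong\mathbb{K}[G]^\vee\otimes H^*(X)$ induced by the action. The cotensor product $\mathbb{K}\,\Box_{\mathbb{K}[G]^\vee}H^*(X;\mathbb{K})$ with the trivial right comodule $\mathbb{K}$ is the subalgebra $\{x\in H^*(X;\mathbb{K})\mid\nabla(x)=1\otimes x\}$. *)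

theory Defs
  imports
    "HOL-Analysis.Analysis"
    "HOL-Homology.Homology"
    "HOL-Algebra.QuotRing"
    "HOL-Algebra.Module"
    "HOL-Algebra.Group_Action"
begin

section \<open>Singular cohomology algebras with coefficients in a field\<close>

text \<open>
  A cochain is a family \<open>c n\<close> of functions on the singular \<open>n\<close>-simplices of \<open>X\<close>,
  zero for all but finitely many degrees \<open>n\<close>, i.e. an element of the direct sum of the groups
  \<open>C\<^sup>n(X; K)\<close>. To make the representing function unique it is set to zero on everything
  that is not a singular simplex.
\<close>

type_synonym ('a, 'k) cochain = "nat \<Rightarrow> ((nat \<Rightarrow> real) \<Rightarrow> 'a) \<Rightarrow> 'k"

definition cochains :: "'a topology \<Rightarrow> ('a, 'k::field) cochain set" where
  "cochains X = {c. finite {n. \<exists>\<sigma>. c n \<sigma> \<noteq> 0} \<and>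
                    (\<forall>n \<sigma>. \<not> singular_simplex n X \<sigma> \<longrightarrow> c n \<sigma> = 0)}"

definition coboundary :: "'a topology \<Rightarrow> ('a, 'k::field) cochain \<Rightarrow> ('a, 'k) cochain" where
  "coboundary X c = (\<lambda>n \<sigma>.
     if n > 0 \<and> singular_simplex n X \<sigma>
     then \<Sum>i\<le>n. (-1) ^ i * c (n - 1) (singular_face n i \<sigma>) else 0)"

text \<open>The restrictions of a singular \<open>(p+q)\<close>-simplex to its front \<open>p\<close>-face
  \<open>[e\<^sub>0, \<dots>, e\<^sub>p]\<close> and to its back \<open>q\<close>-face \<open>[e\<^sub>p, \<dots>, e\<^sub>p\<^sub>+\<^sub>q]\<close>.\<close>

definition front_face :: "nat \<Rightarrow> ((nat \<Rightarrow> real) \<Rightarrow> 'a) \<Rightarrow> (nat \<Rightarrow> real) \<Rightarrow> 'a" where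
  "front_face p \<sigma> = restrict \<sigma> (standard_simplex p)"

definition back_face :: "nat \<Rightarrow> nat \<Rightarrow> ((nat \<Rightarrow> real) \<Rightarrow> 'a) \<Rightarrow> (nat \<Rightarrow> real) \<Rightarrow> 'a" where
  "back_face p q \<sigma> =
     restrict (\<sigma> \<circ> (\<lambda>x i. if i < p then 0 else x (i - p))) (standard_simplex q)"

definition cup :: "'a topology \<Rightarrow> ('a, 'k::field) cochain \<Rightarrow> ('a, 'k) cochain \<Rightarrow> ('a, 'k) cochain"
  where
  "cup X a b = (\<lambda>n \<sigma>.
     if singular_simplex n X \<sigma>
     then \<Sum>p\<le>n. a p (front_face p \<sigma>) * b (n - p) (back_face p (n - p) \<sigma>) else 0)"

definition cocycle_algebra :: "'a topology \<Rightarrow> ('k::field, ('a, 'k) cochain) module" where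
  "cocycle_algebra X =
     \<lparr>carrier = {c \<in> cochains X. coboundary X c = (\<lambda>n \<sigma>. 0)},
      mult = cup X,
      one = (\<lambda>n \<sigma>. if n = 0 \<and> singular_simplex 0 X \<sigma> then 1 else 0),
      zero = (\<lambda>n \<sigma>. 0),
      add = (\<lambda>a b n \<sigma>. a n \<sigma> + b n \<sigma>),
      smult = (\<lambda>k a n \<sigma>. k * a n \<sigma>)\<rparr>"

definition coboundaries :: "'a topology \<Rightarrow> ('a, 'k::field) cochain set" where
  "coboundaries X = coboundary X ` cochains X"

definition cohomology_class ::
    "'a topology \<Rightarrow> ('a, 'k::field) cochain \<Rightarrow> ('a, 'k) cochain set" where
  "cohomology_class X z = coboundaries X +>\<^bsub>cocycle_algebra X\<^esub> z"

text \<open>\<open>H\<^sup>*(X; K)\<close>, cocycles modulo coboundaries; elements are cosets, i.e. sets of cocycles.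
  The structure is that of the quotient ring, with the scalar multiplication added.\<close>

definition cohomology :: "'a topology \<Rightarrow> ('k::field, ('a, 'k) cochain set) module" where
  "cohomology X =
     (let Q = cocycle_algebra X Quot coboundaries X in
     \<lparr>carrier = carrier Q, mult = mult Q, one = one Q, zero = zero Q, add = add Q,
      smult = (\<lambda>k A. \<Union>a\<in>A. cohomology_class X (k \<odot>\<^bsub>cocycle_algebra X\<^esub> a))\<rparr>)"

definition cohomology_degree :: "nat \<Rightarrow> 'a topology \<Rightarrow> ('a, 'k::field) cochain set set" where
  "cohomology_degree n X =
     {cohomology_class X z | z.
        z \<in> carrier (cocycle_algebra X) \<and> (\<forall>m. m \<noteq> n \<longrightarrow> z m = (\<lambda>\<sigma>. 0))}"

definition cohomology_map ::
    "'a topology \<Rightarrow> 'b topology \<Rightarrow> ('a \<Rightarrow> 'b) \<Rightarrow>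
     ('b, 'k::field) cochain set \<Rightarrow> ('a, 'k) cochain set" where
  "cohomology_map X Y f A =
     (\<Union>c\<in>A. cohomology_class X
        (\<lambda>n \<sigma>. if singular_simplex n X \<sigma> then c n (simplex_map n f \<sigma>) else 0))"

text \<open>The cohomology cross product, i.e. the Kuenneth map
  \<open>H\<^sup>*(X) \<otimes> H\<^sup>*(Y) \<rightarrow> H\<^sup>*(X \<times> Y)\<close> evaluated on \<open>a \<otimes> b\<close>.\<close>

definition cross_product ::
    "'a topology \<Rightarrow> 'b topology \<Rightarrow> ('a, 'k::field) cochain set \<Rightarrow> ('b, 'k) cochain set \<Rightarrow>
     ('a \<times> 'b, 'k) cochain set" where
  "cross_product X Y a b =
     cohomology_map (prod_topology X Y) X fst a
       \<otimes>\<^bsub>cohomology (prod_topology X Y)\<^esub> cohomology_map (prod_topology X Y) Y snd b"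

text \<open>Each \<open>H\<^sup>n(X; K)\<close> is finite dimensional. The first argument only names the field.\<close>

definition locally_finite_cohomology :: "'k::field itself \<Rightarrow> 'a topology \<Rightarrow> bool" where
  "locally_finite_cohomology K X \<longleftrightarrow>
     (let H = (cohomology X :: ('k, ('a, 'k) cochain set) module) in
      \<forall>n. \<exists>S. finite S \<and> S \<subseteq> cohomology_degree n X \<and>
        (\<forall>x \<in> cohomology_degree n X. \<exists>c. x = (\<Oplus>\<^bsub>H\<^esub>s\<in>S. c s \<odot>\<^bsub>H\<^esub> s)))"

text \<open>Isomorphisms of graded algebras; \<open>A\<^sub>d n\<close> and \<open>B\<^sub>d n\<close> are the parts of degree \<open>n\<close>.\<close>

definition graded_algebra_iso ::
    "('k, 'a) module \<Rightarrow> (nat \<Rightarrow> 'a set) \<Rightarrow> ('k, 'b) module \<Rightarrow> (nat \<Rightarrow> 'b set) \<Rightarrow> ('a \<Rightarrow> 'b) set"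
  where
  "graded_algebra_iso A A\<^sub>d B B\<^sub>d =
     {f \<in> ring_iso A B.
        (\<forall>k. \<forall>x \<in> carrier A. f (k \<odot>\<^bsub>A\<^esub> x) = k \<odot>\<^bsub>B\<^esub> f x) \<and>
        (\<forall>n. f ` A\<^sub>d n = B\<^sub>d n)}"


section \<open>Spaces of maps\<close>

text \<open>The points are the continuous maps, represented by functions that are
  \<^const>\<open>undefined\<close> outside the domain.\<close>

definition compact_open_topology :: "'a topology \<Rightarrow> 'b topology \<Rightarrow> ('a \<Rightarrow> 'b) topology" where
  "compact_open_topology X Y =
     topology_generated_by
       {{f \<in> extensional (topspace X). continuous_map X Y f \<and> f ` C \<subseteq> U} | C U.
          compactin X C \<and> openin Y U}"

lemma topspace_compact_open_topology:
  "topspace (compact_open_topology X Y) =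
     {f \<in> extensional (topspace X). continuous_map X Y f}"
proof -
  have "{f \<in> extensional (topspace X). continuous_map X Y f} \<in>
     {{f \<in> extensional (topspace X). continuous_map X Y f \<and> f ` C \<subseteq> U} | C U.
          compactin X C \<and> openin Y U}"
    by (intro CollectI exI[of _ "{}"]) auto
  then show ?thesis
    unfolding compact_open_topology_def topology_generated_by_topspace by blast
qed

definition free_loop_space :: "'a topology \<Rightarrow> (complex \<Rightarrow> 'a) topology" where
  "free_loop_space X = compact_open_topology (top_of_set (sphere 0 1)) X"


section \<open>Group actions on topological spaces\<close>

definition continuous_action ::
    "('g, 'r) monoid_scheme \<Rightarrow> 'a topology \<Rightarrow> ('g \<Rightarrow> 'a \<Rightarrow> 'a) \<Rightarrow> bool" where
  "continuous_action G X \<phi> \<longleftrightarrow>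
     group_action G (topspace X) \<phi> \<and> (\<forall>g \<in> carrier G. continuous_map X X (\<phi> g))"

text \<open>The set of orbits with the quotient topology.\<close>

definition orbit_space ::
    "('g, 'r) monoid_scheme \<Rightarrow> 'a topology \<Rightarrow> ('g \<Rightarrow> 'a \<Rightarrow> 'a) \<Rightarrow> 'a set topology" where
  "orbit_space G X \<phi> =
     topology (\<lambda>U. U \<subseteq> orbits G (topspace X) \<phi> \<and>
                   openin X {x \<in> topspace X. orbit G \<phi> x \<in> U})"

lemma openin_orbit_space:
  "openin (orbit_space G X \<phi>) U \<longleftrightarrow>
     U \<subseteq> orbits G (topspace X) \<phi> \<and> openin X {x \<in> topspace X. orbit G \<phi> x \<in> U}"
proof -
  have "istopology (\<lambda>U. U \<subseteq> orbits G (topspace X) \<phi> \<and>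
                        openin X {x \<in> topspace X. orbit G \<phi> x \<in> U})"
    unfolding istopology_def
  proof (intro conjI allI impI)
    fix S T
    assume S: "S \<subseteq> orbits G (topspace X) \<phi> \<and> openin X {x \<in> topspace X. orbit G \<phi> x \<in> S}"
      and T: "T \<subseteq> orbits G (topspace X) \<phi> \<and> openin X {x \<in> topspace X. orbit G \<phi> x \<in> T}"
    have "{x \<in> topspace X. orbit G \<phi> x \<in> S \<inter> T} =
          {x \<in> topspace X. orbit G \<phi> x \<in> S} \<inter> {x \<in> topspace X. orbit G \<phi> x \<in> T}" by auto
    then show "openin X {x \<in> topspace X. orbit G \<phi> x \<in> S \<inter> T}" using S T by auto
    show "S \<inter> T \<subseteq> orbits G (topspace X) \<phi>" using S by auto
  next
    fix \<K>
    assume K: "\<forall>K\<in>\<K>. K \<subseteq> orbits G (topspace X) \<phi> \<and>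
                      openin X {x \<in> topspace X. orbit G \<phi> x \<in> K}"
    have "{x \<in> topspace X. orbit G \<phi> x \<in> \<Union>\<K>} =
          (\<Union>K\<in>\<K>. {x \<in> topspace X. orbit G \<phi> x \<in> K})" by auto
    then show "openin X {x \<in> topspace X. orbit G \<phi> x \<in> \<Union>\<K>}" using K by auto
    show "\<Union>\<K> \<subseteq> orbits G (topspace X) \<phi>" using K by auto
  qed
  then show ?thesis
    by (simp add: orbit_space_def topology_inverse')
qed

lemma quotient_map_orbit_space: "quotient_map X (orbit_space G X \<phi>) (orbit G \<phi>)"
proof -
  have top: "topspace (orbit_space G X \<phi>) = orbits G (topspace X) \<phi>"
  proof
    show "topspace (orbit_space G X \<phi>) \<subseteq> orbits G (topspace X) \<phi>"
      using openin_orbit_space openin_topspace by metis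
    have "{x \<in> topspace X. orbit G \<phi> x \<in> orbits G (topspace X) \<phi>} = topspace X"
      by (auto simp: orbits_def)
    then have "openin (orbit_space G X \<phi>) (orbits G (topspace X) \<phi>)"
      by (simp add: openin_orbit_space)
    then show "orbits G (topspace X) \<phi> \<subseteq> topspace (orbit_space G X \<phi>)"
      by (rule openin_subset)
  qed
  show ?thesis
    unfolding quotient_map_def top by (auto simp: openin_orbit_space orbits_def)
qed

text \<open>\<open>E\<close> with the action \<open>\<epsilon>\<close> is a model of \<open>EG\<close>: a (nonempty) contractible space such that
  \<open>E \<rightarrow> E/G\<close> is a principal \<open>G\<close>-bundle. As \<open>G\<close> is discrete, local triviality amounts to every
  point having an open neighbourhood disjoint from all its translates by \<open>g \<noteq> 1\<close>; in particular
  the action is free. Nonemptiness is stated separately because \<^const>\<open>contractible_space\<close> holds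
  for the empty space.\<close>

definition universal_bundle ::
    "('g, 'r) monoid_scheme \<Rightarrow> 'e topology \<Rightarrow> ('g \<Rightarrow> 'e \<Rightarrow> 'e) \<Rightarrow> bool" where
  "universal_bundle G E \<epsilon> \<longleftrightarrow>
     continuous_action G E \<epsilon> \<and> topspace E \<noteq> {} \<and> contractible_space E \<and>
     (\<forall>e \<in> topspace E. \<exists>U. openin E U \<and> e \<in> U \<and>
        (\<forall>g \<in> carrier G. g \<noteq> \<one>\<^bsub>G\<^esub> \<longrightarrow> \<epsilon> g ` U \<inter> U = {}))"

text \<open>\<open>E \<times>\<^sub>G M\<close>, the orbit space of the diagonal action.\<close>

definition borel_construction ::
    "('g, 'r) monoid_scheme \<Rightarrow> 'e topology \<Rightarrow> ('g \<Rightarrow> 'e \<Rightarrow> 'e) \<Rightarrow>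
     'm topology \<Rightarrow> ('g \<Rightarrow> 'm \<Rightarrow> 'm) \<Rightarrow> ('e \<times> 'm) set topology" where
  "borel_construction G E \<epsilon> M \<phi> =
     orbit_space G (prod_topology E M) (\<lambda>g (e, x). (\<epsilon> g e, \<phi> g x))"

definition twisted_paths ::
    "'m topology \<Rightarrow> ('g \<Rightarrow> 'm \<Rightarrow> 'm) \<Rightarrow> 'g \<Rightarrow> (real \<Rightarrow> 'm) topology" where
  "twisted_paths M \<phi> g =
     subtopology (compact_open_topology (top_of_set {0..1}) M) {\<gamma>. \<gamma> 1 = \<phi> g (\<gamma> 0)}"

text \<open>\<open>\<P>\<^sub>G(M)\<close>; following \<^const>\<open>sum_topology\<close>, its points are written \<open>(g, \<gamma>)\<close>.\<close>

definition path_space ::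
    "('g, 'r) monoid_scheme \<Rightarrow> 'm topology \<Rightarrow> ('g \<Rightarrow> 'm \<Rightarrow> 'm) \<Rightarrow> ('g \<times> (real \<Rightarrow> 'm)) topology"
  where
  "path_space G M \<phi> = sum_topology (twisted_paths M \<phi>) (carrier G)"

definition path_space_action ::
    "('g, 'r) monoid_scheme \<Rightarrow> ('g \<Rightarrow> 'm \<Rightarrow> 'm) \<Rightarrow>
     'g \<Rightarrow> 'g \<times> (real \<Rightarrow> 'm) \<Rightarrow> 'g \<times> (real \<Rightarrow> 'm)" where
  "path_space_action G \<phi> h =
     (\<lambda>(g, \<gamma>). (h \<otimes>\<^bsub>G\<^esub> g \<otimes>\<^bsub>G\<^esub> inv\<^bsub>G\<^esub> h, \<lambda>t\<in>{0..1}. \<phi> h (\<gamma> t)))"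


section \<open>The cotensor product\<close>

text \<open>The map \<open>\<nabla>\<close> induced by the action \<open>G \<times> X \<rightarrow> X\<close> of the discrete group \<open>G\<close>. It takes values
  in \<open>H\<^sup>*(G \<times> X)\<close>, which the cross product identifies with \<open>H\<^sup>*(G) \<otimes> H\<^sup>*(X)\<close>.\<close>

definition coaction ::
    "('g, 'r) monoid_scheme \<Rightarrow> 'a topology \<Rightarrow> ('g \<Rightarrow> 'a \<Rightarrow> 'a) \<Rightarrow>
     ('a, 'k::field) cochain set \<Rightarrow> ('g \<times> 'a, 'k) cochain set" where
  "coaction G X \<phi> =
     cohomology_map (prod_topology (discrete_topology (carrier G)) X) X (\<lambda>(g, x). \<phi> g x)"

text \<open>The cotensor product of the trivial comodule \<open>K\<close> with \<open>H\<^sup>*(X; K)\<close> over the dual of the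
  group ring, as the subalgebra of those \<open>x\<close> with \<open>\<nabla>(x) = 1 \<otimes> x\<close>.\<close>

definition cotensor ::
    "('g, 'r) monoid_scheme \<Rightarrow> 'a topology \<Rightarrow> ('g \<Rightarrow> 'a \<Rightarrow> 'a) \<Rightarrow>
     ('k::field, ('a, 'k) cochain set) module" where
  "cotensor G X \<phi> =
     (cohomology X)\<lparr>carrier := {x \<in> carrier (cohomology X).
        coaction G X \<phi> x =
          cross_product (discrete_topology (carrier G)) X
            \<one>\<^bsub>cohomology (discrete_topology (carrier G))\<^esub> x}\<rparr>"

definition cotensor_degree ::
    "('g, 'r) monoid_scheme \<Rightarrow> 'a topology \<Rightarrow> ('g \<Rightarrow> 'a \<Rightarrow> 'a) \<Rightarrow>
     nat \<Rightarrow> ('a, 'k::field) cochain set set" where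
  "cotensor_degree G X \<phi> n = carrier (cotensor G X \<phi>) \<inter> cohomology_degree n X"

end

theory Submission
  imports Defs "HOL-Library.Function_Algebras"
begin

text \<open>
  Let \<open>Y = E \<times> M\<close> with the diagonal action, so that \<open>Y \<rightarrow> Y/G\<close> is a covering and \<open>Y/G\<close> is the
  Borel construction. A loop in \<open>Y/G\<close> lifts to a path \<open>\<gamma>\<close> in \<open>Y\<close>; its end is \<open>g \<cdot> \<gamma>(0)\<close> for some
  \<open>g \<in> G\<close>, and the action being free, this \<open>g\<close> is unique. Two lifts of the same loop differ by an
  element of \<open>G\<close>. So the free loop space of \<open>Y/G\<close> is \<open>\<P>\<^sub>G(Y)\<close> modulo \<open>G\<close>. For singular cohomology
  it is enough to know this simplex by simplex: the projection is continuous, every singular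
  simplex of the loop space lifts, and its lifts form a single \<open>G\<close>-orbit
  (\<open>loop_orbit_map\<close>). By the exponential law, a simplex of loops is a map \<open>\<Delta>\<^sup>n \<times> S\<^sup>1 \<rightarrow> Y/G\<close>, so its lift is a lift of a map on the contractible
  space \<open>\<Delta>\<^sup>n \<times> [0,1]\<close> (\<open>contractible_space_lift\<close>).

  It follows that the cochains of the loop space are exactly the \<open>G\<close>-invariant cochains of
  \<open>\<P>\<^sub>G(Y)\<close>. As \<open>|G|\<close> is invertible in the field, averaging over \<open>G\<close> turns invariant classes into
  classes of invariant cocycles, and the cohomology of the loop space becomes the algebra of
  \<open>G\<close>-invariant classes of \<open>\<P>\<^sub>G(Y)\<close> (\<open>inj_on_cohomology_map_q\<close>, \<open>cohomology_map_q_image\<close>).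

  The factor \<open>E\<close> is contractible and can be dropped. The projection
  \<open>\<P>\<^sub>G(E \<times> M) \<rightarrow> \<P>\<^sub>G(M)\<close> is equivariant; it has a section, which in each component \<open>g\<close> adds a fixed
  path from a base point \<open>e\<^sub>0\<close> to \<open>g e\<^sub>0\<close>, and going down and up again is homotopic to the
  identity. The section need not be equivariant, but it induces the inverse in cohomology of an
  equivariant map and therefore matches the invariant classes
  (\<open>cohomology_map_section_bij\<close>). Finally \<open>\<nabla>(x) = 1 \<otimes> x\<close> says that every element of \<open>G\<close> fixes
  \<open>x\<close>, because the product of the discrete group with a space is a disjoint union of copies of that
  space (\<open>cotensor_condition_iff\<close>).

  The resulting isomorphism is induced by one continuous map, the section followed by the
  projection to loops. So it is compatible with cup products, scalars and degrees, once the cup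
  product is known to be defined on classes (the Leibniz rule \<open>coboundary_cup\<close>). That homotopic
  maps induce the same map in cohomology is shown with the prism operator
  (\<open>prism_cochain_homotopy\<close>).
\<close>

section \<open>Cochains\<close>

lemma sum_fun_apply: "(\<Sum>i\<in>I. f i) x = (\<Sum>i\<in>I. f i x)"
  by (induction I rule: infinite_finite_induct) simp_all

lemma restrict_eq_extensional: "f \<in> extensional A \<Longrightarrow> (\<And>x. x \<in> A \<Longrightarrow> g x = f x) \<Longrightarrow> restrict g A = f"
  by (auto simp: fun_eq_iff extensional_def)

abbreviation cocycles :: "'a topology \<Rightarrow> ('a, 'k::field) cochain set" where
  "cocycles X \<equiv> {c \<in> cochains X. coboundary X c = 0}"

definition scale_cochain :: "'k::field \<Rightarrow> ('a, 'k) cochain \<Rightarrow> ('a, 'k) cochain" where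
  "scale_cochain k c = (\<lambda>n \<sigma>. k * c n \<sigma>)"

lemma scale_cochain_apply [simp]: "scale_cochain k c n \<sigma> = k * c n \<sigma>"
  by (simp add: scale_cochain_def)

definition unit_cochain :: "'a topology \<Rightarrow> ('a, 'k::field) cochain" where
  "unit_cochain X = (\<lambda>n \<sigma>. if n = 0 \<and> singular_simplex 0 X \<sigma> then 1 else 0)"

lemma cocycle_algebra_sel:
  "carrier (cocycle_algebra X) = cocycles X"
  "mult (cocycle_algebra X) = cup X"
  "one (cocycle_algebra X) = unit_cochain X"
  "zero (cocycle_algebra X) = 0"
  "add (cocycle_algebra X) = (+)"
  "smult (cocycle_algebra X) = scale_cochain"
  by (auto simp: cocycle_algebra_def unit_cochain_def scale_cochain_def fun_eq_iff)

lemma cochainsI: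
  assumes "\<And>n \<sigma>. n > N \<Longrightarrow> c n \<sigma> = 0" "\<And>n \<sigma>. \<not> singular_simplex n X \<sigma> \<Longrightarrow> c n \<sigma> = 0"
  shows "c \<in> cochains X"
proof -
  have "{n. \<exists>\<sigma>. c n \<sigma> \<noteq> 0} \<subseteq> {..N}"
    using assms(1) not_le by auto
  then show ?thesis
    using assms(2) finite_subset[OF _ finite_atMost] unfolding cochains_def by blast
qed

lemma cochains_bounded:
  assumes "c \<in> cochains X"
  shows "\<exists>N. \<forall>n>N. \<forall>\<sigma>. c n \<sigma> = 0"
proof -
  obtain N where "\<forall>n\<in>{n. \<exists>\<sigma>. c n \<sigma> \<noteq> 0}. n \<le> N"
    using assms finite_nat_set_iff_bounded_le by (auto simp: cochains_def)
  then show ?thesis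
    by (metis (mono_tags, lifting) mem_Collect_eq not_le)
qed

lemma cochain_outside: "c \<in> cochains X \<Longrightarrow> \<not> singular_simplex n X \<sigma> \<Longrightarrow> c n \<sigma> = 0"
  by (simp add: cochains_def)

lemma cochain_eqI:
  assumes "c \<in> cochains X" "d \<in> cochains X" "\<And>n \<sigma>. singular_simplex n X \<sigma> \<Longrightarrow> c n \<sigma> = d n \<sigma>"
  shows "c = d"
  using assms by (intro ext) (metis cochain_outside)

lemma zero_in_cochains [simp]: "0 \<in> cochains X"
  by (simp add: cochains_def)

lemma add_in_cochains:
  assumes "c \<in> cochains X" "d \<in> cochains X" shows "c + d \<in> cochains X"
proof -
  obtain M where M: "\<And>n \<sigma>. n > M \<Longrightarrow> c n \<sigma> = 0" using cochains_bounded[OF assms(1)] by blast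
  obtain N where N: "\<And>n \<sigma>. n > N \<Longrightarrow> d n \<sigma> = 0" using cochains_bounded[OF assms(2)] by blast
  show ?thesis
    by (rule cochainsI[of "max M N"]) (simp_all add: M N assms[THEN cochain_outside])
qed

lemma scale_in_cochains: "c \<in> cochains X \<Longrightarrow> scale_cochain k c \<in> cochains X"
  using cochains_bounded[of c X] by (auto intro!: cochainsI simp: cochain_outside)

lemma uminus_in_cochains: "c \<in> cochains X \<Longrightarrow> - c \<in> cochains X"
  using scale_in_cochains[of c X "-1"]
  by (simp add: scale_cochain_def fun_Compl_def)

lemma diff_in_cochains: "c \<in> cochains X \<Longrightarrow> d \<in> cochains X \<Longrightarrow> c - d \<in> cochains X"
  using add_in_cochains[of c X "-d"] by (simp add: uminus_in_cochains)

lemma sum_in_cochains: "(\<And>i. i \<in> I \<Longrightarrow> c i \<in> cochains X) \<Longrightarrow> (\<Sum>i\<in>I. c i) \<in> cochains X"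
  by (induction I rule: infinite_finite_induct) (simp_all add: add_in_cochains)

lemma cup_in_cochains:
  assumes "c \<in> cochains X" "d \<in> cochains X" shows "cup X c d \<in> cochains X"
proof -
  obtain M where M: "\<And>n \<sigma>. n > M \<Longrightarrow> c n \<sigma> = 0" using cochains_bounded[OF assms(1)] by blast
  obtain N where N: "\<And>n \<sigma>. n > N \<Longrightarrow> d n \<sigma> = 0" using cochains_bounded[OF assms(2)] by blast
  show ?thesis
  proof (rule cochainsI[of "M + N"])
    fix n \<sigma> assume "n > M + N"
    then have "p > M \<or> n - p > N" for p by linarith
    then have "c p (front_face p \<sigma>) * d (n - p) (back_face p (n - p) \<sigma>) = 0" for p
      using M N by (metis mult_eq_0_iff)
    then show "cup X c d n \<sigma> = 0"
      unfolding cup_def by (simp only: sum.neutral_const if_cancel)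
  qed (simp add: cup_def)
qed

lemma coboundary_in_cochains:
  assumes "c \<in> cochains X" shows "coboundary X c \<in> cochains X"
proof -
  obtain M where M: "\<And>n \<sigma>. n > M \<Longrightarrow> c n \<sigma> = 0" using cochains_bounded[OF assms(1)] by blast
  show ?thesis
    by (rule cochainsI[of "Suc M"]) (auto simp: coboundary_def M)
qed

lemma coboundary_0 [simp]: "coboundary X 0 = 0"
  by (simp add: coboundary_def fun_eq_iff)

lemma coboundary_add: "coboundary X (c + d) = coboundary X c + coboundary X d"
  by (simp add: coboundary_def fun_eq_iff ring_distribs sum.distrib)

lemma coboundary_scale: "coboundary X (scale_cochain k c) = scale_cochain k (coboundary X c)"
  by (simp add: coboundary_def fun_eq_iff sum_distrib_left mult.left_commute)

lemma coboundary_uminus: "coboundary X (- c) = - coboundary X c"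
  by (simp add: coboundary_def fun_eq_iff sum_negf)

lemma coboundary_diff: "coboundary X (c - d) = coboundary X c - coboundary X d"
  using coboundary_add[of X c "-d"] by (simp add: coboundary_uminus)

lemma coboundary_sum: "coboundary X (\<Sum>i\<in>I. c i) = (\<Sum>i\<in>I. coboundary X (c i))"
  by (induction I rule: infinite_finite_induct) (simp_all add: coboundary_add del: plus_fun_apply zero_fun_apply)

text \<open>The simplicial identity behind \<open>\<delta> \<circ> \<delta> = 0\<close>.\<close>

lemma singular_face_singular_face:
  assumes "i \<le> j" "j \<le> Suc n"
  shows "singular_face (Suc n) i (singular_face (Suc (Suc n)) (Suc j) \<sigma>) =
         singular_face (Suc n) j (singular_face (Suc (Suc n)) i \<sigma>)"
proof -
  have "simplical_face (Suc j) (simplical_face i t) = simplical_face i (simplical_face j t)" for t :: "nat \<Rightarrow> real"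
    using assms unfolding simplical_face_def by (fastforce split: if_splits)
  then show ?thesis
    using simplical_face_in_standard_simplex[of "Suc n" i] simplical_face_in_standard_simplex[of "Suc n" j] assms
    by (intro ext) (auto simp: singular_face_def)
qed

lemma singular_simplex_face:
  "singular_simplex (Suc n) X \<sigma> \<Longrightarrow> i \<le> Suc n \<Longrightarrow> singular_simplex n X (singular_face (Suc n) i \<sigma>)"
  using singular_simplex_singular_face[of "Suc n"] by simp

lemma coboundary_Suc:
  "singular_simplex (Suc n) X \<sigma> \<Longrightarrow>
    coboundary X c (Suc n) \<sigma> = (\<Sum>i\<le>Suc n. (-1) ^ i * c n (singular_face (Suc n) i \<sigma>))"
  by (simp add: coboundary_def)

lemma coboundary_at_0 [simp]: "coboundary X c 0 \<sigma> = 0"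
  by (simp add: coboundary_def)

text \<open>The map \<open>(i, j) \<mapsto> (j + 1, i)\<close> carries the pairs with \<open>i \<le> j\<close> to those with \<open>j < i\<close> and
  changes the sign.\<close>

lemma alternating_double_sum_zero:
  fixes F :: "nat \<Rightarrow> nat \<Rightarrow> 'k::field"
  assumes "\<And>i j. i \<le> j \<Longrightarrow> j \<le> n \<Longrightarrow> F (Suc j) i = F i j"
  shows "(\<Sum>i\<le>Suc n. \<Sum>j\<le>n. (-1) ^ (i + j) * F i j) = 0"
proof -
  let ?f = "\<lambda>(i, j). (-1) ^ (i + j) * F i j"
  let ?L = "{(i, j). i \<le> Suc n \<and> j \<le> n \<and> j < i}" and ?U = "{(i, j). i \<le> j \<and> j \<le> n}"
  have fin: "finite ?L" "finite ?U"
    by (rule finite_subset[of _ "{..Suc n} \<times> {..n}"]; force)+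
  have "(\<Sum>i\<le>Suc n. \<Sum>j\<le>n. (-1) ^ (i + j) * F i j) = sum ?f ({..Suc n} \<times> {..n})"
    by (rule sum.cartesian_product)
  also have "{..Suc n} \<times> {..n} = ?L \<union> ?U"
    by auto
  also have "sum ?f (?L \<union> ?U) = sum ?f ?L + sum ?f ?U"
    by (rule sum.union_disjoint[OF fin]) auto
  also have "sum ?f ?L = (\<Sum>(i, j)\<in>?U. - ((-1) ^ (i + j) * F i j))"
  proof (rule sum.reindex_bij_witness[of _ "\<lambda>(i, j). (Suc j, i)" "\<lambda>(i, j). (j, i - 1)"])
    fix x assume "x \<in> ?L"
    then obtain i j where x: "x = (i, j)" "i \<le> Suc n" "j \<le> n" "j < i" by blast
    then obtain k where k: "i = Suc k" by (cases i) auto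
    have "F (Suc k) j = F j k"
      using assms[of j k] x k by simp
    then show "(case (\<lambda>(i, j). (j, i - 1)) x of (i, j) \<Rightarrow> - ((-1) ^ (i + j) * F i j)) = ?f x"
      by (simp add: x(1) k add.commute)
    show "(\<lambda>(i, j). (Suc j, i)) ((\<lambda>(i, j). (j, i - 1)) x) = x" "(\<lambda>(i, j). (j, i - 1)) x \<in> ?U"
      using x k by simp_all
  qed auto
  finally show ?thesis
    by (simp add: sum_negf split_def)
qed

lemma coboundary_coboundary: "coboundary X (coboundary X c) = 0"
proof (intro ext)
  fix n and \<sigma> :: "(nat \<Rightarrow> real) \<Rightarrow> 'a"
  show "coboundary X (coboundary X c) n \<sigma> = 0 n \<sigma>"
  proof (cases "singular_simplex n X \<sigma> \<and> n \<ge> 2")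
    case False
    then consider "\<not> singular_simplex n X \<sigma>" | "n = 0" | "n = Suc 0" by linarith
    then show ?thesis
      by cases (simp_all add: coboundary_def)
  next
    case True
    then obtain m where n: "n = Suc (Suc m)"
      by (metis add_2_eq_Suc le_Suc_ex)
    have "coboundary X (coboundary X c) n \<sigma> = (\<Sum>i\<le>Suc (Suc m). (-1) ^ i *
        (\<Sum>j\<le>Suc m. (-1) ^ j * c m (singular_face (Suc m) j (singular_face (Suc (Suc m)) i \<sigma>))))"
      unfolding n using True
    proof (subst coboundary_Suc)
      show "singular_simplex (Suc (Suc m)) X \<sigma>"
        using True n by simp
      then have "coboundary X c (Suc m) (singular_face (Suc (Suc m)) i \<sigma>) = (\<Sum>j\<le>Suc m. (-1) ^ j *
          c m (singular_face (Suc m) j (singular_face (Suc (Suc m)) i \<sigma>)))" if "i \<le> Suc (Suc m)" for i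
        using that by (intro coboundary_Suc singular_simplex_face)
      then show "(\<Sum>i\<le>Suc (Suc m). (-1) ^ i * coboundary X c (Suc m) (singular_face (Suc (Suc m)) i \<sigma>)) =
        (\<Sum>i\<le>Suc (Suc m). (-1) ^ i *
        (\<Sum>j\<le>Suc m. (-1) ^ j * c m (singular_face (Suc m) j (singular_face (Suc (Suc m)) i \<sigma>))))"
        by (intro sum.cong refl) simp
    qed
    also have "\<dots> = (\<Sum>i\<le>Suc (Suc m). \<Sum>j\<le>Suc m. (-1) ^ (i + j) *
        c m (singular_face (Suc m) j (singular_face (Suc (Suc m)) i \<sigma>)))"
      by (simp add: sum_distrib_left power_add mult.assoc del: sum.atMost_Suc)
    also have "\<dots> = 0"
      by (rule alternating_double_sum_zero) (simp add: singular_face_singular_face)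
    finally show ?thesis by simp
  qed
qed


section \<open>The Leibniz rule\<close>

text \<open>The inclusion of the back face \<open>[e\<^sub>p, \<dots>, e\<^sub>p\<^sub>+\<^sub>q]\<close>.\<close>

lemma shift_in_standard_simplex:
  assumes "t \<in> standard_simplex q"
  shows "(\<lambda>i. if i < p then 0 else t (i - p)) \<in> standard_simplex (p + q)"
proof -
  have "(\<Sum>i\<le>p + q. if i < p then 0 else t (i - p)) = (\<Sum>i\<in>{p..p + q}. t (i - p))"
    by (rule sum.mono_neutral_cong_right) auto
  also have "\<dots> = (\<Sum>i\<le>q. t i)"
    by (rule sum.reindex_bij_witness[of _ "\<lambda>i. i + p" "\<lambda>i. i - p"]) auto
  finally show ?thesis
    using assms by (auto simp: standard_simplex_def)
qed

lemma singular_simplex_front_face: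
  assumes "singular_simplex n X \<sigma>" "p \<le> n"
  shows "singular_simplex p X (front_face p \<sigma>)"
proof -
  have "continuous_map (subtopology (powertop_real UNIV) (standard_simplex p)) X \<sigma>"
    using assms standard_simplex_mono unfolding singular_simplex_def
    by (meson continuous_map_from_subtopology_mono)
  then show ?thesis
    unfolding singular_simplex_def front_face_def by (auto intro: continuous_map_eq)
qed

lemma singular_simplex_back_face:
  assumes "singular_simplex n X \<sigma>" "n = p + q"
  shows "singular_simplex q X (back_face p q \<sigma>)"
proof -
  let ?s = "\<lambda>x i. if i < p then 0 else x (i - p) :: real"
  have "continuous_map (powertop_real UNIV) (powertop_real UNIV) ?s"
    unfolding continuous_map_componentwise by (auto intro: continuous_map_product_projection)
  then have "continuous_map (subtopology (powertop_real UNIV) (standard_simplex q))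
      (subtopology (powertop_real UNIV) (standard_simplex n)) ?s"
    using assms(2) shift_in_standard_simplex
    by (auto simp: continuous_map_in_subtopology continuous_map_from_subtopology)
  then have "continuous_map (subtopology (powertop_real UNIV) (standard_simplex q)) X (\<sigma> \<circ> ?s)"
    using assms(1) unfolding singular_simplex_def by (blast intro: continuous_map_compose)
  then show ?thesis
    unfolding singular_simplex_def back_face_def by (auto intro: continuous_map_eq)
qed

text \<open>The four lemmas that follow describe the front and the back part of the \<open>i\<close>-th face of a simplex
  \<open>[e\<^sub>0, \<dots>, e\<^sub>n\<^sub>+\<^sub>1]\<close>, cut at the \<open>p\<close>-th vertex of that face. Omitting \<open>e\<^sub>i\<close> with \<open>i \<le> p\<close> shortens the
  front part and moves the cut to \<open>e\<^sub>p\<^sub>+\<^sub>1\<close>; omitting it with \<open>i > p\<close> shortens the back part.\<close>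

lemma front_face_singular_face_low:
  assumes "p \<le> n" "i \<le> p"
  shows "front_face p (singular_face (Suc n) i \<sigma>) = singular_face (Suc p) i (front_face (Suc p) \<sigma>)"
  using assms standard_simplex_mono[of p n] simplical_face_in_standard_simplex[of "Suc p" i]
  by (intro ext) (auto simp: front_face_def singular_face_def)

lemma back_face_singular_face_low:
  assumes "p \<le> n" "i \<le> p"
  shows "back_face p (n - p) (singular_face (Suc n) i \<sigma>) = back_face (Suc p) (n - p) \<sigma>"
proof -
  have "simplical_face i (\<lambda>i. if i < p then 0 else t (i - p)) =
      (\<lambda>i. if i < Suc p then 0 else t (i - Suc p))" for t :: "nat \<Rightarrow> real"
    using assms by (fastforce simp: simplical_face_def fun_eq_iff)
  then show ?thesis
    using shift_in_standard_simplex[of _ "n - p" p] assms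
    by (intro ext) (auto simp: back_face_def singular_face_def)
qed

lemma front_face_singular_face_high:
  assumes "p \<le> n" "p < i" "i \<le> Suc n"
  shows "front_face p (singular_face (Suc n) i \<sigma>) = front_face p \<sigma>"
proof -
  have "simplical_face i t = t" if "t \<in> standard_simplex p" for t
    using that assms by (auto simp: simplical_face_def standard_simplex_def fun_eq_iff)
  then show ?thesis
    using standard_simplex_mono[OF assms(1)]
    by (intro ext) (auto simp: front_face_def singular_face_def)
qed

lemma back_face_singular_face_high:
  assumes "p \<le> n" "p + k \<le> Suc n"
  shows "back_face p (n - p) (singular_face (Suc n) (p + k) \<sigma>) =
    singular_face (Suc (n - p)) k (back_face p (Suc (n - p)) \<sigma>)"
proof -
  have "simplical_face (p + k) (\<lambda>i. if i < p then 0 else t (i - p)) =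
      (\<lambda>i. if i < p then 0 else simplical_face k t (i - p))" for t :: "nat \<Rightarrow> real"
    by (auto simp: simplical_face_def fun_eq_iff)
  then show ?thesis
    using shift_in_standard_simplex[of _ "n - p" p] simplical_face_in_standard_simplex[of "Suc (n - p)" k] assms
    by (intro ext) (auto simp: back_face_def singular_face_def)
qed

lemma singular_face_front_face_last:
  "singular_face (Suc p) (Suc p) (front_face (Suc p) \<sigma>) = front_face p \<sigma>"
proof -
  have "simplical_face (Suc p) t = t" if "t \<in> standard_simplex p" for t
    using that by (auto simp: simplical_face_def standard_simplex_def fun_eq_iff)
  then show ?thesis
    using standard_simplex_mono[of p "Suc p"]
    by (intro ext) (auto simp: front_face_def singular_face_def)
qed

lemma singular_face_back_face_0:
  "singular_face (Suc q) 0 (back_face p (Suc q) \<sigma>) = back_face (Suc p) q \<sigma>"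
proof -
  have "(\<lambda>i. if i < p then 0 else simplical_face 0 t (i - p)) =
      (\<lambda>i. if i < Suc p then 0 else t (i - Suc p))" for t :: "nat \<Rightarrow> real"
    by (auto simp: simplical_face_def fun_eq_iff)
  then show ?thesis
    using simplical_face_in_standard_simplex[of "Suc q" 0]
    by (intro ext) (auto simp: back_face_def singular_face_def)
qed

text \<open>Cochains may have components in several degrees, so the sign \<open>(-1)\<^bsup>|a|\<^esup>\<close> of the Leibniz rule
  is an operator.\<close>

definition grade_sign :: "('a, 'k::field) cochain \<Rightarrow> ('a, 'k) cochain" where
  "grade_sign c = (\<lambda>n \<sigma>. (-1) ^ n * c n \<sigma>)"

lemma grade_sign_grade_sign [simp]: "grade_sign (grade_sign c) = c"
  by (simp add: grade_sign_def fun_eq_iff flip: mult.assoc power_add mult_2)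

lemma grade_sign_in_cochains: "c \<in> cochains X \<Longrightarrow> grade_sign c \<in> cochains X"
  using cochains_bounded[of c X] by (auto intro!: cochainsI simp: cochain_outside grade_sign_def)

lemma coboundary_grade_sign: "coboundary X (grade_sign c) = - grade_sign (coboundary X c)"
proof (intro ext)
  fix n \<sigma>
  show "coboundary X (grade_sign c) n \<sigma> = (- grade_sign (coboundary X c)) n \<sigma>"
    by (cases n) (simp_all add: coboundary_def grade_sign_def sum_distrib_left mult.left_commute
        del: sum.atMost_Suc flip: sum_negf)
qed

text \<open>The contribution of one cut \<open>p\<close> to the Leibniz rule. Both sides list the faces that omit a vertex of
  the front part and those that omit a vertex of the back part. The right-hand side contains two
  more terms, which cancel.\<close>

lemma cup_face_sum:
  fixes a b :: "('a, 'k::field) cochain"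
  assumes "p \<le> m"
  shows "(\<Sum>i\<le>Suc m. (-1) ^ i * (a p (front_face p (singular_face (Suc m) i \<sigma>)) *
             b (m - p) (back_face p (m - p) (singular_face (Suc m) i \<sigma>)))) =
    (\<Sum>i\<le>Suc p. (-1) ^ i * a p (singular_face (Suc p) i (front_face (Suc p) \<sigma>))) *
      b (m - p) (back_face (Suc p) (m - p) \<sigma>) +
    (-1) ^ p * a p (front_face p \<sigma>) *
      (\<Sum>k\<le>Suc (m - p). (-1) ^ k * b (m - p) (singular_face (Suc (m - p)) k (back_face p (Suc (m - p)) \<sigma>)))"
    (is "(\<Sum>i\<le>Suc m. ?f i) = ?T1 + ?T2")
proof -
  let ?A = "a p (front_face p \<sigma>)" and ?B = "b (m - p) (back_face (Suc p) (m - p) \<sigma>)"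
  let ?g = "\<lambda>i. (-1) ^ i * a p (singular_face (Suc p) i (front_face (Suc p) \<sigma>))"
  let ?h = "\<lambda>k. (-1) ^ k * b (m - p) (singular_face (Suc (m - p)) k (back_face p (Suc (m - p)) \<sigma>))"
  have "{..Suc m} = {..p} \<union> {Suc p..Suc m}" "{..p} \<inter> {Suc p..Suc m} = {}"
    using assms by auto
  then have "(\<Sum>i\<le>Suc m. ?f i) = (\<Sum>i\<le>p. ?f i) + (\<Sum>i=Suc p..Suc m. ?f i)"
    by (simp add: sum.union_disjoint del: sum.cl_ivl_Suc)
  also have "(\<Sum>i\<le>p. ?f i) = (\<Sum>i\<le>p. ?g i) * ?B"
    unfolding sum_distrib_right
    using assms by (intro sum.cong refl)
      (simp add: front_face_singular_face_low back_face_singular_face_low)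
  also have "(\<Sum>i=Suc p..Suc m. ?f i) = (\<Sum>k\<le>m - p. (-1) ^ p * ?A * ?h (Suc k))"
  proof (rule sum.reindex_bij_witness[of _ "\<lambda>k. p + Suc k" "\<lambda>i. i - Suc p"])
    fix i assume i: "i \<in> {Suc p..Suc m}"
    then obtain k where k: "i = p + Suc k"
      by (metis add_Suc_right add_Suc_shift atLeastAtMost_iff le_Suc_ex)
    then have "p + Suc k \<le> Suc m" using i by simp
    then show "(-1) ^ p * ?A * ?h (Suc (i - Suc p)) = ?f i"
      using assms front_face_singular_face_high[of p m i \<sigma>] back_face_singular_face_high[of p m "Suc k" \<sigma>] k
      by (simp add: power_add)
  qed (use assms in auto)
  also have "\<dots> = (-1) ^ p * ?A * (\<Sum>k\<le>m - p. ?h (Suc k))"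
    by (simp only: sum_distrib_left)
  finally have eq: "(\<Sum>i\<le>Suc m. ?f i) =
      (\<Sum>i\<le>p. ?g i) * ?B + (-1) ^ p * ?A * (\<Sum>k\<le>m - p. ?h (Suc k))" .
  \<comment> \<open>The last face of the longer front part and the initial face of the longer back part give the
    same pair of faces, \<open>[e\<^sub>0, \<dots>, e\<^sub>p]\<close> and \<open>[e\<^sub>p\<^sub>+\<^sub>1, \<dots>, e\<^sub>m\<^sub>+\<^sub>1]\<close>, with opposite signs.\<close>
  have "?T1 = ((\<Sum>i\<le>p. ?g i) - (-1) ^ p * ?A) * ?B"
    by (simp add: singular_face_front_face_last)
  moreover have "?T2 = (-1) ^ p * ?A * (?B + (\<Sum>k\<le>m - p. ?h (Suc k)))"
    by (subst sum.atMost_Suc_shift) (simp add: singular_face_back_face_0)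
  ultimately show ?thesis
    unfolding eq by (simp only: ring_distribs) (simp only: mult_ac add_diff_cancel diff_add_cancel algebra_simps)
qed

lemma coboundary_cup:
  "coboundary X (cup X a b) = cup X (coboundary X a) b + cup X (grade_sign a) (coboundary X b)"
proof (intro ext)
  fix n \<sigma>
  show "coboundary X (cup X a b) n \<sigma> =
    (cup X (coboundary X a) b + cup X (grade_sign a) (coboundary X b)) n \<sigma>"
  proof (cases "singular_simplex n X \<sigma> \<and> n > 0")
    case False
    then show ?thesis
      by (auto simp: coboundary_def cup_def)
  next
    case True
    then obtain m where n: "n = Suc m" and \<sigma>: "singular_simplex (Suc m) X \<sigma>"
      using gr0_implies_Suc by blast
    let ?g = "\<lambda>p. \<Sum>i\<le>Suc p. (-1) ^ i * a p (singular_face (Suc p) i (front_face (Suc p) \<sigma>))"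
    let ?h = "\<lambda>p. \<Sum>k\<le>Suc (m - p). (-1) ^ k *
      b (m - p) (singular_face (Suc (m - p)) k (back_face p (Suc (m - p)) \<sigma>))"
    have "coboundary X (cup X a b) n \<sigma> = (\<Sum>i\<le>Suc m. (-1) ^ i *
       (\<Sum>p\<le>m. a p (front_face p (singular_face (Suc m) i \<sigma>)) *
             b (m - p) (back_face p (m - p) (singular_face (Suc m) i \<sigma>))))"
      unfolding n coboundary_Suc[OF \<sigma>]
      using \<sigma> by (intro sum.cong refl) (simp add: cup_def singular_simplex_face)
    also have "\<dots> = (\<Sum>p\<le>m. \<Sum>i\<le>Suc m. (-1) ^ i * (a p (front_face p (singular_face (Suc m) i \<sigma>)) *
             b (m - p) (back_face p (m - p) (singular_face (Suc m) i \<sigma>))))"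
      unfolding sum_distrib_left by (rule sum.swap)
    also have "\<dots> = (\<Sum>p\<le>m. ?g p * b (m - p) (back_face (Suc p) (m - p) \<sigma>) +
        (-1) ^ p * a p (front_face p \<sigma>) * ?h p)"
      by (intro sum.cong refl cup_face_sum) simp
    also have "\<dots> = (\<Sum>p\<le>m. ?g p * b (m - p) (back_face (Suc p) (m - p) \<sigma>)) +
        (\<Sum>p\<le>m. (-1) ^ p * a p (front_face p \<sigma>) * ?h p)"
      by (rule sum.distrib)
    also have "(\<Sum>p\<le>m. ?g p * b (m - p) (back_face (Suc p) (m - p) \<sigma>)) =
        (\<Sum>p\<le>m. coboundary X a (Suc p) (front_face (Suc p) \<sigma>) * b (m - p) (back_face (Suc p) (m - p) \<sigma>))"
      using singular_simplex_front_face[OF \<sigma>]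
      by (intro sum.cong refl) (simp add: coboundary_Suc del: sum.atMost_Suc)
    also have "\<dots> = cup X (coboundary X a) b n \<sigma>"
      using \<sigma> by (simp add: cup_def n sum.atMost_Suc_shift del: sum.atMost_Suc)
    also have "(\<Sum>p\<le>m. (-1) ^ p * a p (front_face p \<sigma>) * ?h p) =
        (\<Sum>p\<le>m. grade_sign a p (front_face p \<sigma>) * coboundary X b (Suc m - p) (back_face p (Suc m - p) \<sigma>))"
    proof (intro sum.cong refl)
      fix p assume "p \<in> {..m}"
      then have "singular_simplex (Suc (m - p)) X (back_face p (Suc (m - p)) \<sigma>)" "Suc m - p = Suc (m - p)"
        by (auto intro: singular_simplex_back_face[OF \<sigma>])
      then show "(-1) ^ p * a p (front_face p \<sigma>) * ?h p =
          grade_sign a p (front_face p \<sigma>) * coboundary X b (Suc m - p) (back_face p (Suc m - p) \<sigma>)"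
        by (simp add: coboundary_Suc grade_sign_def del: sum.atMost_Suc)
    qed
    also have "\<dots> = cup X (grade_sign a) (coboundary X b) n \<sigma>"
      using \<sigma> by (simp add: cup_def n)
    finally show ?thesis by simp
  qed
qed

lemma cup_add_left: "cup X (a + b) c = cup X a c + cup X b c"
  by (simp add: cup_def fun_eq_iff ring_distribs sum.distrib)

lemma cup_add_right: "cup X a (b + c) = cup X a b + cup X a c"
  by (simp add: cup_def fun_eq_iff ring_distribs sum.distrib)

lemma cup_0_left [simp]: "cup X 0 b = 0"
  by (simp add: cup_def fun_eq_iff)

lemma cup_0_right [simp]: "cup X a 0 = 0"
  by (simp add: cup_def fun_eq_iff)

lemma unit_cochain_in_cocycles: "unit_cochain X \<in> cocycles X"
proof -
  have "coboundary X (unit_cochain X) n \<sigma> = 0" for n \<sigma>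
  proof (cases "singular_simplex n X \<sigma> \<and> n > 0")
    case True
    then obtain m where "n = Suc m" "singular_simplex (Suc m) X \<sigma>"
      using gr0_implies_Suc by blast
    then show ?thesis
      by (cases m) (simp_all add: coboundary_Suc unit_cochain_def singular_simplex_face[where n=0, simplified])
  qed (auto simp: coboundary_def)
  moreover have "unit_cochain X \<in> cochains X"
    by (rule cochainsI[of 0]) (auto simp: unit_cochain_def)
  ultimately show ?thesis
    by (auto simp: fun_eq_iff)
qed

lemma cup_unit_left:
  assumes "b \<in> cochains X" shows "cup X (unit_cochain X) b = b"
proof (rule cochain_eqI[OF cup_in_cochains assms])
  show "unit_cochain X \<in> cochains X"
    using unit_cochain_in_cocycles by blast
  fix n \<sigma> assume \<sigma>: "singular_simplex n X \<sigma>"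
  have "cup X (unit_cochain X) b n \<sigma> =
      (\<Sum>p\<le>n. unit_cochain X p (front_face p \<sigma>) * b (n - p) (back_face p (n - p) \<sigma>))"
    using \<sigma> by (simp add: cup_def)
  also have "\<dots> = (\<Sum>p\<in>{0}. unit_cochain X p (front_face p \<sigma>) * b (n - p) (back_face p (n - p) \<sigma>))"
    by (rule sum.mono_neutral_right) (auto simp: unit_cochain_def)
  also have "\<dots> = b n (back_face 0 n \<sigma>)"
    using singular_simplex_front_face[OF \<sigma>, of 0] by (simp add: unit_cochain_def)
  also have "back_face 0 n \<sigma> = \<sigma>"
    using \<sigma> by (simp add: back_face_def singular_simplex_def comp_def extensional_restrict)
  finally show "cup X (unit_cochain X) b n \<sigma> = b n \<sigma>" .
qed (use assms in auto)


section \<open>Cohomology classes and induced maps\<close>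

lemma coboundaries_add: "u \<in> coboundaries X \<Longrightarrow> v \<in> coboundaries X \<Longrightarrow> u + v \<in> coboundaries X"
  by (auto simp: coboundaries_def simp flip: coboundary_add intro!: imageI add_in_cochains)

lemma coboundaries_0 [simp]: "0 \<in> coboundaries X"
  unfolding coboundaries_def by (metis coboundary_0 image_eqI zero_in_cochains)

lemma coboundaries_scale: "u \<in> coboundaries X \<Longrightarrow> scale_cochain k u \<in> coboundaries X"
  by (auto simp: coboundaries_def simp flip: coboundary_scale intro!: imageI scale_in_cochains)

lemma coboundaries_diff: "u \<in> coboundaries X \<Longrightarrow> v \<in> coboundaries X \<Longrightarrow> u - v \<in> coboundaries X"
  by (auto simp: coboundaries_def simp flip: coboundary_diff intro!: imageI diff_in_cochains)

lemma coboundaries_subset_cocycles: "coboundaries X \<subseteq> cocycles X"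
  by (auto simp: coboundaries_def coboundary_coboundary coboundary_in_cochains)

lemma cocycles_add: "a \<in> cocycles X \<Longrightarrow> b \<in> cocycles X \<Longrightarrow> a + b \<in> cocycles X"
  by (simp add: coboundary_add add_in_cochains del: plus_fun_apply zero_fun_apply)

lemma grade_sign_0 [simp]: "grade_sign 0 = 0"
  by (simp add: fun_eq_iff grade_sign_def)

text \<open>The coboundaries are an ideal in the cocycles; this is the part of the Leibniz rule that makes the
  product of cohomology classes well defined.\<close>

lemma cup_coboundary_left:
  assumes "u \<in> coboundaries X" "b \<in> cocycles X" shows "cup X u b \<in> coboundaries X"
proof -
  obtain v where v: "v \<in> cochains X" "u = coboundary X v"
    using assms by (auto simp: coboundaries_def)
  then have "cup X u b = coboundary X (cup X v b)"
    using assms by (simp add: coboundary_cup)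
  then show ?thesis
    using v assms by (auto simp: coboundaries_def intro!: imageI cup_in_cochains)
qed

lemma cup_coboundary_right:
  assumes "a \<in> cocycles X" "u \<in> coboundaries X" shows "cup X a u \<in> coboundaries X"
proof -
  obtain v where v: "v \<in> cochains X" "u = coboundary X v"
    using assms by (auto simp: coboundaries_def)
  then have "cup X a u = coboundary X (cup X (grade_sign a) v)"
    using assms by (simp add: coboundary_cup coboundary_grade_sign)
  then show ?thesis
    using v assms by (auto simp: coboundaries_def intro!: imageI cup_in_cochains grade_sign_in_cochains)
qed

lemma cohomology_class_eq: "cohomology_class X z = (\<lambda>b. b + z) ` coboundaries X"
  by (auto simp: cohomology_class_def a_r_coset_def' cocycle_algebra_sel)

lemma mem_cohomology_class: "w \<in> cohomology_class X z \<longleftrightarrow> w - z \<in> coboundaries X"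
  unfolding cohomology_class_eq image_iff by (metis add_diff_cancel diff_add_cancel)

lemma cohomology_class_eq_iff:
  "cohomology_class X z = cohomology_class X w \<longleftrightarrow> z - w \<in> coboundaries X"
proof
  assume "cohomology_class X z = cohomology_class X w"
  moreover have "z \<in> cohomology_class X z" by (simp add: mem_cohomology_class)
  ultimately show "z - w \<in> coboundaries X"
    using mem_cohomology_class by metis
next
  assume zw: "z - w \<in> coboundaries X"
  show "cohomology_class X z = cohomology_class X w"
  proof (intro Set.set_eqI)
    fix v
    have "v - w = (v - z) + (z - w)" "v - z = (v - w) - (z - w)" by simp_all
    then show "v \<in> cohomology_class X z \<longleftrightarrow> v \<in> cohomology_class X w"
      unfolding mem_cohomology_class using zw coboundaries_add coboundaries_diff by metis
  qed
qed

lemma mem_cohomology_class_cocycle: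
  "w \<in> cohomology_class X z \<Longrightarrow> z \<in> cocycles X \<Longrightarrow> w \<in> cocycles X"
  using coboundaries_subset_cocycles cocycles_add unfolding cohomology_class_eq by blast

text \<open>Operations on classes are defined as unions over all representatives. Such a union collapses as soon
  as the operation does not depend on the representative.\<close>

lemma UN_cohomology_class_const:
  assumes "\<And>w. w \<in> cohomology_class X z \<Longrightarrow> F w = F z"
  shows "(\<Union>w\<in>cohomology_class X z. F w) = F z"
proof -
  have "z \<in> cohomology_class X z" by (simp add: mem_cohomology_class)
  then show ?thesis using assms by blast
qed

lemma carrier_cohomology: "carrier (cohomology X) = cohomology_class X ` cocycles X"
  by (auto simp: cohomology_def Let_def FactRing_def A_RCOSETS_def' cohomology_class_def cocycle_algebra_sel)

lemma cohomology_one: "\<one>\<^bsub>cohomology X\<^esub> = cohomology_class X (unit_cochain X)"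
  by (simp add: cohomology_def Let_def FactRing_def cohomology_class_def cocycle_algebra_sel)

lemma cohomology_add:
  "cohomology_class X a \<oplus>\<^bsub>cohomology X\<^esub> cohomology_class X b = cohomology_class X (a + b)"
proof -
  have "cohomology_class X a \<oplus>\<^bsub>cohomology X\<^esub> cohomology_class X b =
      (\<Union>h\<in>cohomology_class X a. \<Union>k\<in>cohomology_class X b. {h + k})"
    by (simp add: cohomology_def Let_def FactRing_def set_add_defs cocycle_algebra_sel)
  also have "\<dots> = cohomology_class X (a + b)"
  proof (intro Set.set_eqI iffI)
    fix w assume "w \<in> (\<Union>h\<in>cohomology_class X a. \<Union>k\<in>cohomology_class X b. {h + k})"
    then obtain h k where "h - a \<in> coboundaries X" "k - b \<in> coboundaries X" "w = h + k"
      by (auto simp: mem_cohomology_class)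
    moreover have "h + k - (a + b) = (h - a) + (k - b)" by simp
    ultimately show "w \<in> cohomology_class X (a + b)"
      unfolding mem_cohomology_class using coboundaries_add by metis
  next
    fix w assume "w \<in> cohomology_class X (a + b)"
    then have "w - b \<in> cohomology_class X a" "b \<in> cohomology_class X b" "w = (w - b) + b"
      by (simp_all add: mem_cohomology_class diff_diff_eq add.commute)
    then show "w \<in> (\<Union>h\<in>cohomology_class X a. \<Union>k\<in>cohomology_class X b. {h + k})"
      by blast
  qed
  finally show ?thesis .
qed

lemma cohomology_mult:
  assumes a: "a \<in> cocycles X" and b: "b \<in> cocycles X"
  shows "cohomology_class X a \<otimes>\<^bsub>cohomology X\<^esub> cohomology_class X b = cohomology_class X (cup X a b)"
proof -
  have "cohomology_class X (cup X a' b') = cohomology_class X (cup X a b)"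
    if a': "a' \<in> cohomology_class X a" and b': "b' \<in> cohomology_class X b" for a' b'
  proof -
    have B: "a' - a \<in> coboundaries X" "b' - b \<in> coboundaries X"
      using a' b' by (simp_all add: mem_cohomology_class)
    have "cup X a' b' = cup X (a' - a + a) b'" "cup X a b' = cup X a (b' - b + b)" by simp_all
    then have "cup X a' b' - cup X a b = cup X (a' - a) b' + cup X a (b' - b)"
      unfolding cup_add_left cup_add_right by simp
    then show ?thesis
      using cup_coboundary_left[OF B(1) mem_cohomology_class_cocycle[OF b' b]]
        cup_coboundary_right[OF a B(2)] coboundaries_add
      by (simp only: cohomology_class_eq_iff)
  qed
  moreover have "a \<in> cohomology_class X a" "b \<in> cohomology_class X b"
    by (simp_all add: mem_cohomology_class)
  ultimately have "(\<Union>a'\<in>cohomology_class X a. \<Union>b'\<in>cohomology_class X b.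
      cohomology_class X (cup X a' b')) = cohomology_class X (cup X a b)"
    by blast
  then show ?thesis
    by (simp add: cohomology_def Let_def FactRing_def rcoset_mult_def cocycle_algebra_sel
        flip: cohomology_class_def)
qed

lemma scale_cochain_diff: "scale_cochain k (a - b) = scale_cochain k a - scale_cochain k b"
  by (simp add: fun_eq_iff right_diff_distrib)

lemma cohomology_smult:
  "k \<odot>\<^bsub>cohomology X\<^esub> cohomology_class X a = cohomology_class X (scale_cochain k a)"
proof -
  have "(\<Union>w\<in>cohomology_class X a. cohomology_class X (scale_cochain k w)) =
      cohomology_class X (scale_cochain k a)"
    by (rule UN_cohomology_class_const)
       (simp add: cohomology_class_eq_iff mem_cohomology_class coboundaries_scale flip: scale_cochain_diff)
  then show ?thesis
    by (simp add: cohomology_def Let_def cocycle_algebra_sel)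
qed

definition homogeneous :: "nat \<Rightarrow> ('a, 'k::field) cochain \<Rightarrow> bool" where
  "homogeneous n z \<longleftrightarrow> (\<forall>m. m \<noteq> n \<longrightarrow> z m = 0)"

lemma cohomology_degree_eq:
  "cohomology_degree n X = cohomology_class X ` {z \<in> cocycles X. homogeneous n z}"
  by (auto simp: cohomology_degree_def cocycle_algebra_sel homogeneous_def zero_fun_def)

definition pullback ::
    "'a topology \<Rightarrow> ('a \<Rightarrow> 'b) \<Rightarrow> ('b, 'k::field) cochain \<Rightarrow> ('a, 'k) cochain" where
  "pullback X f c = (\<lambda>n \<sigma>. if singular_simplex n X \<sigma> then c n (simplex_map n f \<sigma>) else 0)"

lemma pullback_in_cochains:
  assumes "c \<in> cochains Y" shows "pullback X f c \<in> cochains X"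
  using cochains_bounded[OF assms] by (auto intro!: cochainsI simp: pullback_def)

lemma pullback_0 [simp]: "pullback X f 0 = 0"
  by (simp add: pullback_def fun_eq_iff)

lemma pullback_add: "pullback X f (c + d) = pullback X f c + pullback X f d"
  by (simp add: pullback_def fun_eq_iff)

lemma pullback_diff: "pullback X f (c - d) = pullback X f c - pullback X f d"
  by (simp add: pullback_def fun_eq_iff)

lemma pullback_scale: "pullback X f (scale_cochain k c) = scale_cochain k (pullback X f c)"
  by (simp add: pullback_def fun_eq_iff)

lemma pullback_sum: "pullback X f (\<Sum>i\<in>I. c i) = (\<Sum>i\<in>I. pullback X f (c i))"
  by (induction I rule: infinite_finite_induct)
     (simp_all add: pullback_add del: plus_fun_apply zero_fun_apply)

lemma pullback_cong:
  assumes "\<And>x. x \<in> topspace X \<Longrightarrow> f x = g x"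
  shows "pullback X f c = pullback X g c"
proof (intro ext)
  fix n \<sigma>
  show "pullback X f c n \<sigma> = pullback X g c n \<sigma>"
    using simplex_map_eq[of n X \<sigma> f g] assms by (simp add: pullback_def)
qed

lemma pullback_compose:
  assumes "continuous_map X Y f"
  shows "pullback X f (pullback Y g c) = pullback X (g \<circ> f) c"
  using singular_simplex_simplex_map[OF _ assms]
  by (simp add: pullback_def fun_eq_iff simplex_map_compose)

lemma pullback_id:
  assumes "c \<in> cochains X" "\<And>x. x \<in> topspace X \<Longrightarrow> f x = x"
  shows "pullback X f c = c"
proof (intro ext)
  fix n \<sigma>
  show "pullback X f c n \<sigma> = c n \<sigma>"
    using assms simplex_map_id_gen[of n X \<sigma> f] by (simp add: cochain_outside pullback_def)
qed

lemma singular_face_of_simplex_map: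
  assumes "singular_simplex (Suc n) X \<sigma>" "i \<le> Suc n"
  shows "singular_face (Suc n) i (simplex_map (Suc n) f \<sigma>) = simplex_map n f (singular_face (Suc n) i \<sigma>)"
  using assms by (simp add: singular_face_simplex_map) (simp add: simplex_map_def singular_face_def fun_eq_iff)

lemma coboundary_pullback:
  assumes "continuous_map X Y f"
  shows "coboundary X (pullback X f c) = pullback X f (coboundary Y c)"
proof (intro ext)
  fix n \<sigma>
  show "coboundary X (pullback X f c) n \<sigma> = pullback X f (coboundary Y c) n \<sigma>"
  proof (cases "singular_simplex n X \<sigma> \<and> n > 0")
    case False
    then show ?thesis by (auto simp: coboundary_def pullback_def)
  next
    case True
    then obtain m where n: "n = Suc m" and \<sigma>: "singular_simplex (Suc m) X \<sigma>"
      using gr0_implies_Suc by blast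
    show ?thesis
      using singular_simplex_simplex_map[OF \<sigma> assms] \<sigma>
      by (simp add: n coboundary_Suc pullback_def singular_simplex_face
          singular_face_of_simplex_map[OF \<sigma>] del: sum.atMost_Suc)
  qed
qed

lemma front_face_simplex_map:
  "p \<le> n \<Longrightarrow> front_face p (simplex_map n f \<sigma>) = simplex_map p f (front_face p \<sigma>)"
  using standard_simplex_mono[of p n] by (auto simp: front_face_def simplex_map_def fun_eq_iff)

lemma back_face_simplex_map:
  assumes "p \<le> n"
  shows "back_face p (n - p) (simplex_map n f \<sigma>) = simplex_map (n - p) f (back_face p (n - p) \<sigma>)"
  using shift_in_standard_simplex[of _ "n - p" p] assms
  by (auto simp: back_face_def simplex_map_def fun_eq_iff)

lemma pullback_cup:
  assumes "continuous_map X Y f"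
  shows "pullback X f (cup Y a b) = cup X (pullback X f a) (pullback X f b)"
proof (intro ext)
  fix n \<sigma>
  show "pullback X f (cup Y a b) n \<sigma> = cup X (pullback X f a) (pullback X f b) n \<sigma>"
  proof (cases "singular_simplex n X \<sigma>")
    case \<sigma>: True
    have "pullback X f (cup Y a b) n \<sigma> = (\<Sum>p\<le>n. a p (front_face p (simplex_map n f \<sigma>)) *
        b (n - p) (back_face p (n - p) (simplex_map n f \<sigma>)))"
      using \<sigma> singular_simplex_simplex_map[OF \<sigma> assms] by (simp add: pullback_def cup_def)
    also have "\<dots> = cup X (pullback X f a) (pullback X f b) n \<sigma>"
      unfolding cup_def using \<sigma>
      by (auto simp: pullback_def front_face_simplex_map back_face_simplex_map
          singular_simplex_front_face singular_simplex_back_face intro!: sum.cong)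
    finally show ?thesis .
  qed (simp add: pullback_def cup_def)
qed

lemma pullback_unit:
  assumes "continuous_map X Y f"
  shows "pullback X f (unit_cochain Y) = unit_cochain X"
  using singular_simplex_simplex_map[OF _ assms, of 0]
  by (auto simp: pullback_def unit_cochain_def fun_eq_iff)

lemma pullback_in_cocycles:
  assumes "continuous_map X Y f" "c \<in> cocycles Y" shows "pullback X f c \<in> cocycles X"
  using assms by (simp add: coboundary_pullback pullback_in_cochains[of c Y])

lemma pullback_in_coboundaries:
  assumes "continuous_map X Y f" "u \<in> coboundaries Y"
  shows "pullback X f u \<in> coboundaries X"
  using assms by (auto simp: coboundaries_def simp flip: coboundary_pullback
      intro!: imageI pullback_in_cochains)

lemma cohomology_map_class:
  assumes "continuous_map X Y f"
  shows "cohomology_map X Y f (cohomology_class Y z) = cohomology_class X (pullback X f z)"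
  unfolding cohomology_map_def pullback_def[symmetric]
  by (rule UN_cohomology_class_const)
     (simp add: cohomology_class_eq_iff mem_cohomology_class pullback_in_coboundaries[OF assms]
       flip: pullback_diff)

lemma cohomology_cases:
  assumes "x \<in> carrier (cohomology X)"
  obtains z where "z \<in> cocycles X" "x = cohomology_class X z"
  using assms by (auto simp: carrier_cohomology)

lemma cohomology_map_closed:
  assumes "continuous_map X Y f" "x \<in> carrier (cohomology Y)"
  shows "cohomology_map X Y f x \<in> carrier (cohomology X)"
  using assms(2) by (rule cohomology_cases)
     (auto simp: cohomology_map_class[OF assms(1)] carrier_cohomology
       intro!: imageI pullback_in_cocycles[OF assms(1), simplified])

lemma cohomology_map_compose:
  assumes f: "continuous_map X Y f" and g: "continuous_map Y Z g" and x: "x \<in> carrier (cohomology Z)"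
  shows "cohomology_map X Y f (cohomology_map Y Z g x) = cohomology_map X Z (g \<circ> f) x"
  using x
proof (rule cohomology_cases)
  fix z assume "x = cohomology_class Z z"
  then show ?thesis
    by (simp add: cohomology_map_class f g continuous_map_compose[OF f g] pullback_compose[OF f])
qed

lemma cohomology_map_cong:
  assumes "\<And>x. x \<in> topspace X \<Longrightarrow> f x = g x"
  shows "(cohomology_map X Y f :: ('b, 'k::field) cochain set \<Rightarrow> _) = cohomology_map X Y g"
proof
  fix A :: "('b, 'k) cochain set"
  have "pullback X f c = pullback X g c" for c :: "('b, 'k) cochain"
    using assms by (rule pullback_cong)
  then show "cohomology_map X Y f A = cohomology_map X Y g A"
    unfolding cohomology_map_def pullback_def[symmetric] by simp
qed

lemma cohomology_map_id:
  assumes "\<And>x. x \<in> topspace X \<Longrightarrow> f x = x" and x: "x \<in> carrier (cohomology X)"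
  shows "cohomology_map X X f x = x"
proof -
  have f: "continuous_map X X f"
    using continuous_map_eq[OF continuous_map_id, of X f] assms by simp
  obtain z where z: "z \<in> cocycles X" "x = cohomology_class X z"
    using x by (rule cohomology_cases)
  have "pullback X f z = z"
    using z(1) by (intro pullback_id assms(1)) simp_all
  then show ?thesis
    by (simp only: z(2) cohomology_map_class[OF f])
qed

lemma cohomology_map_ring_hom:
  assumes f: "continuous_map X Y f"
  shows "cohomology_map X Y f \<in>
    ring_hom (cohomology Y :: ('k::field, ('b, 'k) cochain set) module) (cohomology X)"
proof (rule ring_hom_memI)
  fix x y :: "('b, 'k) cochain set"
  assume "x \<in> carrier (cohomology Y)" "y \<in> carrier (cohomology Y)"
  then obtain a b where ab: "a \<in> cocycles Y" "x = cohomology_class Y a"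
    "b \<in> cocycles Y" "y = cohomology_class Y b"
    unfolding carrier_cohomology by blast
  show "cohomology_map X Y f (x \<otimes>\<^bsub>cohomology Y\<^esub> y) =
      cohomology_map X Y f x \<otimes>\<^bsub>cohomology X\<^esub> cohomology_map X Y f y"
    unfolding ab(2,4) cohomology_mult[OF ab(1,3)] cohomology_map_class[OF f] pullback_cup[OF f]
      cohomology_mult[OF pullback_in_cocycles[OF f ab(1)] pullback_in_cocycles[OF f ab(3)]] ..
  show "cohomology_map X Y f (x \<oplus>\<^bsub>cohomology Y\<^esub> y) =
      cohomology_map X Y f x \<oplus>\<^bsub>cohomology X\<^esub> cohomology_map X Y f y"
    unfolding ab(2,4) cohomology_add cohomology_map_class[OF f] pullback_add ..
next
  show "cohomology_map X Y f \<one>\<^bsub>cohomology Y\<^esub> = \<one>\<^bsub>cohomology X\<^esub>"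
    by (simp add: cohomology_one cohomology_map_class[OF f] pullback_unit[OF f])
qed (rule cohomology_map_closed[OF f])

lemma cohomology_map_smult:
  assumes f: "continuous_map X Y f" and x: "x \<in> carrier (cohomology Y)"
  shows "cohomology_map X Y f (k \<odot>\<^bsub>cohomology Y\<^esub> x) = k \<odot>\<^bsub>cohomology X\<^esub> cohomology_map X Y f x"
  using x
  by (rule cohomology_cases) (simp add: cohomology_smult cohomology_map_class[OF f] pullback_scale)

lemma cohomology_map_degree:
  assumes f: "continuous_map X Y f" and x: "x \<in> cohomology_degree n Y"
  shows "cohomology_map X Y f x \<in> cohomology_degree n X"
proof -
  obtain z where z: "z \<in> cocycles Y" "homogeneous n z" "x = cohomology_class Y z"
    using x by (auto simp: cohomology_degree_eq)
  then have "homogeneous n (pullback X f z)"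
    by (auto simp: homogeneous_def pullback_def fun_eq_iff)
  then show ?thesis
    using z pullback_in_cocycles[OF f z(1)]
    by (auto simp: cohomology_degree_eq cohomology_map_class[OF f])
qed

text \<open>The homogeneous parts of a cochain. Taking them commutes with pullback and, up to a shift, with
  the coboundary.\<close>

definition component :: "nat \<Rightarrow> ('a, 'k::field) cochain \<Rightarrow> ('a, 'k) cochain" where
  "component n c = (\<lambda>m. if m = n then c n else 0)"

lemma component_in_cochains: "c \<in> cochains X \<Longrightarrow> component n c \<in> cochains X"
  using cochains_bounded[of c X] by (auto intro!: cochainsI simp: cochain_outside component_def)

lemma homogeneous_component: "homogeneous n (component n c)"
  by (simp add: homogeneous_def component_def)

lemma component_homogeneous: "homogeneous n c \<Longrightarrow> component n c = c"
  by (auto simp: homogeneous_def component_def)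

lemma coboundary_component:
  "coboundary X (component n c) = component (Suc n) (coboundary X c)"
proof (intro ext)
  fix m \<sigma>
  show "coboundary X (component n c) m \<sigma> = component (Suc n) (coboundary X c) m \<sigma>"
    by (cases m) (auto simp: coboundary_def component_def)
qed

lemma component_coboundary_0: "component 0 (coboundary X c) = 0"
  by (simp add: component_def fun_eq_iff)

lemma component_diff: "component n (c - d) = component n c - component n d"
  by (simp add: component_def fun_eq_iff)

lemma component_0 [simp]: "component n 0 = 0"
  by (simp add: component_def fun_eq_iff)

lemma component_in_cocycles: "c \<in> cocycles X \<Longrightarrow> component n c \<in> cocycles X"
  by (simp add: coboundary_component component_in_cochains)

lemma component_in_coboundaries:
  assumes "u \<in> coboundaries X" shows "component n u \<in> coboundaries X"
proof -
  obtain c where c: "c \<in> cochains X" "u = coboundary X c"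
    using assms by (auto simp: coboundaries_def)
  show ?thesis
  proof (cases n)
    case 0
    then show ?thesis by (simp add: c component_coboundary_0)
  next
    case (Suc m)
    then show ?thesis
      using c component_in_cochains by (auto simp: coboundaries_def simp flip: coboundary_component)
  qed
qed

text \<open>Pullback commutes with taking homogeneous parts, so if a class of degree \<open>n\<close> has a preimage, the
  degree \<open>n\<close> part of that preimage is again one.\<close>

lemma cohomology_map_degree_preimage:
  assumes f: "continuous_map X Y f" and y: "y \<in> carrier (cohomology Y)"
    and deg: "cohomology_map X Y f y \<in> cohomology_degree n X"
  obtains y' where "y' \<in> cohomology_degree n Y" "cohomology_map X Y f y' = cohomology_map X Y f y"
proof -
  obtain z where z: "z \<in> cocycles Y" "y = cohomology_class Y z"
    using y by (rule cohomology_cases)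
  obtain w where w: "w \<in> cocycles X" "homogeneous n w" "cohomology_map X Y f y = cohomology_class X w"
    using deg by (auto simp: cohomology_degree_eq)
  then have "pullback X f z - w \<in> coboundaries X"
    by (simp add: z cohomology_map_class[OF f] cohomology_class_eq_iff)
  then have "component n (pullback X f z) - w \<in> coboundaries X"
    using component_in_coboundaries[of "pullback X f z - w" X n] w
    by (simp add: component_diff component_homogeneous)
  moreover have "pullback X f (component n z) = component n (pullback X f z)"
    by (auto simp: component_def pullback_def fun_eq_iff)
  ultimately have "cohomology_map X Y f (cohomology_class Y (component n z)) = cohomology_map X Y f y"
    by (simp add: w(3) cohomology_map_class[OF f] cohomology_class_eq_iff)
  moreover have "cohomology_class Y (component n z) \<in> cohomology_degree n Y"
    using component_in_cocycles[OF z(1)] by (auto simp: cohomology_degree_eq homogeneous_component)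
  ultimately show ?thesis using that by blast
qed


section \<open>Homotopy invariance\<close>

text \<open>The prism \<open>[0,1] \<times> \<Delta>\<^sup>n\<close> is cut into \<open>n + 1\<close> simplices of dimension \<open>n + 1\<close>. The \<open>j\<close>-th one has the
  vertices \<open>(0, e\<^sub>0), \<dots>, (0, e\<^sub>j), (1, e\<^sub>j), \<dots>, (1, e\<^sub>n)\<close>. Its affine parametrization has the simplex
  coordinate \<open>collapse j\<close>, the degeneracy that identifies the vertices \<open>j\<close> and \<open>j + 1\<close>, and the
  interval coordinate \<open>height j\<close>, the total weight of the vertices after the \<open>j\<close>-th.\<close>

definition collapse :: "nat \<Rightarrow> (nat \<Rightarrow> real) \<Rightarrow> nat \<Rightarrow> real" where
  "collapse j x = (\<lambda>i. if i < j then x i else if i = j then x j + x (Suc j) else x (Suc i))"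

definition height :: "nat \<Rightarrow> (nat \<Rightarrow> real) \<Rightarrow> real" where
  "height j x = 1 - (\<Sum>k\<le>j. x k)"

definition prism_simplex ::
    "nat \<Rightarrow> (real \<times> 'a \<Rightarrow> 'b) \<Rightarrow> nat \<Rightarrow> ((nat \<Rightarrow> real) \<Rightarrow> 'a) \<Rightarrow> (nat \<Rightarrow> real) \<Rightarrow> 'b" where
  "prism_simplex n H j \<sigma> =
     restrict (\<lambda>x. H (height j x, \<sigma> (collapse j x))) (standard_simplex (Suc n))"

lemma standard_simplex_partial_sum:
  assumes "x \<in> standard_simplex n"
  shows "(\<Sum>k\<le>j. x k) \<le> 1"
proof -
  have "(\<Sum>k\<le>j. x k) \<le> (\<Sum>k\<le>max j n. x k)"
    using assms by (intro sum_mono2) (auto simp: standard_simplex_def)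
  also have "\<dots> = (\<Sum>k\<le>n. x k)"
    using assms by (intro sum.mono_neutral_right) (auto simp: standard_simplex_def)
  finally show ?thesis
    using assms by (simp add: standard_simplex_def)
qed

lemma height_in_unit_interval:
  assumes "x \<in> standard_simplex n" shows "height j x \<in> {0..1}"
  using standard_simplex_partial_sum[OF assms, of j] assms
  by (auto simp: height_def standard_simplex_def intro!: sum_nonneg)

lemma sum_collapse:
  assumes "j \<le> n" shows "(\<Sum>i\<le>n. collapse j x i) = (\<Sum>i\<le>Suc n. x i)"
  using assms
proof (induction n)
  case (Suc n)
  show ?case
  proof (cases "j = Suc n")
    case True
    have "(\<Sum>i\<le>n. collapse j x i) = (\<Sum>i\<le>n. x i)"
      by (rule sum.cong) (auto simp: collapse_def True)
    then show ?thesis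
      by (simp add: True collapse_def)
  next
    case False
    then show ?thesis
      using Suc by (simp add: collapse_def)
  qed
qed (simp add: collapse_def)

lemma collapse_in_standard_simplex:
  assumes x: "x \<in> standard_simplex (Suc n)" and "j \<le> n"
  shows "collapse j x \<in> standard_simplex n"
proof -
  have pos: "0 \<le> x i" for i
    using x by (simp add: standard_simplex_def)
  then have pos': "0 \<le> collapse j x i" for i
    by (simp add: collapse_def)
  have sum: "(\<Sum>i\<le>n. collapse j x i) = 1"
    using x sum_collapse[OF assms(2), of x] by (simp add: standard_simplex_def)
  have zero: "collapse j x i = 0" if "i > n" for i
    using that x assms(2) by (auto simp: collapse_def standard_simplex_def)
  have "collapse j x i \<le> 1" for i
  proof (cases "i \<le> n")
    case True
    then have "collapse j x i \<le> (\<Sum>i\<le>n. collapse j x i)"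
      by (intro member_le_sum pos') auto
    then show ?thesis using sum by simp
  qed (simp add: zero)
  then show ?thesis
    using pos' sum zero by (simp add: standard_simplex_def)
qed

lemma singular_simplex_prism:
  assumes H: "continuous_map (prod_topology (top_of_set {0..1}) X) Y H"
    and \<sigma>: "singular_simplex n X \<sigma>" and "j \<le> n"
  shows "singular_simplex (Suc n) Y (prism_simplex n H j \<sigma>)"
proof -
  let ?D = "\<lambda>n. subtopology (powertop_real UNIV) (standard_simplex n)"
  have proj: "continuous_map (powertop_real UNIV) euclideanreal (\<lambda>x. x i)" for i :: nat
    by (rule continuous_map_product_projection) simp
  have "continuous_map (powertop_real UNIV) (powertop_real UNIV) (collapse j)"
    unfolding continuous_map_componentwise collapse_def
    by (auto intro!: continuous_map_add proj)
  then have "continuous_map (?D (Suc n)) (?D n) (collapse j)"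
    using collapse_in_standard_simplex \<open>j \<le> n\<close>
    by (auto simp: continuous_map_in_subtopology continuous_map_from_subtopology)
  then have 1: "continuous_map (?D (Suc n)) X (\<sigma> \<circ> collapse j)"
    using \<sigma> unfolding singular_simplex_def by (blast intro: continuous_map_compose)
  have "continuous_map (powertop_real UNIV) euclideanreal (height j)"
    unfolding height_def by (intro continuous_map_diff continuous_map_sum proj) auto
  then have 2: "continuous_map (?D (Suc n)) (top_of_set {0..1}) (height j)"
    using height_in_unit_interval
    by (fastforce simp: continuous_map_in_subtopology continuous_map_from_subtopology)
  have "continuous_map (?D (Suc n)) Y (H \<circ> (\<lambda>x. (height j x, (\<sigma> \<circ> collapse j) x)))"
    using continuous_map_compose[OF continuous_map_pairedI[OF 2 1] H] .
  then show ?thesis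
    unfolding singular_simplex_def prism_simplex_def
    by (auto intro: continuous_map_eq)
qed

lemma singular_face_prism:
  assumes "j \<le> n" "i \<le> Suc n"
  shows "singular_face (Suc n) i (prism_simplex n H j \<sigma>) =
    restrict (\<lambda>t. H (height j (simplical_face i t), \<sigma> (collapse j (simplical_face i t)))) (standard_simplex n)"
  using simplical_face_in_standard_simplex[of "Suc n" i] assms
  by (auto simp: singular_face_def prism_simplex_def fun_eq_iff)

lemma sum_simplical_face:
  "(\<Sum>k\<le>j. simplical_face i x k) = (if i \<le> j then \<Sum>k<j. x k else \<Sum>k\<le>j. (x k :: real))"
proof (induction j)
  case (Suc j)
  then show ?case
    by (auto simp: simplical_face_def le_Suc_eq lessThan_Suc_atMost[symmetric])
qed (auto simp: simplical_face_def)

text \<open>The identities from here on are those of a simplicial homotopy. Face \<open>0\<close> of simplex \<open>0\<close> and face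
  \<open>n + 1\<close> of simplex \<open>n\<close> are the two ends of the homotopy, neighbouring simplices share the face of
  \<open>singular_face_prism_diagonal\<close>, and every other face lies in the prism over the boundary.\<close>

lemma singular_face_prism_top:
  assumes "\<And>x. H (1, x) = g x"
  shows "singular_face (Suc n) 0 (prism_simplex n H 0 \<sigma>) = simplex_map n g \<sigma>"
proof -
  have "collapse 0 (simplical_face 0 t) = t" "height 0 (simplical_face 0 t) = 1" for t
    by (auto simp: collapse_def simplical_face_def fun_eq_iff height_def)
  then show ?thesis
    by (simp add: singular_face_prism simplex_map_def assms comp_def)
qed

lemma singular_face_prism_bottom:
  assumes "\<And>x. H (0, x) = f x"
  shows "singular_face (Suc n) (Suc n) (prism_simplex n H n \<sigma>) = simplex_map n f \<sigma>"
proof -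
  have "collapse n (simplical_face (Suc n) t) = t" "height n (simplical_face (Suc n) t) = 0"
    if "t \<in> standard_simplex n" for t
    using that by (auto simp: collapse_def simplical_face_def fun_eq_iff height_def standard_simplex_def)
  then show ?thesis
    by (auto simp: singular_face_prism simplex_map_def assms intro!: restrict_ext)
qed

lemma singular_face_prism_diagonal:
  assumes "j < n"
  shows "singular_face (Suc n) (Suc j) (prism_simplex n H j \<sigma>) =
    singular_face (Suc n) (Suc j) (prism_simplex n H (Suc j) \<sigma>)"
proof -
  have "collapse j (simplical_face (Suc j) t) = t" "collapse (Suc j) (simplical_face (Suc j) t) = t"
    "height j (simplical_face (Suc j) t) = height (Suc j) (simplical_face (Suc j) t)" for t
    by (auto simp: collapse_def simplical_face_def fun_eq_iff height_def)
  then show ?thesis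
    using assms by (simp add: singular_face_prism)
qed

lemma singular_face_prism_low:
  assumes "i \<le> j" "j \<le> m"
  shows "singular_face (Suc (Suc m)) i (prism_simplex (Suc m) H (Suc j) \<sigma>) =
    prism_simplex m H j (singular_face (Suc m) i \<sigma>)"
proof -
  have "collapse (Suc j) (simplical_face i t) = simplical_face i (collapse j t)"
    "height (Suc j) (simplical_face i t) = height j t" for t
  proof -
    show "collapse (Suc j) (simplical_face i t) = simplical_face i (collapse j t)"
      using assms by (auto simp: collapse_def simplical_face_def fun_eq_iff)
    show "height (Suc j) (simplical_face i t) = height j t"
      using assms by (simp add: height_def sum_simplical_face lessThan_Suc_atMost del: sum.atMost_Suc)
  qed
  then show ?thesis
    using assms collapse_in_standard_simplex[of _ m j]
    by (simp add: singular_face_prism) (auto simp: prism_simplex_def singular_face_def intro!: restrict_ext)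
qed

lemma singular_face_prism_high:
  assumes "j < i" "i \<le> Suc m"
  shows "singular_face (Suc (Suc m)) (Suc i) (prism_simplex (Suc m) H j \<sigma>) =
    prism_simplex m H j (singular_face (Suc m) i \<sigma>)"
proof -
  have "collapse j (simplical_face (Suc i) t) = simplical_face i (collapse j t)"
    for t
  proof
    fix k
    show "collapse j (simplical_face (Suc i) t) k = simplical_face i (collapse j t) k"
      using assms by (cases k) (auto simp: collapse_def simplical_face_def)
  qed
  moreover have "height j (simplical_face (Suc i) t) = height j t" for t
    using assms by (simp add: height_def sum_simplical_face)
  ultimately show ?thesis
    using assms collapse_in_standard_simplex[of _ m j]
    by (simp add: singular_face_prism) (auto simp: prism_simplex_def singular_face_def intro!: restrict_ext)
qed

text \<open>In the boundary of the prism the shared faces telescope. What remains are the two ends and,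
  with a minus sign, the prism over the boundary; \<open>F j i\<close> stands for the \<open>i\<close>-th face of the \<open>j\<close>-th
  simplex.\<close>

lemma prism_alternating_sum:
  fixes F :: "nat \<Rightarrow> nat \<Rightarrow> 'k::field"
  assumes "\<And>j. j < n \<Longrightarrow> F j (Suc j) = F (Suc j) (Suc j)"
  shows "(\<Sum>j\<le>n. \<Sum>i\<le>Suc n. (-1) ^ (i + j) * F j i) = F 0 0 - F n (Suc n) -
    (\<Sum>i\<le>n. \<Sum>j<n. (-1) ^ (i + j) * (if i \<le> j then F (Suc j) i else F j (Suc i)))"
proof -
  let ?f = "\<lambda>j i. (-1) ^ (i + j) * F j i"
  let ?d = "\<lambda>i j. (-1) ^ (i + j) * (if i \<le> j then F (Suc j) i else F j (Suc i))"
  have row: "(\<Sum>i\<le>Suc n. ?f j i) =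
      (\<Sum>i<j. ?f j i) + F j j - F j (Suc j) + (\<Sum>i=Suc j..n. ?f j (Suc i))" if "j \<le> n" for j
  proof -
    have "(\<Sum>i\<le>Suc n. ?f j i) = (\<Sum>i\<in>{..<j} \<union> ({j, Suc j} \<union> {Suc (Suc j)..Suc n}). ?f j i)"
      using that by (intro sum.cong refl) auto
    also have "\<dots> = (\<Sum>i<j. ?f j i) + (\<Sum>i\<in>{j, Suc j} \<union> {Suc (Suc j)..Suc n}. ?f j i)"
      by (rule sum.union_disjoint) auto
    also have "(\<Sum>i\<in>{j, Suc j} \<union> {Suc (Suc j)..Suc n}. ?f j i) =
        (\<Sum>i\<in>{j, Suc j}. ?f j i) + (\<Sum>i=Suc (Suc j)..Suc n. ?f j i)"
      by (rule sum.union_disjoint) auto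
    also have "(\<Sum>i\<in>{j, Suc j}. ?f j i) = F j j - F j (Suc j)"
      by (simp flip: mult_2)
    also have "(\<Sum>i=Suc (Suc j)..Suc n. ?f j i) = (\<Sum>i=Suc j..n. ?f j (Suc i))"
      by (rule sum.shift_bounds_cl_Suc_ivl)
    finally show ?thesis by (simp add: algebra_simps)
  qed
  have low: "(\<Sum>j\<le>n. \<Sum>i<j. ?f j i) = - (\<Sum>j<n. \<Sum>i\<le>j. ?d i j)"
  proof -
    have "(\<Sum>j\<le>n. \<Sum>i<j. ?f j i) = (\<Sum>j<n. \<Sum>i<Suc j. ?f (Suc j) i)"
      by (simp add: lessThan_Suc_atMost[symmetric] sum.lessThan_Suc_shift del: sum.lessThan_Suc)
    then show ?thesis
      by (simp add: lessThan_Suc_atMost sum_negf)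
  qed
  have high: "(\<Sum>j\<le>n. \<Sum>i=Suc j..n. ?f j (Suc i)) = - (\<Sum>j<n. \<Sum>i=Suc j..n. ?d i j)"
  proof -
    have "(\<Sum>j\<le>n. \<Sum>i=Suc j..n. ?f j (Suc i)) = (\<Sum>j<n. \<Sum>i=Suc j..n. ?f j (Suc i))"
      by (simp add: lessThan_Suc_atMost[symmetric])
    also have "\<dots> = (\<Sum>j<n. \<Sum>i=Suc j..n. - ?d i j)"
      by (intro sum.cong refl) simp
    finally show ?thesis by (simp only: sum_negf)
  qed
  have "(\<Sum>i\<le>n. \<Sum>j<n. ?d i j) = (\<Sum>j<n. \<Sum>i\<le>n. ?d i j)"
    by (rule sum.swap)
  also have "\<dots> = (\<Sum>j<n. (\<Sum>i\<le>j. ?d i j) + (\<Sum>i=Suc j..n. ?d i j))"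
  proof (intro sum.cong refl)
    fix j assume "j \<in> {..<n}"
    then have "{..n} = {..j} \<union> {Suc j..n}" by auto
    moreover have "(\<Sum>i\<in>{..j} \<union> {Suc j..n}. ?d i j) = (\<Sum>i\<le>j. ?d i j) + (\<Sum>i=Suc j..n. ?d i j)"
      by (rule sum.union_disjoint) auto
    ultimately show "(\<Sum>i\<le>n. ?d i j) = (\<Sum>i\<le>j. ?d i j) + (\<Sum>i=Suc j..n. ?d i j)"
      by simp
  qed
  finally have d: "(\<Sum>i\<le>n. \<Sum>j<n. ?d i j) = (\<Sum>j<n. \<Sum>i\<le>j. ?d i j) + (\<Sum>j<n. \<Sum>i=Suc j..n. ?d i j)"
    by (simp only: sum.distrib)
  have "(\<Sum>j\<le>n. F j j) = F 0 0 + (\<Sum>j<n. F (Suc j) (Suc j))"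
    by (simp add: lessThan_Suc_atMost[symmetric] sum.lessThan_Suc_shift del: sum.lessThan_Suc)
  moreover have "(\<Sum>j\<le>n. F j (Suc j)) = (\<Sum>j<n. F (Suc j) (Suc j)) + F n (Suc n)"
    by (simp add: lessThan_Suc_atMost[symmetric] assms)
  moreover have "(\<Sum>j\<le>n. \<Sum>i\<le>Suc n. ?f j i) = (\<Sum>j\<le>n. \<Sum>i<j. ?f j i) + (\<Sum>j\<le>n. F j j) -
      (\<Sum>j\<le>n. F j (Suc j)) + (\<Sum>j\<le>n. \<Sum>i=Suc j..n. ?f j (Suc i))"
    by (simp add: row sum.distrib sum_subtractf del: sum.atMost_Suc)
  ultimately show ?thesis
    unfolding d low high by simp
qed

definition prism_cochain ::
    "'a topology \<Rightarrow> (real \<times> 'a \<Rightarrow> 'b) \<Rightarrow> ('b, 'k::field) cochain \<Rightarrow> ('a, 'k) cochain" where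
  "prism_cochain X H c = (\<lambda>n \<sigma>. if singular_simplex n X \<sigma>
     then \<Sum>j\<le>n. (-1) ^ j * c (Suc n) (prism_simplex n H j \<sigma>) else 0)"

lemma prism_cochain_in_cochains:
  assumes "c \<in> cochains Y" shows "prism_cochain X H c \<in> cochains X"
proof -
  obtain N where N: "\<forall>n>N. \<forall>\<sigma>. c n \<sigma> = 0"
    using cochains_bounded[OF assms] by blast
  show ?thesis
    by (rule cochainsI[of N]) (auto simp: prism_cochain_def N)
qed

lemma prism_cochain_0 [simp]: "prism_cochain X H 0 = 0"
  by (simp add: prism_cochain_def fun_eq_iff)

lemma prism_cochain_homotopy:
  assumes H: "continuous_map (prod_topology (top_of_set {0..1}) X) Y H"
    and H0: "\<And>x. H (0, x) = f x" and H1: "\<And>x. H (1, x) = g x"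
  shows "coboundary X (prism_cochain X H c) + prism_cochain X H (coboundary Y c) =
    pullback X g c - pullback X f c"
proof (intro ext)
  fix n \<sigma>
  show "(coboundary X (prism_cochain X H c) + prism_cochain X H (coboundary Y c)) n \<sigma> =
    (pullback X g c - pullback X f c) n \<sigma>"
  proof (cases "singular_simplex n X \<sigma>")
    case False
    then show ?thesis
      by (simp add: coboundary_def prism_cochain_def pullback_def)
  next
    case \<sigma>: True
    let ?F = "\<lambda>j i. c n (singular_face (Suc n) i (prism_simplex n H j \<sigma>))"
    have "prism_cochain X H (coboundary Y c) n \<sigma> = (\<Sum>j\<le>n. \<Sum>i\<le>Suc n. (-1) ^ (i + j) * ?F j i)"
      using \<sigma> singular_simplex_prism[OF H \<sigma>]
      by (simp add: prism_cochain_def coboundary_Suc sum_distrib_left power_add mult_ac del: sum.atMost_Suc)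
    also have "\<dots> = ?F 0 0 - ?F n (Suc n) -
        (\<Sum>i\<le>n. \<Sum>j<n. (-1) ^ (i + j) * (if i \<le> j then ?F (Suc j) i else ?F j (Suc i)))"
      by (rule prism_alternating_sum) (simp add: singular_face_prism_diagonal)
    also have "(\<Sum>i\<le>n. \<Sum>j<n. (-1) ^ (i + j) * (if i \<le> j then ?F (Suc j) i else ?F j (Suc i))) =
        coboundary X (prism_cochain X H c) n \<sigma>"
    proof (cases n)
      case (Suc m)
      have "coboundary X (prism_cochain X H c) n \<sigma> = (\<Sum>i\<le>n. (-1) ^ i *
          (\<Sum>j\<le>m. (-1) ^ j * c n (prism_simplex m H j (singular_face n i \<sigma>))))"
        using \<sigma> unfolding Suc
        by (simp add: coboundary_Suc prism_cochain_def singular_simplex_face del: sum.atMost_Suc)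
      also have "\<dots> = (\<Sum>i\<le>n. \<Sum>j<n. (-1) ^ (i + j) * c n (prism_simplex m H j (singular_face n i \<sigma>)))"
        by (simp add: Suc lessThan_Suc_atMost sum_distrib_left power_add mult_ac del: sum.atMost_Suc)
      also have "\<dots> = (\<Sum>i\<le>n. \<Sum>j<n. (-1) ^ (i + j) * (if i \<le> j then ?F (Suc j) i else ?F j (Suc i)))"
        by (intro sum.cong refl arg_cong2[where f="(*)"])
           (auto simp: Suc singular_face_prism_low singular_face_prism_high)
      finally show ?thesis by simp
    qed simp
    finally show ?thesis
      using \<sigma> by (simp add: pullback_def singular_face_prism_top[of H g, OF H1]
          singular_face_prism_bottom[of H f, OF H0])
  qed
qed

lemma cohomology_map_homotopic:
  fixes X :: "'a topology" and Y :: "'b topology"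
  assumes "homotopic_with (\<lambda>_. True) X Y f g" and x: "x \<in> carrier (cohomology Y)"
  shows "cohomology_map X Y f x = cohomology_map X Y g x"
proof -
  obtain H :: "real \<times> 'a \<Rightarrow> 'b" where H:
    "continuous_map (prod_topology (top_of_set {0..1}) X) Y H" "\<And>x. H (0, x) = f x" "\<And>x. H (1, x) = g x"
    using assms(1) unfolding homotopic_with_def by blast
  have fg: "continuous_map X Y f" "continuous_map X Y g"
    using homotopic_with_imp_continuous_maps[OF assms(1)] by auto
  obtain z where z: "z \<in> cocycles Y" "x = cohomology_class Y z"
    using x by (rule cohomology_cases)
  have "pullback X g z - pullback X f z = coboundary X (prism_cochain X H z)"
    using prism_cochain_homotopy[OF H, of z] z(1) by simp
  then have "pullback X g z - pullback X f z \<in> coboundaries X"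
    using prism_cochain_in_cochains[of z Y X H] z(1) by (auto simp: coboundaries_def)
  then show ?thesis
    unfolding z(2) cohomology_map_class[OF fg(1)] cohomology_map_class[OF fg(2)]
    by (metis cohomology_class_eq_iff)
qed


section \<open>Transfer for finite group actions\<close>

lemma sum_in_coboundaries:
  "(\<And>i. i \<in> I \<Longrightarrow> u i \<in> coboundaries X) \<Longrightarrow> (\<Sum>i\<in>I. u i) \<in> coboundaries X"
  by (induction I rule: infinite_finite_induct)
     (simp_all add: coboundaries_add del: plus_fun_apply zero_fun_apply)

text \<open>The diagonal action on \<open>E \<times> M\<close> and the action on twisted paths are given by formulas that do not
  return the value \<^const>\<open>undefined\<close> outside the space. They are thus not group actions in the sense
  of \<^locale>\<open>group_action\<close>, which takes bijections of the underlying set to be extensional. Here the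
  laws are only required on points of the space.\<close>

locale topological_action = group G for G :: "('g, 'r) monoid_scheme" (structure) +
  fixes X :: "'a topology" and \<phi> :: "'g \<Rightarrow> 'a \<Rightarrow> 'a"
  assumes continuous_action_map: "g \<in> carrier G \<Longrightarrow> continuous_map X X (\<phi> g)"
    and action_one: "x \<in> topspace X \<Longrightarrow> \<phi> \<one> x = x"
    and action_mult: "g \<in> carrier G \<Longrightarrow> h \<in> carrier G \<Longrightarrow> x \<in> topspace X \<Longrightarrow>
      \<phi> (g \<otimes> h) x = \<phi> g (\<phi> h x)"
begin

lemma action_closed: "g \<in> carrier G \<Longrightarrow> x \<in> topspace X \<Longrightarrow> \<phi> g x \<in> topspace X"
  using continuous_action_map continuous_map_image_subset_topspace by blast

lemma action_inv: "g \<in> carrier G \<Longrightarrow> x \<in> topspace X \<Longrightarrow> \<phi> (inv g) (\<phi> g x) = x"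
  using action_mult[of "inv g" g x] action_one by simp

lemma action_inv': "g \<in> carrier G \<Longrightarrow> x \<in> topspace X \<Longrightarrow> \<phi> g (\<phi> (inv g) x) = x"
  using action_mult[of g "inv g" x] action_one by simp

lemma pullback_action_mult:
  assumes "g \<in> carrier G" "h \<in> carrier G"
  shows "pullback X (\<phi> h) (pullback X (\<phi> g) c) = pullback X (\<phi> (g \<otimes> h)) c"
  unfolding pullback_compose[OF continuous_action_map[OF assms(2)]]
  by (rule pullback_cong) (simp add: action_mult assms)

definition average :: "('a, 'k::field) cochain \<Rightarrow> ('a, 'k) cochain" where
  "average c = scale_cochain (inverse (of_nat (order G))) (\<Sum>g\<in>carrier G. pullback X (\<phi> g) c)"

lemma average_in_cochains: "c \<in> cochains X \<Longrightarrow> average c \<in> cochains X"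
  unfolding average_def by (intro scale_in_cochains sum_in_cochains pullback_in_cochains)

lemma pullback_average:
  assumes h: "h \<in> carrier G"
  shows "pullback X (\<phi> h) (average c) = average c"
proof -
  have "(\<Sum>g\<in>carrier G. pullback X (\<phi> h) (pullback X (\<phi> g) c)) =
      (\<Sum>g\<in>carrier G. pullback X (\<phi> (g \<otimes> h)) c)"
    by (intro sum.cong refl pullback_action_mult h)
  also have "\<dots> = (\<Sum>g\<in>carrier G. pullback X (\<phi> g) c)"
    by (rule sum.reindex_bij_witness[of _ "\<lambda>g. g \<otimes> inv h" "\<lambda>g. g \<otimes> h"])
       (use h in \<open>simp_all add: m_assoc\<close>)
  finally show ?thesis
    by (simp add: average_def pullback_scale pullback_sum)
qed

lemma coboundary_average: "coboundary X (average c) = average (coboundary X c)"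
  unfolding average_def coboundary_scale coboundary_sum
  by (intro arg_cong[where f = "scale_cochain _"] sum.cong refl coboundary_pullback continuous_action_map)

lemma average_invariant:
  fixes c :: "('a, 'k::field) cochain"
  assumes "finite (carrier G)" "(of_nat (order G) :: 'k) \<noteq> 0"
    and "\<And>h. h \<in> carrier G \<Longrightarrow> pullback X (\<phi> h) c = c"
  shows "average c = c"
  using assms by (simp add: average_def fun_eq_iff sum_fun_apply order_def)

text \<open>An invariant class is represented by the average of any of its cocycles, since the average differs
  from the cocycle by a mean of coboundaries.\<close>

lemma average_diff_in_coboundaries:
  fixes c :: "('a, 'k::field) cochain"
  assumes fin: "finite (carrier G)" and ord: "(of_nat (order G) :: 'k) \<noteq> 0"
    and inv: "\<And>h. h \<in> carrier G \<Longrightarrow> pullback X (\<phi> h) c - c \<in> coboundaries X"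
  shows "average c - c \<in> coboundaries X"
proof -
  have "average c - c = scale_cochain (inverse (of_nat (order G)))
      (\<Sum>g\<in>carrier G. pullback X (\<phi> g) c - c)"
    using ord fin by (simp add: average_def fun_eq_iff sum_fun_apply sum_subtractf order_def field_simps)
  moreover have "(\<Sum>g\<in>carrier G. pullback X (\<phi> g) c - c) \<in> coboundaries X"
    using inv by (rule sum_in_coboundaries)
  ultimately show ?thesis
    by (simp only: coboundaries_scale)
qed

lemma cohomology_class_invariant_iff:
  assumes "h \<in> carrier G"
  shows "cohomology_map X X (\<phi> h) (cohomology_class X c) = cohomology_class X c \<longleftrightarrow>
    pullback X (\<phi> h) c - c \<in> coboundaries X"
  by (simp add: cohomology_map_class continuous_action_map assms cohomology_class_eq_iff)

end

definition invariant_classes ::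
    "('g, 'r) monoid_scheme \<Rightarrow> 'a topology \<Rightarrow> ('g \<Rightarrow> 'a \<Rightarrow> 'a) \<Rightarrow> ('a, 'k::field) cochain set set" where
  "invariant_classes G X \<phi> =
     {x \<in> carrier (cohomology X). \<forall>h\<in>carrier G. cohomology_map X X (\<phi> h) x = x}"

text \<open>The map \<open>q\<close> is a quotient by \<open>G\<close> as far as singular simplices can see: the simplices of \<open>L\<close> are
  the \<open>G\<close>-orbits of simplices of \<open>X\<close>.\<close>

locale simplicial_orbit_map = topological_action G X \<phi>
  for G :: "('g, 'r) monoid_scheme" (structure) and X :: "'a topology" and \<phi> :: "'g \<Rightarrow> 'a \<Rightarrow> 'a" +
  fixes L :: "'b topology" and q :: "'a \<Rightarrow> 'b"
  assumes finite_group: "finite (carrier G)"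
    and continuous_q: "continuous_map X L q"
    and q_invariant: "h \<in> carrier G \<Longrightarrow> x \<in> topspace X \<Longrightarrow> q (\<phi> h x) = q x"
    and simplex_lift: "singular_simplex n L \<tau> \<Longrightarrow> \<exists>\<sigma>. singular_simplex n X \<sigma> \<and> simplex_map n q \<sigma> = \<tau>"
    and simplex_lift_unique: "singular_simplex n X \<sigma> \<Longrightarrow> singular_simplex n X \<sigma>' \<Longrightarrow>
      simplex_map n q \<sigma> = simplex_map n q \<sigma>' \<Longrightarrow> \<exists>h\<in>carrier G. \<sigma>' = simplex_map n (\<phi> h) \<sigma>"
begin

lemma pullback_q_injective:
  assumes "d \<in> cochains L" "e \<in> cochains L" "pullback X q d = pullback X q e"
  shows "d = e"
proof (rule cochain_eqI[OF assms(1,2)])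
  fix n \<tau> assume "singular_simplex n L \<tau>"
  then obtain \<sigma> where \<sigma>: "singular_simplex n X \<sigma>" "simplex_map n q \<sigma> = \<tau>"
    using simplex_lift by blast
  have "pullback X q d n \<sigma> = pullback X q e n \<sigma>"
    using assms(3) by simp
  then show "d n \<tau> = e n \<tau>"
    using \<sigma> by (simp add: pullback_def)
qed

lemma pullback_q_invariant:
  assumes "h \<in> carrier G"
  shows "pullback X (\<phi> h) (pullback X q d) = pullback X q d"
  unfolding pullback_compose[OF continuous_action_map[OF assms]]
  by (rule pullback_cong) (simp add: q_invariant assms)

text \<open>An invariant cochain takes the same value on all lifts of a simplex, so it may be evaluated on an
  arbitrary one.\<close>

lemma invariant_cochain_descends:
  assumes c: "c \<in> cochains X" and inv: "\<And>h. h \<in> carrier G \<Longrightarrow> pullback X (\<phi> h) c = c"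
  obtains d where "d \<in> cochains L" "pullback X q d = c"
proof -
  define d where "d = (\<lambda>n \<tau>. if singular_simplex n L \<tau>
    then c n (SOME \<sigma>. singular_simplex n X \<sigma> \<and> simplex_map n q \<sigma> = \<tau>) else 0)"
  have "d \<in> cochains L"
    using cochains_bounded[OF c] by (auto intro!: cochainsI simp: d_def)
  moreover have "pullback X q d n \<sigma> = c n \<sigma>" for n \<sigma>
  proof (cases "singular_simplex n X \<sigma>")
    case \<sigma>: True
    define \<sigma>' where "\<sigma>' = (SOME \<rho>. singular_simplex n X \<rho> \<and> simplex_map n q \<rho> = simplex_map n q \<sigma>)"
    have \<sigma>': "singular_simplex n X \<sigma>' \<and> simplex_map n q \<sigma>' = simplex_map n q \<sigma>"
      unfolding \<sigma>'_def by (rule someI[of _ \<sigma>]) (simp add: \<sigma>)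
    then obtain h where h: "h \<in> carrier G" "\<sigma>' = simplex_map n (\<phi> h) \<sigma>"
      using simplex_lift_unique[OF \<sigma>, of \<sigma>'] by auto
    have "pullback X q d n \<sigma> = c n \<sigma>'"
      using \<sigma> singular_simplex_simplex_map[OF \<sigma> continuous_q]
      by (simp add: pullback_def d_def \<sigma>'_def)
    also have "\<dots> = pullback X (\<phi> h) c n \<sigma>"
      using \<sigma> by (simp add: pullback_def h)
    finally show ?thesis
      by (simp add: inv[OF h(1)])
  qed (simp add: pullback_def cochain_outside[OF c])
  ultimately show ?thesis
    using that by (auto simp: fun_eq_iff)
qed

text \<open>If the pullback of a cocycle is the coboundary of \<open>u\<close>, it is also the coboundary of the average of
  \<open>u\<close>, and that average comes from \<open>L\<close>.\<close>

lemma inj_on_cohomology_map_q: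
  assumes "(of_nat (order G) :: 'k::field) \<noteq> 0"
  shows "inj_on (cohomology_map X L q)
    (carrier (cohomology L :: ('k, ('b, 'k) cochain set) module))"
proof (rule inj_onI)
  fix x y :: "('b, 'k) cochain set"
  assume "x \<in> carrier (cohomology L)" "y \<in> carrier (cohomology L)"
    and eq: "cohomology_map X L q x = cohomology_map X L q y"
  then obtain a b where ab: "a \<in> cocycles L" "x = cohomology_class L a"
    "b \<in> cocycles L" "y = cohomology_class L b"
    unfolding carrier_cohomology by blast
  have "pullback X q (a - b) \<in> coboundaries X"
    using eq by (simp add: ab cohomology_map_class[OF continuous_q] cohomology_class_eq_iff pullback_diff)
  then obtain u where u: "u \<in> cochains X" "pullback X q (a - b) = coboundary X u"
    by (auto simp: coboundaries_def)
  obtain v where v: "v \<in> cochains L" "pullback X q v = average u"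
    using invariant_cochain_descends[OF average_in_cochains[OF u(1)] pullback_average] by blast
  have "pullback X q (coboundary L v) = average (pullback X q (a - b))"
    by (simp only: coboundary_pullback[OF continuous_q, symmetric] v(2) coboundary_average u(2))
  also have "\<dots> = pullback X q (a - b)"
    by (rule average_invariant[OF finite_group assms pullback_q_invariant])
  finally have "coboundary L v = a - b"
    using ab v by (intro pullback_q_injective) (simp_all add: coboundary_in_cochains diff_in_cochains)
  then have "a - b \<in> coboundaries L"
    unfolding coboundaries_def using v(1) by (metis image_eqI)
  then show "x = y"
    by (simp add: ab cohomology_class_eq_iff)
qed

text \<open>An invariant class contains an invariant cocycle by averaging, and this cocycle comes from \<open>L\<close>.\<close>

lemma cohomology_map_q_image:
  assumes "(of_nat (order G) :: 'k::field) \<noteq> 0"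
  shows "cohomology_map X L q ` carrier (cohomology L :: ('k, ('b, 'k) cochain set) module) =
    invariant_classes G X \<phi>"
proof (intro equalityI subsetI)
  fix x assume "x \<in> cohomology_map X L q ` carrier (cohomology L :: ('k, ('b, 'k) cochain set) module)"
  then obtain a where a: "a \<in> cocycles L" "x = cohomology_class X (pullback X q a)"
    unfolding carrier_cohomology by (auto simp: cohomology_map_class[OF continuous_q])
  then show "x \<in> invariant_classes G X \<phi>"
    using pullback_in_cocycles[OF continuous_q a(1)]
    by (simp add: invariant_classes_def carrier_cohomology cohomology_class_invariant_iff
        pullback_q_invariant)
next
  fix x :: "('a, 'k) cochain set"
  assume x: "x \<in> invariant_classes G X \<phi>"
  then obtain c where c: "c \<in> cocycles X" "x = cohomology_class X c"
    unfolding invariant_classes_def carrier_cohomology by blast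
  have inv: "pullback X (\<phi> h) c - c \<in> coboundaries X" if "h \<in> carrier G" for h
    using x that unfolding invariant_classes_def c(2) by (simp add: cohomology_class_invariant_iff)
  have c': "c \<in> cochains X" "coboundary X c = 0" using c(1) by simp_all
  obtain d where d: "d \<in> cochains L" "pullback X q d = average c"
    using invariant_cochain_descends[OF average_in_cochains[OF c'(1)] pullback_average] by blast
  have "pullback X q (coboundary L d) = pullback X q 0"
    by (simp add: coboundary_pullback[OF continuous_q, symmetric] d coboundary_average c'(2)
        average_invariant[OF finite_group assms])
  then have "coboundary L d = 0"
    by (intro pullback_q_injective) (simp_all add: coboundary_in_cochains d)
  then have "cohomology_class L d \<in> carrier (cohomology L)"
    using d by (auto simp: carrier_cohomology)
  moreover have "cohomology_map X L q (cohomology_class L d) = x"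
    unfolding cohomology_map_class[OF continuous_q] d(2) c(2) cohomology_class_eq_iff
    by (rule average_diff_in_coboundaries[OF finite_group assms inv])
  ultimately show "x \<in> cohomology_map X L q ` carrier (cohomology L)"
    by blast
qed

end

lemma (in topological_action) continuous_map_discrete_prod:
  "continuous_map (prod_topology (discrete_topology (carrier G)) X) X (\<lambda>(g, x). \<phi> g x)"
proof (rule pasting_lemma[where I = "carrier G" and T = "\<lambda>g. {g} \<times> topspace X"
      and f = "\<lambda>g (_, x). \<phi> g x"])
  fix g assume g: "g \<in> carrier G"
  show "openin (prod_topology (discrete_topology (carrier G)) X) ({g} \<times> topspace X)"
    using g by (simp add: openin_prod_Times_iff)
  have "continuous_map (prod_topology (discrete_topology (carrier G)) X) X (\<phi> g \<circ> snd)"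
    using continuous_map_compose[OF continuous_map_snd continuous_action_map[OF g]] .
  then show "continuous_map (subtopology (prod_topology (discrete_topology (carrier G)) X)
      ({g} \<times> topspace X)) X (\<lambda>(_, x). \<phi> g x)"
    by (simp add: continuous_map_from_subtopology comp_def split_def)
qed auto

lemma singular_simplex_discrete_prod:
  assumes "singular_simplex n (prod_topology (discrete_topology S) X) \<sigma>"
  obtains g where "g \<in> S" "\<And>x. x \<in> standard_simplex n \<Longrightarrow> fst (\<sigma> x) = g"
proof -
  let ?D = "subtopology (powertop_real UNIV) (standard_simplex n)"
  have "continuous_map ?D (discrete_topology S) (fst \<circ> \<sigma>)"
    using assms continuous_map_compose continuous_map_fst unfolding singular_simplex_def by blast
  moreover have "connectedin ?D (standard_simplex n)"
    by (simp add: connectedin_subtopology connectedin_standard_simplex)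
  ultimately have "connectedin (discrete_topology S) ((fst \<circ> \<sigma>) ` standard_simplex n)"
    using connectedin_continuous_map_image by blast
  then obtain g where "(fst \<circ> \<sigma>) ` standard_simplex n \<subseteq> S" "(fst \<circ> \<sigma>) ` standard_simplex n \<subseteq> {g}"
    unfolding connectedin_discrete_topology by blast
  then show ?thesis
    using nonempty_standard_simplex[of n] that[of g] by fastforce
qed

lemma continuous_map_slice:
  "h \<in> S \<Longrightarrow> continuous_map X (prod_topology (discrete_topology S) X) (\<lambda>x. (h, x))"
  by (simp add: continuous_map_pairwise comp_def)

text \<open>A simplex is connected, so it lies in one of the slices \<open>{h} \<times> X\<close>. Cochains with coboundary \<open>c\<close> on the
  slices therefore fit together to one on the product; its degrees are bounded because there are
  finitely many slices.\<close>

lemma coboundary_on_slices_imp_coboundary: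
  assumes fin: "finite S" and c: "c \<in> cochains (prod_topology (discrete_topology S) X)"
    and slices: "\<And>h. h \<in> S \<Longrightarrow> pullback X (\<lambda>x. (h, x)) c \<in> coboundaries X"
  shows "c \<in> coboundaries (prod_topology (discrete_topology S) X)"
proof -
  let ?P = "prod_topology (discrete_topology S) X"
  have "\<forall>h\<in>S. \<exists>u. u \<in> cochains X \<and> pullback X (\<lambda>x. (h, x)) c = coboundary X u"
    using slices by (force simp: coboundaries_def)
  from bchoice[OF this] obtain u where u: "\<And>h. h \<in> S \<Longrightarrow> u h \<in> cochains X"
    "\<And>h. h \<in> S \<Longrightarrow> pullback X (\<lambda>x. (h, x)) c = coboundary X (u h)"
    by blast
  \<comment> \<open>All points of a simplex have the same index, which is read off at the vertex \<open>e\<^sub>0\<close>.\<close>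
  define w where "w = (\<lambda>n \<sigma>. if singular_simplex n ?P \<sigma>
    then u (fst (\<sigma> (\<lambda>j. if j = 0 then 1 else 0))) n (simplex_map n snd \<sigma>) else 0)"
  have w_eq: "w n \<sigma> = u h n (simplex_map n snd \<sigma>)"
    if "singular_simplex n ?P \<sigma>" "\<And>x. x \<in> standard_simplex n \<Longrightarrow> fst (\<sigma> x) = h" for n \<sigma> h
    using that basis_in_standard_simplex[of 0 n] by (simp add: w_def)
  have "w \<in> cochains ?P"
  proof -
    have "\<forall>h\<in>S. \<exists>N. \<forall>n>N. \<forall>\<sigma>. u h n \<sigma> = 0"
      using u(1) cochains_bounded by blast
    then obtain N where N: "\<And>h n \<sigma>. h \<in> S \<Longrightarrow> n > N h \<Longrightarrow> u h n \<sigma> = 0"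
      by metis
    show ?thesis
    proof (rule cochainsI[of "\<Sum>h\<in>S. N h"])
      fix n \<sigma> assume n: "n > (\<Sum>h\<in>S. N h)"
      show "w n \<sigma> = 0"
      proof (cases "singular_simplex n ?P \<sigma>")
        case True
        then obtain h where h: "h \<in> S" "\<And>x. x \<in> standard_simplex n \<Longrightarrow> fst (\<sigma> x) = h"
          by (rule singular_simplex_discrete_prod) blast
        have "N h < n"
          using member_le_sum[OF h(1), of N] fin n by simp
        then show ?thesis
          using w_eq[OF True h(2)] N[OF h(1)] by simp
      qed (simp add: w_def)
    qed (simp add: w_def)
  qed
  moreover have "coboundary ?P w = c"
  proof (rule cochain_eqI[OF coboundary_in_cochains[OF \<open>w \<in> cochains ?P\<close>] c])
    fix n \<sigma> assume \<sigma>: "singular_simplex n ?P \<sigma>"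
    then obtain h where h: "h \<in> S" "\<And>x. x \<in> standard_simplex n \<Longrightarrow> fst (\<sigma> x) = h"
      by (rule singular_simplex_discrete_prod) blast
    let ?\<sigma> = "simplex_map n snd \<sigma>"
    have \<sigma>': "singular_simplex n X ?\<sigma>"
      using singular_simplex_simplex_map[OF \<sigma> continuous_map_snd] .
    have "coboundary ?P w n \<sigma> = coboundary X (u h) n ?\<sigma>"
    proof (cases n)
      case (Suc m)
      have "w m (singular_face (Suc m) i \<sigma>) = u h m (singular_face (Suc m) i ?\<sigma>)" if i: "i \<le> Suc m" for i
      proof -
        have \<sigma>m: "singular_simplex (Suc m) ?P \<sigma>" using \<sigma> Suc by simp
        have "fst (singular_face (Suc m) i \<sigma> x) = h" if "x \<in> standard_simplex m" for x
          using that i h(2) Suc simplical_face_in_standard_simplex[of "Suc m" i x]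
          by (simp add: singular_face_def)
        then have "w m (singular_face (Suc m) i \<sigma>) = u h m (simplex_map m snd (singular_face (Suc m) i \<sigma>))"
          using singular_simplex_face[OF \<sigma>m i] by (intro w_eq)
        then show ?thesis
          using singular_face_of_simplex_map[OF \<sigma>m i, of snd] Suc by simp
      qed
      then show ?thesis
        using \<sigma> \<sigma>' unfolding Suc by (simp add: coboundary_Suc del: sum.atMost_Suc)
    qed simp
    also have "\<dots> = c n (simplex_map n (\<lambda>x. (h, x)) ?\<sigma>)"
      using \<sigma>' by (simp add: u(2)[OF h(1), symmetric] pullback_def)
    also have "simplex_map n (\<lambda>x. (h, x)) ?\<sigma> = \<sigma>"
      using \<sigma> h(2) unfolding simplex_map_def singular_simplex_def
      by (intro restrict_eq_extensional) (simp_all add: prod_eq_iff)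
    finally show "coboundary ?P w n \<sigma> = c n \<sigma>" .
  qed
  ultimately show ?thesis
    unfolding coboundaries_def by blast
qed

text \<open>On the slice with index \<open>h\<close> the class \<open>\<nabla>(x)\<close> restricts to \<open>h\<^sup>* x\<close> and \<open>1 \<otimes> x\<close> restricts to \<open>x\<close>.\<close>

lemma (in topological_action) cotensor_condition_iff:
  assumes fin: "finite (carrier G)" and x: "x \<in> carrier (cohomology X)"
  shows "coaction G X \<phi> x = cross_product (discrete_topology (carrier G)) X
      \<one>\<^bsub>cohomology (discrete_topology (carrier G))\<^esub> x \<longleftrightarrow>
    (\<forall>h\<in>carrier G. cohomology_map X X (\<phi> h) x = x)"
proof -
  let ?D = "discrete_topology (carrier G)"
  let ?P = "prod_topology ?D X"
  let ?a = "\<lambda>(g, x). \<phi> g x"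
  note a = continuous_map_discrete_prod
  obtain z where z: "z \<in> cocycles X" "x = cohomology_class X z"
    using x by (rule cohomology_cases)
  have "cup ?P (unit_cochain ?P) (pullback ?P snd z) = pullback ?P snd z"
    using z(1) by (intro cup_unit_left) (simp add: pullback_in_cochains[of z X])
  then have cross: "cross_product ?D X \<one>\<^bsub>cohomology ?D\<^esub> x = cohomology_class ?P (pullback ?P snd z)"
    by (simp only: cross_product_def cohomology_one z(2) cohomology_map_class[OF continuous_map_fst]
        cohomology_map_class[OF continuous_map_snd] pullback_unit[OF continuous_map_fst]
        cohomology_mult[OF unit_cochain_in_cocycles pullback_in_cocycles[OF continuous_map_snd z(1)]])
  let ?c = "pullback ?P ?a z - pullback ?P snd z"
  have slice: "pullback X (\<lambda>x. (h, x)) ?c = pullback X (\<phi> h) z - z" if "h \<in> carrier G" for h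
    using z(1) pullback_id[of z X id]
    by (simp add: pullback_diff pullback_compose[OF continuous_map_slice[OF that]] comp_def id_def)
  have c: "?c \<in> cochains ?P"
    using z(1) pullback_in_cochains[of z X] by (intro diff_in_cochains) auto
  have "coaction G X \<phi> x = cross_product ?D X \<one>\<^bsub>cohomology ?D\<^esub> x \<longleftrightarrow> ?c \<in> coboundaries ?P"
    unfolding cross coaction_def
    unfolding z(2) cohomology_map_class[OF a] cohomology_class_eq_iff ..
  also have "\<dots> \<longleftrightarrow> (\<forall>h\<in>carrier G. pullback X (\<lambda>x. (h, x)) ?c \<in> coboundaries X)"
  proof (intro iffI ballI)
    fix h assume "?c \<in> coboundaries ?P" "h \<in> carrier G"
    then show "pullback X (\<lambda>x. (h, x)) ?c \<in> coboundaries X"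
      by (intro pullback_in_coboundaries[OF continuous_map_slice])
  next
    assume "\<forall>h\<in>carrier G. pullback X (\<lambda>x. (h, x)) ?c \<in> coboundaries X"
    then show "?c \<in> coboundaries ?P"
      by (intro coboundary_on_slices_imp_coboundary[OF fin c]) (rule bspec)
  qed
  also have "\<dots> \<longleftrightarrow> (\<forall>h\<in>carrier G. cohomology_map X X (\<phi> h) x = x)"
    by (simp add: slice z(2) cohomology_class_invariant_iff)
  finally show ?thesis .
qed


section \<open>Spaces of maps and the exponential law\<close>

text \<open>The set of points \<open>t\<close> for which \<open>{t} \<times> C\<close> is mapped into \<open>V\<close> is open by the tube lemma, for \<open>C\<close> compact.\<close>

lemma compact_open_curry:
  assumes F: "continuous_map (prod_topology T K) Y F"
  shows "continuous_map T (compact_open_topology K Y) (\<lambda>t. restrict (\<lambda>k. F (t, k)) (topspace K))"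
proof -
  let ?f = "\<lambda>t. restrict (\<lambda>k. F (t, k)) (topspace K)"
  let ?S = "{{f \<in> extensional (topspace K). continuous_map K Y f \<and> f ` C \<subseteq> U} |C U. compactin K C \<and> openin Y U}"
  have cont: "continuous_map K Y (?f t)" if "t \<in> topspace T" for t
  proof -
    have "continuous_map K (prod_topology T K) (\<lambda>k. (t, k))"
      using that by (simp add: continuous_map_pairwise comp_def)
    then have "continuous_map K Y (F \<circ> (\<lambda>k. (t, k)))"
      using F continuous_map_compose by blast
    then show ?thesis by (rule continuous_map_eq) simp
  qed
  have "openin T (?f -` U \<inter> topspace T)" if US: "U \<in> ?S" for U
  proof -
    obtain C V where U: "U = {f \<in> extensional (topspace K). continuous_map K Y f \<and> f ` C \<subseteq> V}"
      and C: "compactin K C" and V: "openin Y V"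
      using US by blast
    let ?W = "{p \<in> topspace (prod_topology T K). F p \<in> V}"
    have W: "openin (prod_topology T K) ?W"
      using F V by (rule openin_continuous_map_preimage)
    have "?f -` U \<inter> topspace T = {t \<in> topspace T. {t} \<times> C \<subseteq> ?W}"
      using compactin_subset_topspace[OF C] cont unfolding U by (fastforce simp: image_subset_iff)
    moreover have "openin T {t \<in> topspace T. {t} \<times> C \<subseteq> ?W}"
    proof (subst openin_subopen, intro ballI)
      fix t assume "t \<in> {t \<in> topspace T. {t} \<times> C \<subseteq> ?W}"
      then have t: "compactin T {t}" "{t} \<times> C \<subseteq> ?W"
        by simp_all
      obtain A B where AB: "openin T A" "{t} \<subseteq> A" "C \<subseteq> B" "A \<times> B \<subseteq> ?W"
        by (rule Wallace_theorem_prod_topology[OF t(1) C W t(2)]) blast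
      then show "\<exists>A. openin T A \<and> t \<in> A \<and> A \<subseteq> {t \<in> topspace T. {t} \<times> C \<subseteq> ?W}"
        using openin_subset[OF AB(1)] by (intro exI[of _ A]) blast
    qed
    ultimately show ?thesis by simp
  qed
  moreover have "?f ` topspace T \<subseteq> \<Union> ?S"
    using cont topspace_compact_open_topology[of K Y]
    unfolding compact_open_topology_def topology_generated_by_topspace by auto
  ultimately show ?thesis
    unfolding compact_open_topology_def by (intro continuous_on_generated_topo)
qed

text \<open>If \<open>f k \<in> U\<close>, then \<open>k\<close> has a compact neighbourhood \<open>C\<close> inside the preimage of \<open>U\<close>. The maps that send \<open>C\<close>
  into \<open>U\<close>, paired with the points of \<open>C\<close>, form a neighbourhood of \<open>(f, k)\<close> on which evaluation
  takes values in \<open>U\<close>.\<close>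

lemma compact_open_evaluation:
  assumes K: "compact_space K" "Hausdorff_space K"
  shows "continuous_map (prod_topology (compact_open_topology K Y) K) Y (\<lambda>(f, k). f k)"
  unfolding continuous_map_def
proof (intro conjI allI impI)
  show "(\<lambda>(f, k). f k) \<in> topspace (prod_topology (compact_open_topology K Y) K) \<rightarrow> topspace Y"
    by (auto simp: topspace_compact_open_topology continuous_map_def)
  fix U assume U: "openin Y U"
  have nbhd: "neighbourhood_base_of (compactin K) K"
    using K compact_imp_locally_compact_space locally_compact_space_neighbourhood_base by blast
  show "openin (prod_topology (compact_open_topology K Y) K)
      {p \<in> topspace (prod_topology (compact_open_topology K Y) K). (\<lambda>(f, k). f k) p \<in> U}"
    unfolding openin_prod_topology_alt
  proof (intro allI impI)
    fix f k
    assume "(f, k) \<in> {p \<in> topspace (prod_topology (compact_open_topology K Y) K). (\<lambda>(f, k). f k) p \<in> U}"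
    then have f: "f \<in> extensional (topspace K)" "continuous_map K Y f" and k: "k \<in> topspace K" "f k \<in> U"
      by (auto simp: topspace_compact_open_topology)
    have "openin K {x \<in> topspace K. f x \<in> U}"
      using f(2) U by (rule openin_continuous_map_preimage)
    then obtain V C where VC: "openin K V" "compactin K C" "k \<in> V" "V \<subseteq> C" "C \<subseteq> {x \<in> topspace K. f x \<in> U}"
      using nbhd k unfolding neighbourhood_base_of by (metis (mono_tags, lifting) mem_Collect_eq)
    let ?B = "{f \<in> extensional (topspace K). continuous_map K Y f \<and> f ` C \<subseteq> U}"
    have "openin (compact_open_topology K Y) ?B"
      unfolding compact_open_topology_def
      using VC(2) U by (intro topology_generated_by_Basis) blast
    moreover have "?B \<times> V \<subseteq> {p \<in> topspace (prod_topology (compact_open_topology K Y) K). (\<lambda>(f, k). f k) p \<in> U}"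
      using VC by (auto simp: topspace_compact_open_topology)
    ultimately show "\<exists>A B. openin (compact_open_topology K Y) A \<and> openin K B \<and> f \<in> A \<and> k \<in> B \<and>
        A \<times> B \<subseteq> {p \<in> topspace (prod_topology (compact_open_topology K Y) K). (\<lambda>(f, k). f k) p \<in> U}"
      using VC f by (intro exI[of _ ?B] exI[of _ V]) auto
  qed
qed

lemma compact_open_uncurry:
  assumes K: "compact_space K" "Hausdorff_space K"
    and f: "continuous_map T (compact_open_topology K Y) f"
  shows "continuous_map (prod_topology T K) Y (\<lambda>(t, k). f t k)"
proof -
  have "continuous_map (prod_topology T K) (prod_topology (compact_open_topology K Y) K) (\<lambda>(t, k). (f t, k))"
    using f by (simp add: continuous_map_prod_top)
  from continuous_map_compose[OF this compact_open_evaluation[OF K]] show ?thesis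
    by (simp add: comp_def split_def)
qed

abbreviation unit_interval :: "real topology" where
  "unit_interval \<equiv> top_of_set {0..1}"

abbreviation unit_circle :: "complex topology" where
  "unit_circle \<equiv> top_of_set (sphere 0 1)"

lemma compact_Hausdorff_unit_interval: "compact_space unit_interval" "Hausdorff_space unit_interval"
  by (simp_all add: compact_space_subtopology Hausdorff_space_subtopology)

lemma compact_Hausdorff_unit_circle: "compact_space unit_circle" "Hausdorff_space unit_circle"
  by (simp_all add: compact_space_subtopology Hausdorff_space_subtopology)

lemma topspace_twisted_paths:
  "topspace (twisted_paths Y \<alpha> g) =
    {\<gamma> \<in> extensional {0..1}. continuous_map unit_interval Y \<gamma> \<and> \<gamma> 1 = \<alpha> g (\<gamma> 0)}"
  by (auto simp: twisted_paths_def topspace_compact_open_topology)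

lemma twisted_paths_curry:
  assumes F: "continuous_map (prod_topology T unit_interval) Y F"
    and "\<And>x. x \<in> topspace T \<Longrightarrow> F (x, 1) = \<alpha> g (F (x, 0))"
  shows "continuous_map T (twisted_paths Y \<alpha> g) (\<lambda>x. \<lambda>t\<in>{0..1}. F (x, t))"
  using compact_open_curry[OF F] assms(2)
  by (auto simp: twisted_paths_def continuous_map_in_subtopology)

lemma twisted_paths_uncurry:
  assumes "continuous_map T (twisted_paths Y \<alpha> g) f"
  shows "continuous_map (prod_topology T unit_interval) Y (\<lambda>(x, t). f x t)"
  using assms compact_open_uncurry[OF compact_Hausdorff_unit_interval]
  by (auto simp: twisted_paths_def continuous_map_in_subtopology)

lemma twisted_paths_evaluation:
  "continuous_map (prod_topology (twisted_paths Y \<alpha> g) unit_interval) Y (\<lambda>(\<gamma>, t). \<gamma> t)"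
  using twisted_paths_uncurry[OF continuous_map_id[unfolded id_def]] .

lemma twisted_paths_evaluate:
  assumes "continuous_map S (twisted_paths Y \<alpha> g) p" "continuous_map S unit_interval r"
  shows "continuous_map S Y (\<lambda>x. p x (r x))"
  using continuous_map_compose[OF continuous_map_pairedI[OF assms] twisted_paths_evaluation]
  by (simp add: comp_def)

lemma continuous_map_from_sum_topology:
  assumes "\<And>i. i \<in> I \<Longrightarrow> continuous_map (X i) Z (\<lambda>x. f (i, x))"
  shows "continuous_map (sum_topology X I) Z f"
  unfolding continuous_map_def
proof (intro conjI allI impI)
  show "f \<in> topspace (sum_topology X I) \<rightarrow> topspace Z"
    using assms by (auto simp: continuous_map_def Pi_iff)
  fix U assume U: "openin Z U"
  have "openin (X i) {x. (i, x) \<in> {p \<in> topspace (sum_topology X I). f p \<in> U}}" if "i \<in> I" for i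
    using openin_continuous_map_preimage[OF assms[OF that] U] that by simp
  then show "openin (sum_topology X I) {p \<in> topspace (sum_topology X I). f p \<in> U}"
    unfolding openin_sum_topology by auto
qed

lemma continuous_map_sum_component_snd:
  assumes "i \<in> I"
  shows "continuous_map (subtopology (sum_topology X I) ({i} \<times> topspace (X i))) (X i) snd"
  unfolding continuous_map_def
proof (intro conjI allI impI)
  fix U assume U: "openin (X i) U"
  have "{p \<in> topspace (subtopology (sum_topology X I) ({i} \<times> topspace (X i))). snd p \<in> U} = Pair i ` U"
    using openin_subset[OF U] assms by auto
  moreover have "openin (sum_topology X I) (Pair i ` U)"
    using open_map_component_injection[OF assms] U unfolding open_map_def by blast
  ultimately show "openin (subtopology (sum_topology X I) ({i} \<times> topspace (X i)))
      {p \<in> topspace (subtopology (sum_topology X I) ({i} \<times> topspace (X i))). snd p \<in> U}"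
    using openin_subset[OF U] unfolding openin_subtopology by (intro exI[of _ "Pair i ` U"]) auto
qed auto

lemma continuous_map_from_prod_sum_topology:
  assumes "\<And>i. i \<in> I \<Longrightarrow> continuous_map (prod_topology T (X i)) Z (\<lambda>(t, x). f (t, (i, x)))"
  shows "continuous_map (prod_topology T (sum_topology X I)) Z f"
proof (rule pasting_lemma[where I = I and T = "\<lambda>i. topspace T \<times> ({i} \<times> topspace (X i))" and f = "\<lambda>i. f"])
  fix i assume i: "i \<in> I"
  have Pair_image: "Pair i ` topspace (X i) = {i} \<times> topspace (X i)" by auto
  have op: "openin (sum_topology X I) ({i} \<times> topspace (X i))"
    using open_map_component_injection[OF i, of X] openin_topspace[of "X i"]
    unfolding open_map_def Pair_image[symmetric] by blast
  then show "openin (prod_topology T (sum_topology X I)) (topspace T \<times> ({i} \<times> topspace (X i)))"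
    by (simp add: openin_prod_Times_iff)
  note continuous_map_sum_component_snd[OF i, of X]
  then have "continuous_map (prod_topology T (subtopology (sum_topology X I) ({i} \<times> topspace (X i))))
      (prod_topology T (X i)) (\<lambda>(t, p). (t, snd p))"
    by (simp add: continuous_map_prod_top)
  from continuous_map_compose[OF this assms[OF i]]
  have "continuous_map (prod_topology T (subtopology (sum_topology X I) ({i} \<times> topspace (X i)))) Z
      (\<lambda>(t, p). f (t, (i, snd p)))"
    by (simp add: comp_def split_def)
  then show "continuous_map (subtopology (prod_topology T (sum_topology X I))
      (topspace T \<times> ({i} \<times> topspace (X i)))) Z f"
    unfolding subtopology_Times subtopology_topspace by (rule continuous_map_eq) auto
qed auto


section \<open>Lifting through covering actions\<close>

lemma openin_prod_topologyE:
  assumes "openin (prod_topology X Y) W" "(x, y) \<in> W"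
  obtains U V where "openin X U" "openin Y V" "x \<in> U" "y \<in> V" "U \<times> V \<subseteq> W"
proof -
  have "\<exists>U V. openin X U \<and> openin Y V \<and> x \<in> U \<and> y \<in> V \<and> U \<times> V \<subseteq> W"
    using assms(1) assms(2) by (simp only: openin_prod_topology_alt)
  then show ?thesis by (elim exE conjE) (rule that)
qed

text \<open>The condition under which the orbit map is a covering; it forces the action to be free.\<close>

locale covering_action = topological_action G Y \<alpha>
  for G :: "('g, 'r) monoid_scheme" (structure) and Y :: "'a topology" and \<alpha> :: "'g \<Rightarrow> 'a \<Rightarrow> 'a" +
  assumes evenly_displaced: "y \<in> topspace Y \<Longrightarrow>
    \<exists>U. openin Y U \<and> y \<in> U \<and> (\<forall>g\<in>carrier G. g \<noteq> \<one> \<longrightarrow> \<alpha> g ` U \<inter> U = {})"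
begin

abbreviation B :: "'a set topology" where "B \<equiv> orbit_space G Y \<alpha>"
abbreviation q :: "'a \<Rightarrow> 'a set" where "q \<equiv> orbit G \<alpha>"

lemma action_free:
  assumes "g \<in> carrier G" "y \<in> topspace Y" "\<alpha> g y = y"
  shows "g = \<one>"
  using evenly_displaced[OF assms(2)] assms by (metis IntI empty_iff imageI)

lemma orbit_action:
  assumes "g \<in> carrier G" "y \<in> topspace Y" shows "q (\<alpha> g y) = q y"
proof -
  have "\<exists>k\<in>carrier G. \<alpha> h (\<alpha> g y) = \<alpha> k y" if "h \<in> carrier G" for h
    using action_mult[OF that assms] that assms by (metis m_closed)
  moreover have "\<exists>k\<in>carrier G. \<alpha> h y = \<alpha> k (\<alpha> g y)" if h: "h \<in> carrier G" for h
  proof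
    show "\<alpha> h y = \<alpha> (h \<otimes> inv g) (\<alpha> g y)"
      using assms h by (simp add: action_mult action_inv action_closed)
  qed (use assms h in simp)
  ultimately show ?thesis
    unfolding orbit_def by blast
qed

lemma orbit_eqD:
  assumes "y \<in> topspace Y" "y' \<in> topspace Y" "q y = q y'"
  shows "\<exists>g\<in>carrier G. y' = \<alpha> g y"
proof -
  have "y' \<in> q y'"
    unfolding orbit_def using action_one[OF assms(2)] one_closed by force
  then have "y' \<in> q y" using assms(3) by simp
  then show ?thesis
    by (auto simp: orbit_def)
qed

lemma continuous_orbit_map: "continuous_map Y B q"
  using quotient_imp_continuous_map quotient_map_orbit_space by blast

lemma topspace_orbit_space: "topspace B = q ` topspace Y"
  using quotient_imp_surjective_map[OF quotient_map_orbit_space[of Y G \<alpha>]] by simp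

lemma openin_translate:
  assumes "g \<in> carrier G" "openin Y U" shows "openin Y (\<alpha> g ` U)"
proof -
  have "\<alpha> g ` U = {y \<in> topspace Y. \<alpha> (inv g) y \<in> U}"
    using assms openin_subset[OF assms(2)]
    by (auto simp: action_inv action_closed subset_iff image_iff intro!: bexI[of _ "\<alpha> (inv g) _"] action_inv'[symmetric])
  then show ?thesis
    using openin_continuous_map_preimage[OF continuous_action_map[OF inv_closed[OF assms(1)]] assms(2)] by simp
qed

lemma openin_orbit_image:
  assumes "openin Y U" shows "openin B (q ` U)"
proof -
  have U: "U \<subseteq> topspace Y" using assms openin_subset by blast
  have "{y \<in> topspace Y. q y \<in> q ` U} = (\<Union>g\<in>carrier G. \<alpha> g ` U)"
  proof (intro equalityI subsetI)
    fix y assume "y \<in> {y \<in> topspace Y. q y \<in> q ` U}"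
    then obtain u where "y \<in> topspace Y" "u \<in> U" "q u = q y" by auto
    moreover from this U obtain g where "g \<in> carrier G" "y = \<alpha> g u"
      using orbit_eqD[of u y] by blast
    ultimately show "y \<in> (\<Union>g\<in>carrier G. \<alpha> g ` U)" by blast
  next
    fix y assume "y \<in> (\<Union>g\<in>carrier G. \<alpha> g ` U)"
    then obtain g u where "g \<in> carrier G" "u \<in> U" "y = \<alpha> g u" by blast
    then show "y \<in> {y \<in> topspace Y. q y \<in> q ` U}"
      using U action_closed orbit_action by blast
  qed
  then have "openin Y {y \<in> topspace Y. q y \<in> q ` U}"
    using openin_translate assms by auto
  then show ?thesis
    using U by (auto simp: openin_orbit_space orbits_def)
qed

lemma orbit_map_local_inj:
  assumes V: "openin Y V" "\<forall>g\<in>carrier G. g \<noteq> \<one> \<longrightarrow> \<alpha> g ` V \<inter> V = {}"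
    and y: "y \<in> V" "y' \<in> V" "q y = q y'"
  shows "y = y'"
proof -
  have "y \<in> topspace Y" "y' \<in> topspace Y" using openin_subset[OF V(1)] y by auto
  then obtain g where g: "g \<in> carrier G" "y' = \<alpha> g y" using orbit_eqD[of y y'] y by blast
  then have "y' \<in> \<alpha> g ` V \<inter> V" using y by blast
  then have "g = \<one>" using V(2) g by blast
  then show ?thesis using g action_one \<open>y \<in> topspace Y\<close> by simp
qed

text \<open>On a neighbourhood that is disjoint from its translates the orbit map is injective and open, so its
  inverse is continuous.\<close>

lemma local_section:
  assumes y: "y \<in> topspace Y"
  obtains V s where "openin Y V" "y \<in> V" "\<forall>g\<in>carrier G. g \<noteq> \<one> \<longrightarrow> \<alpha> g ` V \<inter> V = {}"
    "continuous_map (subtopology B (q ` V)) Y s" "\<And>w. w \<in> q ` V \<Longrightarrow> s w \<in> V \<and> q (s w) = w"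
proof -
  obtain V where V: "openin Y V" "y \<in> V" "\<forall>g\<in>carrier G. g \<noteq> \<one> \<longrightarrow> \<alpha> g ` V \<inter> V = {}"
    using evenly_displaced[OF y] by blast
  have VY: "V \<subseteq> topspace Y" using V(1) openin_subset by blast
  define s where "s = inv_into V q"
  have s: "s w \<in> V \<and> q (s w) = w" if "w \<in> q ` V" for w
    using that by (simp add: s_def inv_into_into f_inv_into_f)
  have "continuous_map (subtopology B (q ` V)) Y s"
    unfolding continuous_map_def
  proof (intro conjI allI impI)
    show "s \<in> topspace (subtopology B (q ` V)) \<rightarrow> topspace Y"
      using s VY by auto
    fix U assume U: "openin Y U"
    have "{w \<in> topspace (subtopology B (q ` V)). s w \<in> U} = q ` (U \<inter> V)"
    proof (intro equalityI subsetI)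
      fix w assume "w \<in> {w \<in> topspace (subtopology B (q ` V)). s w \<in> U}"
      then have "s w \<in> U \<inter> V" "w = q (s w)" using s by auto
      then show "w \<in> q ` (U \<inter> V)" by blast
    next
      fix w assume "w \<in> q ` (U \<inter> V)"
      then obtain v where v: "v \<in> U" "v \<in> V" "w = q v" by blast
      then have "s w = v"
        using orbit_map_local_inj[OF V(1,3), of "s w" v] s[of w] by blast
      then show "w \<in> {w \<in> topspace (subtopology B (q ` V)). s w \<in> U}"
        using v VY by (auto simp: topspace_orbit_space)
    qed
    moreover have "openin B (q ` (U \<inter> V))"
      using U V(1) by (intro openin_orbit_image openin_Int)
    moreover have "q ` (U \<inter> V) \<subseteq> q ` V" by blast
    ultimately show "openin (subtopology B (q ` V)) {w \<in> topspace (subtopology B (q ` V)). s w \<in> U}"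
      unfolding openin_subtopology by (metis inf.absorb1)
  qed
  then show ?thesis using that V s by blast
qed

text \<open>For each \<open>g\<close> the set where \<open>l' = g \<cdot> l\<close> is open, as a small neighbourhood contains at most one point of
  each orbit. These sets partition the connected space \<open>D\<close>, so one of them is everything.\<close>

lemma lifts_differ_by_translation:
  assumes D: "connected_space D"
    and l: "continuous_map D Y l" "continuous_map D Y l'"
    and eq: "\<And>d. d \<in> topspace D \<Longrightarrow> q (l d) = q (l' d)"
  shows "\<exists>g\<in>carrier G. \<forall>d\<in>topspace D. l' d = \<alpha> g (l d)"
proof (cases "topspace D = {}")
  case False
  have lY: "l d \<in> topspace Y" "l' d \<in> topspace Y" if "d \<in> topspace D" for d
    using l that continuous_map_image_subset_topspace by blast+
  define A where "A g = {d \<in> topspace D. l' d = \<alpha> g (l d)}" for g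
  have op: "openin D (A g)" if g: "g \<in> carrier G" for g
  proof (subst openin_subopen, intro ballI)
    fix d assume d: "d \<in> A g"
    then have dD: "d \<in> topspace D" and eqd: "l' d = \<alpha> g (l d)" by (auto simp: A_def)
    obtain V where V: "openin Y V" "l' d \<in> V" "\<forall>g\<in>carrier G. g \<noteq> \<one> \<longrightarrow> \<alpha> g ` V \<inter> V = {}"
      using evenly_displaced[OF lY(2)[OF dD]] by blast
    let ?N = "{x \<in> topspace D. l' x \<in> V} \<inter> {x \<in> topspace D. (\<alpha> g \<circ> l) x \<in> V}"
    have "openin D ?N"
      using l V(1) continuous_action_map[OF g]
      by (intro openin_Int openin_continuous_map_preimage[where Y=Y] continuous_map_compose)
    moreover have "d \<in> ?N" using dD eqd V(2) by simp
    moreover have "?N \<subseteq> A g"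
    proof
      fix x assume x: "x \<in> ?N"
      then have "q (l' x) = q (\<alpha> g (l x))"
        using eq lY orbit_action[OF g] by simp
      then show "x \<in> A g"
        using x orbit_map_local_inj[OF V(1,3), of "l' x" "\<alpha> g (l x)"] by (simp add: A_def)
    qed
    ultimately show "\<exists>T. openin D T \<and> d \<in> T \<and> T \<subseteq> A g" by blast
  qed
  have cover: "\<exists>g\<in>carrier G. d \<in> A g" if d: "d \<in> topspace D" for d
    using orbit_eqD[OF lY[OF d] eq[OF d]] d by (auto simp: A_def)
  have disj: "g = h" if "g \<in> carrier G" "h \<in> carrier G" "d \<in> A g" "d \<in> A h" for g h d
  proof -
    have d: "d \<in> topspace D" "\<alpha> g (l d) = \<alpha> h (l d)" using that by (auto simp: A_def)
    then have "\<alpha> (inv h \<otimes> g) (l d) = l d"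
      using that lY by (simp add: action_mult action_inv)
    then have "inv h \<otimes> g = \<one>"
      using that lY d by (intro action_free[of _ "l d"]) auto
    then show ?thesis
      using that by (metis inv_equality inv_inv inv_closed)
  qed
  obtain d g where g: "d \<in> topspace D" "g \<in> carrier G" "d \<in> A g"
    using False cover by blast
  have "topspace D - A g = (\<Union>h\<in>carrier G - {g}. A h)"
  proof (intro equalityI subsetI)
    fix x assume "x \<in> topspace D - A g"
    then show "x \<in> (\<Union>h\<in>carrier G - {g}. A h)" using cover[of x] by blast
  next
    fix x assume "x \<in> (\<Union>h\<in>carrier G - {g}. A h)"
    then obtain h where "h \<in> carrier G" "h \<noteq> g" "x \<in> A h" by blast
    then show "x \<in> topspace D - A g" using disj[OF g(2), of h x] by (auto simp: A_def)
  qed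
  then have "openin D (topspace D - A g)"
    using op by auto
  then have "closedin D (A g)"
    by (auto simp: closedin_def A_def)
  then have "A g = topspace D"
    using D op[OF g(2)] g(3) unfolding connected_space_clopen_in by blast
  then show ?thesis using g(2) by (auto simp: A_def)
qed (use one_closed in auto)

lemma lifts_agreeing_at_point:
  assumes D: "connected_space D"
    and l: "continuous_map D Y l" "continuous_map D Y l'"
    and eq: "\<And>d. d \<in> topspace D \<Longrightarrow> q (l d) = q (l' d)"
    and d0: "d0 \<in> topspace D" "l d0 = l' d0" and d: "d \<in> topspace D"
  shows "l d = l' d"
proof -
  obtain g where g: "g \<in> carrier G" "\<forall>d\<in>topspace D. l' d = \<alpha> g (l d)"
    using lifts_differ_by_translation[OF D l eq] by blast
  have lY: "l x \<in> topspace Y" if "x \<in> topspace D" for x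
    using l that continuous_map_image_subset_topspace by blast
  have "g = \<one>"
    using g d0 lY by (intro action_free[of _ "l d0"]) auto
  then show ?thesis
    using g d lY action_one by simp
qed

text \<open>Lifts of a homotopy are built along the interval, over a neighbourhood of a parameter \<open>t\<^sub>0\<close> that shrinks
  at each of finitely many steps. The predicate \<open>liftable_near\<close> quantifies over all initial lifts at
  \<open>a\<close>, so that steps over adjacent intervals can be composed.\<close>

definition lift_on ::
    "'t topology \<Rightarrow> ('t \<times> real \<Rightarrow> 'a set) \<Rightarrow> 't set \<Rightarrow> real \<Rightarrow> real \<Rightarrow> ('t \<Rightarrow> 'a) \<Rightarrow> ('t \<times> real \<Rightarrow> 'a) \<Rightarrow> bool"
  where "lift_on T F N a b f L \<longleftrightarrow>
    continuous_map (subtopology (prod_topology T euclideanreal) (N \<times> {a..b})) Y L \<and>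
    (\<forall>t\<in>N. L (t, a) = f t \<and> (\<forall>s\<in>{a..b}. q (L (t, s)) = F (t, s)))"

definition liftable_near :: "'t topology \<Rightarrow> ('t \<times> real \<Rightarrow> 'a set) \<Rightarrow> 't \<Rightarrow> real \<Rightarrow> real \<Rightarrow> bool" where
  "liftable_near T F t0 a b \<longleftrightarrow> (\<forall>N f. openin T N \<longrightarrow> t0 \<in> N \<longrightarrow>
    continuous_map (subtopology T N) Y f \<longrightarrow> (\<forall>t\<in>N. q (f t) = F (t, a)) \<longrightarrow>
    (\<exists>N' L. openin T N' \<and> t0 \<in> N' \<and> N' \<subseteq> N \<and> lift_on T F N' a b f L))"

lemma liftable_nearE:
  assumes "liftable_near T F t0 a b" "openin T N" "t0 \<in> N"
    "continuous_map (subtopology T N) Y f" "\<forall>t\<in>N. q (f t) = F (t, a)"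
  obtains N' L where "openin T N'" "t0 \<in> N'" "N' \<subseteq> N" "lift_on T F N' a b f L"
proof -
  have "\<exists>N' L. openin T N' \<and> t0 \<in> N' \<and> N' \<subseteq> N \<and> lift_on T F N' a b f L"
    using assms(1)[unfolded liftable_near_def, THEN spec, THEN spec, THEN mp, OF assms(2), THEN mp,
        OF assms(3), THEN mp, OF assms(4), THEN mp, OF assms(5)] .
  then show ?thesis by (elim exE conjE) (rule that)
qed

lemma liftable_near_trans:
  assumes ab: "liftable_near T F t0 a b" and bc: "liftable_near T F t0 b c" and le: "a \<le> b" "b \<le> c"
  shows "liftable_near T F t0 a c"
  unfolding liftable_near_def
proof (intro allI impI)
  let ?TR = "prod_topology T euclideanreal"
  fix N f
  assume "openin T N" "t0 \<in> N" "continuous_map (subtopology T N) Y f" "\<forall>t\<in>N. q (f t) = F (t, a)"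
  then obtain N1 L1 where N1: "openin T N1" "t0 \<in> N1" "N1 \<subseteq> N" and L1: "lift_on T F N1 a b f L1"
    by (rule liftable_nearE[OF ab])
  note 1 = L1[unfolded lift_on_def]
  have "continuous_map (subtopology T N1) (subtopology ?TR (N1 \<times> {a..b})) (\<lambda>t. (t, b))"
    using le by (auto simp: continuous_map_in_subtopology continuous_map_pairwise comp_def
        continuous_map_from_subtopology)
  from continuous_map_compose[OF this conjunct1[OF 1]]
  have "continuous_map (subtopology T N1) Y (\<lambda>t. L1 (t, b))"
    by (simp add: comp_def)
  moreover have "\<forall>t\<in>N1. q (L1 (t, b)) = F (t, b)"
    using 1 le by simp
  ultimately obtain N2 L2 where N2: "openin T N2" "t0 \<in> N2" "N2 \<subseteq> N1"
    and L2: "lift_on T F N2 b c (\<lambda>t. L1 (t, b)) L2"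
    by (rule liftable_nearE[OF bc N1(1,2)])
  note 2 = L2[unfolded lift_on_def]
  let ?D = "subtopology ?TR (N2 \<times> {a..c})" and ?L = "\<lambda>p. if snd p \<le> b then L1 p else L2 p"
  have "continuous_map ?D Y ?L"
  proof (rule continuous_map_cases_le)
    show "continuous_map ?D euclideanreal snd"
      by (simp add: continuous_map_from_subtopology continuous_map_snd)
    show "continuous_map (subtopology ?D {x \<in> topspace ?D. snd x \<le> b}) Y L1"
      unfolding subtopology_subtopology
      by (rule continuous_map_from_subtopology_mono[OF conjunct1[OF 1]]) (use N2(3) in auto)
    show "continuous_map (subtopology ?D {x \<in> topspace ?D. b \<le> snd x}) Y L2"
      unfolding subtopology_subtopology
      by (rule continuous_map_from_subtopology_mono[OF conjunct1[OF 2]]) auto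
  qed (use 2 in auto)
  then have "lift_on T F N2 a c f ?L"
    using 1 2 N2(3) le unfolding lift_on_def by auto
  then show "\<exists>N' L. openin T N' \<and> t0 \<in> N' \<and> N' \<subseteq> N \<and> lift_on T F N' a c f L"
    using N1(3) N2 by blast
qed

text \<open>On a short piece of the interval, and near \<open>t\<^sub>0\<close>, the homotopy stays in the image of an evenly covered
  neighbourhood, where a translate of the local section lifts it.\<close>

lemma liftable_near_local:
  assumes F: "continuous_map (prod_topology T euclideanreal) B F" and t0: "t0 \<in> topspace T"
  shows "\<exists>d>0. \<forall>a b. a \<le> x \<and> x \<le> b \<and> b - a < d \<longrightarrow> liftable_near T F t0 a b"
proof -
  let ?TR = "prod_topology T euclideanreal"
  have "F (t0, x) \<in> topspace B"
    using continuous_map_image_subset_topspace[OF F] t0 by auto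
  then obtain y where y: "y \<in> topspace Y" "F (t0, x) = q y"
    by (auto simp: topspace_orbit_space)
  obtain V s where V: "openin Y V" "y \<in> V" "\<forall>g\<in>carrier G. g \<noteq> \<one> \<longrightarrow> \<alpha> g ` V \<inter> V = {}"
    and s: "continuous_map (subtopology B (q ` V)) Y s" "\<And>w. w \<in> q ` V \<Longrightarrow> s w \<in> V \<and> q (s w) = w"
    by (rule local_section[OF y(1)]) blast
  have VY: "V \<subseteq> topspace Y" using V(1) openin_subset by blast
  have W: "openin ?TR {p \<in> topspace ?TR. F p \<in> q ` V}"
    using openin_continuous_map_preimage[OF F openin_orbit_image[OF V(1)]] .
  have mem: "(t0, x) \<in> {p \<in> topspace ?TR. F p \<in> q ` V}"
    using t0 y V(2) by simp
  obtain A C where AC: "openin T A" "openin euclideanreal C" "t0 \<in> A" "x \<in> C"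
      "A \<times> C \<subseteq> {p \<in> topspace ?TR. F p \<in> q ` V}"
    by (rule openin_prod_topologyE[OF W mem])
  have "open C" using AC(2) by simp
  obtain d where d: "d > 0" "ball x d \<subseteq> C"
    by (rule openE[OF \<open>open C\<close> AC(4)])
  have "liftable_near T F t0 a b" if ab: "a \<le> x" "x \<le> b" "b - a < d" for a b
    unfolding liftable_near_def
  proof (intro impI allI)
    fix N f
    assume N: "openin T N" "t0 \<in> N" and f: "continuous_map (subtopology T N) Y f"
      and qf: "\<forall>t\<in>N. q (f t) = F (t, a)"
    have "{a..b} \<subseteq> ball x d"
      using ab by (auto simp: dist_real_def)
    then have FV: "F (t, u) \<in> q ` V" if "t \<in> A" "u \<in> {a..b}" for t u
      using that AC(5) d(2) by blast
    have a: "a \<in> {a..b}" using ab by simp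
    have f_top: "f t0 \<in> topspace Y"
      using f N openin_subset[OF N(1)] by (auto simp: continuous_map_def Pi_iff)
    have "q (s (F (t0, a))) = q (f t0)" "s (F (t0, a)) \<in> topspace Y"
      using s(2)[OF FV[OF AC(3) a]] N qf VY by auto
    \<comment> \<open>The given initial lift may start in another sheet than the local section.\<close>
    then obtain g where g: "g \<in> carrier G" "f t0 = \<alpha> g (s (F (t0, a)))"
      using orbit_eqD[of "s (F (t0, a))" "f t0"] f_top by blast
    let ?N = "{t \<in> topspace (subtopology T N). f t \<in> \<alpha> g ` V} \<inter> A"
    let ?L = "\<lambda>p. \<alpha> g (s (F p))"
    have "openin (subtopology T N) {t \<in> topspace (subtopology T N). f t \<in> \<alpha> g ` V}"
      using f openin_translate[OF g(1) V(1)] openin_continuous_map_preimage by blast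
    then have openN: "openin T ?N"
      using N(1) AC(1) openin_open_subtopology by blast
    have t0N: "t0 \<in> ?N"
      using N t0 AC(3) g(2) s(2)[OF FV[OF AC(3) a]] by auto
    have "continuous_map (subtopology ?TR (?N \<times> {a..b})) (subtopology B (q ` V)) F"
      using FV by (auto simp: continuous_map_in_subtopology continuous_map_from_subtopology F)
    from continuous_map_compose[OF continuous_map_compose[OF this s(1)] continuous_action_map[OF g(1)]]
    have contL: "continuous_map (subtopology ?TR (?N \<times> {a..b})) Y ?L"
      by (simp add: comp_def)
    have qL: "q (?L (t, u)) = F (t, u)" if "t \<in> A" "u \<in> {a..b}" for t u
      using s(2)[OF FV[OF that]] VY orbit_action[OF g(1)] by auto
    have La: "?L (t, a) = f t" if t: "t \<in> ?N" for t
    proof -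
      obtain v where v: "v \<in> V" "f t = \<alpha> g v" using t by auto
      have sV: "s (F (t, a)) \<in> V" "q (s (F (t, a))) = F (t, a)"
        using s(2)[OF FV[OF _ a, of t]] t by auto
      have "q v = q (f t)"
        using v VY orbit_action[OF g(1)] by auto
      also have "\<dots> = q (s (F (t, a)))"
        using qf t sV by auto
      finally have "q v = q (s (F (t, a)))" .
      then show ?thesis
        using orbit_map_local_inj[OF V(1,3) v(1) sV(1)] v(2) by simp
    qed
    have "lift_on T F ?N a b f ?L"
      unfolding lift_on_def using contL qL La by blast
    then show "\<exists>N' L. openin T N' \<and> t0 \<in> N' \<and> N' \<subseteq> N \<and> lift_on T F N' a b f L"
      using openN t0N by (intro exI[of _ ?N] exI[of _ ?L]) auto
  qed
  then show ?thesis using d(1) by blast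
qed

lemma liftable_near_interval:
  assumes F: "continuous_map (prod_topology T euclideanreal) B F" and t0: "t0 \<in> topspace T"
    and "a \<le> b"
  shows "liftable_near T F t0 a b"
  using \<open>a \<le> b\<close>
proof (induction rule: Bolzano)
  case (trans a b c)
  then show ?case by (rule liftable_near_trans)
next
  case (local x)
  show ?case by (rule liftable_near_local[OF F t0])
qed

text \<open>The local lifts agree where two of them are defined, since over a single parameter they are lifts of
  one path with the same start. The homotopy is given on the whole real line, so that the
  pieces of the interval need not be cut off at its ends.\<close>

lemma homotopy_lifting:
  fixes T :: "'t topology"
  assumes F: "continuous_map (prod_topology T euclideanreal) B F"
    and f: "continuous_map T Y f" and qf: "\<And>t. t \<in> topspace T \<Longrightarrow> q (f t) = F (t, 0)"
  obtains L where "continuous_map (prod_topology T unit_interval) Y L"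
    "\<And>t s. t \<in> topspace T \<Longrightarrow> s \<in> {0..1} \<Longrightarrow> q (L (t, s)) = F (t, s)"
proof -
  let ?TR = "prod_topology T euclideanreal" and ?TI = "prod_topology T unit_interval"
  have "\<exists>N L. openin T N \<and> t0 \<in> N \<and> lift_on T F N 0 1 f L" if t0: "t0 \<in> topspace T" for t0
    by (rule liftable_nearE[OF liftable_near_interval[OF F t0, of 0 1] openin_topspace t0, of f])
       (use f qf in auto)
  then have "\<forall>t\<in>topspace T. \<exists>N L. openin T N \<and> t \<in> N \<and> lift_on T F N 0 1 f L" by blast
  from bchoice[OF this] obtain N where
    "\<forall>t\<in>topspace T. \<exists>L. openin T (N t) \<and> t \<in> N t \<and> lift_on T F (N t) 0 1 f L" by blast
  from bchoice[OF this] obtain L where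
    NL: "\<forall>t\<in>topspace T. openin T (N t) \<and> t \<in> N t \<and> lift_on T F (N t) 0 1 f (L t)" by blast
  have N: "openin T (N t)" "t \<in> N t"
    and L: "continuous_map (subtopology ?TR (N t \<times> {0..1})) Y (L t)"
    and L0: "t' \<in> N t \<Longrightarrow> L t (t', 0) = f t'"
    and qL: "t' \<in> N t \<Longrightarrow> s \<in> {0..1} \<Longrightarrow> q (L t (t', s)) = F (t', s)"
    if "t \<in> topspace T" for t t' s
    using bspec[OF NL that] unfolding lift_on_def by blast+
  have NT: "N t \<subseteq> topspace T" if "t \<in> topspace T" for t
    using N(1)[OF that] openin_subset by blast
  have agree: "L t (u, s) = L t' (u, s)"
    if t: "t \<in> topspace T" "t' \<in> topspace T" and u: "u \<in> N t" "u \<in> N t'" and s: "s \<in> {0..1}" for t t' u s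
  proof -
    have cont: "continuous_map unit_interval Y (\<lambda>s. L r (u, s))" if r: "r \<in> topspace T" "u \<in> N r" for r
    proof -
      have "continuous_map unit_interval (subtopology ?TR (N r \<times> {0..1})) (\<lambda>s. (u, s))"
        using r NT by (auto simp: continuous_map_in_subtopology continuous_map_pairwise comp_def
            continuous_map_from_subtopology)
      from continuous_map_compose[OF this L[OF r(1)]] show ?thesis by (simp add: comp_def)
    qed
    show ?thesis
    proof (rule lifts_agreeing_at_point[of unit_interval "\<lambda>s. L t (u, s)" "\<lambda>s. L t' (u, s)" 0 s])
      show "connected_space unit_interval"
        by (simp add: connected_space_subtopology)
    qed (use t u s cont L0 qL in auto)
  qed
  obtain K where K: "continuous_map ?TI Y K"
    "\<And>x i. i \<in> topspace T \<Longrightarrow> x \<in> topspace ?TI \<inter> (N i \<times> {0..1}) \<Longrightarrow> K x = L i x"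
  proof (rule pasting_lemma_exists[where X = ?TI and I = "topspace T" and T = "\<lambda>t. N t \<times> {0..1}" and Y = Y and f = L])
    show "topspace ?TI \<subseteq> (\<Union>t\<in>topspace T. N t \<times> {0..1})"
      using N(2) by auto
    show "openin ?TI (N t \<times> {0..1})" if "t \<in> topspace T" for t
      using N(1)[OF that] openin_topspace[of unit_interval] by (simp add: openin_prod_Times_iff)
    show "continuous_map (subtopology ?TI (N t \<times> {0..1})) Y (L t)" if "t \<in> topspace T" for t
      unfolding prod_topology_subtopology(2) subtopology_subtopology
      by (rule continuous_map_from_subtopology_mono[OF L[OF that]]) blast
    show "L i x = L j x" if ij: "i \<in> topspace T" "j \<in> topspace T"
      and x: "x \<in> topspace ?TI \<inter> (N i \<times> {0..1}) \<inter> (N j \<times> {0..1})" for i j x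
    proof -
      obtain u s where us: "x = (u, s)" by (cases x)
      then have "u \<in> N i" "u \<in> N j" "s \<in> {0..1}" using x by simp_all
      then show ?thesis unfolding us by (rule agree[OF ij])
    qed
  qed blast
  have "q (K (t, s)) = F (t, s)" if "t \<in> topspace T" "s \<in> {0..1}" for t s
    using K(2)[of t "(t, s)"] qL[of t t s] N(2)[of t] that by simp
  then show ?thesis using that K(1) by blast
qed

text \<open>A contraction of \<open>D\<close>, run backwards, is a homotopy from a constant map to the identity. Composed with
  \<open>F\<close> it starts at a constant map, which lifts, so it lifts as a whole, and the end of the lift is a
  lift of \<open>F\<close>.\<close>

lemma contractible_space_lift:
  assumes D: "contractible_space D" and F: "continuous_map D B F"
  obtains l where "continuous_map D Y l" "\<And>d. d \<in> topspace D \<Longrightarrow> q (l d) = F d"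
proof (cases "topspace D = {}")
  case True
  then show ?thesis
    using that[of undefined] by (simp add: continuous_map_def openin_subset)
next
  case False
  obtain a where "homotopic_with (\<lambda>x. True) D D id (\<lambda>x. a)"
    using D unfolding contractible_space_def by blast
  then obtain h where h: "continuous_map (prod_topology unit_interval D) D h"
    "\<And>x. h (0, x) = x" "\<And>x. h (1, x) = a"
    unfolding homotopic_with_def by auto
  have a: "a \<in> topspace D"
    using False h(3) continuous_map_image_subset_topspace[OF h(1)] by fastforce
  then have "F a \<in> q ` topspace Y"
    using F continuous_map_image_subset_topspace topspace_orbit_space by blast
  then obtain y where y: "y \<in> topspace Y" "F a = q y" by blast
  \<comment> \<open>The contraction run backwards, extended to the real line by constants.\<close>
  let ?c = "\<lambda>s. max 0 (min 1 (1 - s)) :: real"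
  have "continuous_map (prod_topology D euclideanreal) unit_interval (?c \<circ> snd)"
    by (intro continuous_map_compose[OF continuous_map_snd])
       (auto simp: continuous_map_in_subtopology intro!: continuous_intros)
  then have "continuous_map (prod_topology D euclideanreal) (prod_topology unit_interval D)
      (\<lambda>p. ((?c \<circ> snd) p, fst p))"
    by (intro continuous_map_pairedI continuous_map_fst)
  from continuous_map_compose[OF continuous_map_compose[OF this h(1)] F]
  have "continuous_map (prod_topology D euclideanreal) B (\<lambda>(d, s). F (h (?c s, d)))"
    by (simp add: comp_def split_def)
  then obtain L where L: "continuous_map (prod_topology D unit_interval) Y L"
    "\<And>t s. t \<in> topspace D \<Longrightarrow> s \<in> {0..1} \<Longrightarrow> q (L (t, s)) = (\<lambda>(d, s). F (h (?c s, d))) (t, s)"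
    by (rule homotopy_lifting[of D _ "\<lambda>_. y"]) (use y h(3) in auto)
  have "continuous_map D (prod_topology D unit_interval) (\<lambda>d. (d, 1))"
    by (simp add: continuous_map_pairwise comp_def)
  from continuous_map_compose[OF this L(1)] have "continuous_map D Y (\<lambda>d. L (d, 1))"
    by (simp add: comp_def)
  then show ?thesis
    using that[of "\<lambda>d. L (d, 1)"] L(2)[of _ 1] h(2) by simp
qed

end


section \<open>Loops in an orbit space as twisted paths\<close>

lemma twisted_paths_closed:
  "\<gamma> \<in> topspace (twisted_paths Y \<alpha> g) \<Longrightarrow> t \<in> {0..1} \<Longrightarrow> \<gamma> t \<in> topspace Y"
  unfolding topspace_twisted_paths by (auto simp: continuous_map_def Pi_iff)

lemma topspace_path_space:
  "topspace (path_space G Y \<alpha>) = (SIGMA g:carrier G. topspace (twisted_paths Y \<alpha> g))"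
  by (auto simp: path_space_def)

text \<open>If \<open>\<gamma>(1) = g \<gamma>(0)\<close> then \<open>h \<gamma>(1) = (h g h\<^sup>-\<^sup>1) (h \<gamma>(0))\<close>, which explains the conjugation.\<close>

lemma (in topological_action) path_space_topological_action:
  "topological_action G (path_space G X \<phi>) (path_space_action G \<phi>)"
proof unfold_locales
  fix h assume h: "h \<in> carrier G"
  show "continuous_map (path_space G X \<phi>) (path_space G X \<phi>) (path_space_action G \<phi> h)"
    unfolding path_space_def
  proof (rule continuous_map_from_sum_topology)
    fix g assume g: "g \<in> carrier G"
    let ?g = "h \<otimes> g \<otimes> inv h"
    have "continuous_map (prod_topology (twisted_paths X \<phi> g) unit_interval) X (\<phi> h \<circ> (\<lambda>(\<gamma>, t). \<gamma> t))"
      using twisted_paths_evaluation continuous_action_map[OF h] by (rule continuous_map_compose)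
    then have "continuous_map (twisted_paths X \<phi> g) (twisted_paths X \<phi> ?g)
        (\<lambda>\<gamma>. \<lambda>t\<in>{0..1}. (\<phi> h \<circ> (\<lambda>(\<gamma>, t). \<gamma> t)) (\<gamma>, t))"
    proof (rule twisted_paths_curry)
      fix \<gamma> assume "\<gamma> \<in> topspace (twisted_paths X \<phi> g)"
      then have "\<gamma> 0 \<in> topspace X" "\<gamma> 1 = \<phi> g (\<gamma> 0)"
        by (auto simp: topspace_twisted_paths continuous_map_def)
      then show "(\<phi> h \<circ> (\<lambda>(\<gamma>, t). \<gamma> t)) (\<gamma>, 1) = \<phi> ?g ((\<phi> h \<circ> (\<lambda>(\<gamma>, t). \<gamma> t)) (\<gamma>, 0))"
        using g h by (simp add: action_mult action_inv action_closed)
    qed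
    from continuous_map_compose[OF this continuous_map_component_injection[of ?g "carrier G" "twisted_paths X \<phi>"]]
    show "continuous_map (twisted_paths X \<phi> g) (sum_topology (twisted_paths X \<phi>) (carrier G))
        (\<lambda>\<gamma>. path_space_action G \<phi> h (g, \<gamma>))"
      using g h by (simp add: comp_def path_space_action_def)
  qed
next
  fix p assume "p \<in> topspace (path_space G X \<phi>)"
  then obtain g \<gamma> where p: "p = (g, \<gamma>)" "g \<in> carrier G" "\<gamma> \<in> topspace (twisted_paths X \<phi> g)"
    by (auto simp: topspace_path_space)
  have \<gamma>: "\<gamma> t \<in> topspace X" if "t \<in> {0..1}" for t
    using p(3) that by (auto simp: topspace_twisted_paths continuous_map_def)
  have "(\<lambda>t\<in>{0..1}. \<phi> \<one> (\<gamma> t)) = \<gamma>"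
    using p(3) \<gamma> by (intro restrict_eq_extensional action_one) (auto simp: topspace_twisted_paths)
  then show "path_space_action G \<phi> \<one> p = p"
    using p by (simp add: path_space_action_def)
  fix h k assume "h \<in> carrier G" "k \<in> carrier G"
  then show "path_space_action G \<phi> (h \<otimes> k) p = path_space_action G \<phi> h (path_space_action G \<phi> k p)"
    using p(2) \<gamma> by (auto simp: p(1) path_space_action_def inv_mult_group m_assoc action_mult intro!: restrict_ext)
qed

lemma contractible_space_standard_simplex:
  "contractible_space (subtopology (powertop_real UNIV) (standard_simplex n))"
proof -
  let ?D = "subtopology (powertop_real UNIV) (standard_simplex n)"
  let ?v = "\<lambda>j. if j = 0 then 1 else 0 :: real"
  let ?h = "\<lambda>(s, x) i. (1 - s) * x i + s * ?v i :: real"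
  have v: "?v \<in> standard_simplex n"
    using basis_in_standard_simplex[of 0 n] by simp
  have "continuous_map (prod_topology unit_interval ?D) euclideanreal (\<lambda>p. ?h p i)" for i
  proof -
    have "continuous_map (prod_topology unit_interval ?D) euclideanreal (\<lambda>p. fst p)"
      using continuous_map_fst[of unit_interval ?D] by (simp add: continuous_map_in_subtopology)
    moreover have "continuous_map (prod_topology unit_interval ?D) euclideanreal ((\<lambda>x. x i) \<circ> snd)"
      by (intro continuous_map_compose[OF continuous_map_snd] continuous_map_from_subtopology
            continuous_map_product_projection) simp
    ultimately show ?thesis
      by (auto simp: split_def comp_def intro!: continuous_map_add continuous_map_real_mult continuous_map_diff)
  qed
  then have "continuous_map (prod_topology unit_interval ?D) ?D ?h"
    using convex_standard_simplex[OF _ v]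
    by (auto simp: continuous_map_in_subtopology continuous_map_componentwise)
  then have "homotopic_with (\<lambda>_. True) ?D ?D id (\<lambda>_. ?v)"
    unfolding homotopic_with_def by (intro exI[of _ ?h]) (auto simp: fun_eq_iff)
  then show ?thesis
    unfolding contractible_space_def by blast
qed

lemma connected_space_standard_simplex:
  "connected_space (subtopology (powertop_real UNIV) (standard_simplex n))"
  using connectedin_standard_simplex by (simp add: connectedin_def)

lemma connectedin_sum_topology_component:
  assumes "connectedin (sum_topology X I) C" "C \<noteq> {}"
  obtains i where "i \<in> I" "C \<subseteq> {i} \<times> topspace (X i)"
proof -
  have "continuous_map (sum_topology X I) (discrete_topology I) fst"
    by (intro continuous_map_from_sum_topology) simp
  then have "connectedin (discrete_topology I) (fst ` C)"
    using assms(1) connectedin_continuous_map_image by blast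
  then obtain i where "fst ` C \<subseteq> I" "fst ` C \<subseteq> {i}"
    unfolding connectedin_discrete_topology by blast
  moreover have "C \<subseteq> topspace (sum_topology X I)"
    using assms(1) by (rule connectedin_subset_topspace)
  ultimately show ?thesis
    using assms(2) that[of i] by fastforce
qed

text \<open>A simplex is connected, so it stays in one component of the path space.\<close>

lemma singular_simplex_path_spaceE:
  assumes "singular_simplex n (path_space G Y \<alpha>) \<sigma>"
  obtains g where "g \<in> carrier G"
    "\<And>x. x \<in> standard_simplex n \<Longrightarrow> \<sigma> x = (g, snd (\<sigma> x)) \<and> snd (\<sigma> x) \<in> topspace (twisted_paths Y \<alpha> g)"
    "continuous_map (subtopology (powertop_real UNIV) (standard_simplex n)) (twisted_paths Y \<alpha> g) (snd \<circ> \<sigma>)"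
proof -
  let ?D = "subtopology (powertop_real UNIV) (standard_simplex n)"
  let ?S = "sum_topology (twisted_paths Y \<alpha>) (carrier G)"
  have \<sigma>: "continuous_map ?D ?S \<sigma>"
    using assms by (simp add: singular_simplex_def path_space_def)
  have "connectedin ?D (standard_simplex n)"
    using connected_space_standard_simplex[of n] by (metis connectedin_topspace topspace_standard_simplex)
  then have "connectedin ?S (\<sigma> ` standard_simplex n)"
    using \<sigma> connectedin_continuous_map_image by blast
  then obtain g where g: "g \<in> carrier G" "\<sigma> ` standard_simplex n \<subseteq> {g} \<times> topspace (twisted_paths Y \<alpha> g)"
    using connectedin_sum_topology_component nonempty_standard_simplex by (metis image_is_empty)
  have "continuous_map ?D (subtopology ?S ({g} \<times> topspace (twisted_paths Y \<alpha> g))) \<sigma>"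
    using \<sigma> g(2) by (auto simp: continuous_map_in_subtopology)
  from continuous_map_compose[OF this continuous_map_sum_component_snd[OF g(1)]]
  have "continuous_map ?D (twisted_paths Y \<alpha> g) (snd \<circ> \<sigma>)" .
  then show ?thesis
    using g by (intro that[of g]) (auto simp: image_subset_iff mem_Times_iff prod_eq_iff)
qed

definition circle_param :: "real \<Rightarrow> complex" where
  "circle_param t = cis (2 * pi * t)"

text \<open>The inverse of \<open>circle_param\<close> on the unit circle, with values in \<open>[0,1)\<close>.\<close>

definition circle_angle :: "complex \<Rightarrow> real" where
  "circle_angle z = Arg2pi z / (2 * pi)"

lemma circle_param_01 [simp]: "circle_param 0 = 1" "circle_param 1 = 1"
  by (simp_all add: circle_param_def)

lemma circle_angle_bounds: "circle_angle z \<in> {0..1}"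
  using Arg2pi_ge_0[of z] Arg2pi_lt_2pi[of z] by (simp add: circle_angle_def field_simps)

lemma circle_param_angle: "z \<in> sphere 0 1 \<Longrightarrow> circle_param (circle_angle z) = z"
  using Arg2pi_eq[of z] by (simp add: circle_angle_def circle_param_def cis_conv_exp)

lemma circle_angle_param:
  assumes "t \<in> {0..<1}" shows "circle_angle (circle_param t) = t"
proof -
  have "Arg2pi (circle_param t) = 2 * pi * t"
    using assms by (intro Arg2pi_unique[of 1]) (auto simp: circle_param_def cis_conv_exp)
  then show ?thesis by (simp add: circle_angle_def)
qed

lemma continuous_map_circle_param: "continuous_map unit_interval unit_circle circle_param"
  by (auto simp: circle_param_def intro!: continuous_intros)

text \<open>A continuous map between compact Hausdorff spaces is proper, and products of proper maps are proper and
  hence closed, whatever \<open>T\<close> is.\<close>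

lemma quotient_map_prod_circle_param:
  "quotient_map (prod_topology T unit_interval) (prod_topology T unit_circle) (\<lambda>(x, t). (x, circle_param t))"
proof (rule continuous_closed_imp_quotient_map)
  show "continuous_map (prod_topology T unit_interval) (prod_topology T unit_circle) (\<lambda>(x, t). (x, circle_param t))"
    using continuous_map_circle_param by (simp add: continuous_map_prod_top)
  have "proper_map unit_interval unit_circle circle_param"
    using compact_Hausdorff_unit_interval compact_Hausdorff_unit_circle
    by (intro continuous_imp_proper_map continuous_map_circle_param) (simp_all add: Hausdorff_imp_kc_space)
  then have "proper_map (prod_topology T unit_interval) (prod_topology T unit_circle) (\<lambda>(x, t). (id x, circle_param t))"
    unfolding proper_map_prod using proper_map_id[of T] by (simp add: id_def)
  then show "closed_map (prod_topology T unit_interval) (prod_topology T unit_circle) (\<lambda>(x, t). (x, circle_param t))"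
    by (simp add: proper_imp_closed_map)
  show "(\<lambda>(x, t). (x, circle_param t)) ` topspace (prod_topology T unit_interval) =
      topspace (prod_topology T unit_circle)"
  proof (intro equalityI subsetI)
    fix p assume "p \<in> topspace (prod_topology T unit_circle)"
    then have "fst p \<in> topspace T" "circle_param (circle_angle (snd p)) = snd p"
      by (auto simp: circle_param_angle)
    then show "p \<in> (\<lambda>(x, t). (x, circle_param t)) ` topspace (prod_topology T unit_interval)"
      using circle_angle_bounds[of "snd p"] by (intro image_eqI[of _ _ "(fst p, circle_angle (snd p))"]) auto
  qed (auto simp: circle_param_def)
qed

context covering_action
begin

definition loop_of_path :: "'g \<times> (real \<Rightarrow> 'a) \<Rightarrow> complex \<Rightarrow> 'a set" where
  "loop_of_path = (\<lambda>(g, \<gamma>). \<lambda>z\<in>sphere 0 1. q (\<gamma> (circle_angle z)))"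

lemma loop_of_path_circle_param:
  assumes g: "g \<in> carrier G" and \<gamma>: "\<gamma> \<in> topspace (twisted_paths Y \<alpha> g)" and t: "t \<in> {0..1}"
  shows "loop_of_path (g, \<gamma>) (circle_param t) = q (\<gamma> t)"
proof -
  have "\<gamma> 0 \<in> topspace Y" "\<gamma> 1 = \<alpha> g (\<gamma> 0)"
    using \<gamma> by (auto simp: topspace_twisted_paths continuous_map_def)
  then have "q (\<gamma> 1) = q (\<gamma> 0)"
    using orbit_action[OF g] by simp
  then have "q (\<gamma> (circle_angle (circle_param t))) = q (\<gamma> t)"
    using t circle_angle_param[of t] circle_angle_param[of 0] by (cases "t = 1") auto
  moreover have "circle_param t \<in> sphere 0 1"
    by (simp add: circle_param_def)
  ultimately show ?thesis
    unfolding loop_of_path_def by simp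
qed

lemma continuous_loop_of_path: "continuous_map (path_space G Y \<alpha>) (free_loop_space B) loop_of_path"
  unfolding path_space_def
proof (rule continuous_map_from_sum_topology)
  fix g assume g: "g \<in> carrier G"
  let ?T = "twisted_paths Y \<alpha> g" and ?l = "\<lambda>(\<gamma>, z). loop_of_path (g, \<gamma>) z"
  have "continuous_map (prod_topology ?T unit_interval) B (q \<circ> (\<lambda>(\<gamma>, t). \<gamma> t))"
    using twisted_paths_evaluation continuous_orbit_map by (rule continuous_map_compose)
  then have "continuous_map (prod_topology ?T unit_interval) B (?l \<circ> (\<lambda>(x, t). (x, circle_param t)))"
    by (rule continuous_map_eq) (auto simp: loop_of_path_circle_param[OF g])
  then have "continuous_map (prod_topology ?T unit_circle) B ?l"
    by (rule continuous_compose_quotient_map[OF quotient_map_prod_circle_param])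
  from compact_open_curry[OF this] show "continuous_map ?T (free_loop_space B) (\<lambda>\<gamma>. loop_of_path (g, \<gamma>))"
    unfolding free_loop_space_def
    by (rule continuous_map_eq) (auto simp: loop_of_path_def intro!: restrict_eq_extensional)
qed

lemma loop_of_path_action:
  assumes h: "h \<in> carrier G" and p: "p \<in> topspace (path_space G Y \<alpha>)"
  shows "loop_of_path (path_space_action G \<alpha> h p) = loop_of_path p"
proof -
  obtain g \<gamma> where p': "p = (g, \<gamma>)" "\<gamma> \<in> topspace (twisted_paths Y \<alpha> g)"
    using p by (auto simp: topspace_path_space)
  have "q (\<alpha> h (\<gamma> t)) = q (\<gamma> t)" if "t \<in> {0..1}" for t
    by (rule orbit_action[OF h twisted_paths_closed[OF p'(2) that]])
  then show ?thesis
    using circle_angle_bounds by (auto simp: p'(1) loop_of_path_def path_space_action_def intro!: restrict_ext)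
qed

text \<open>Unrolling the circle turns a simplex of loops into a map on \<open>\<Delta>\<^sup>n \<times> [0,1]\<close>, which lifts. The two ends
  of the lift are lifts of the same map on \<open>\<Delta>\<^sup>n\<close> and hence differ by one element \<open>g\<close>, the
  component in which the lifted simplex of twisted paths lies.\<close>

lemma loop_simplex_lift:
  assumes \<tau>: "singular_simplex n (free_loop_space B) \<tau>"
  shows "\<exists>\<sigma>. singular_simplex n (path_space G Y \<alpha>) \<sigma> \<and> simplex_map n loop_of_path \<sigma> = \<tau>"
proof -
  let ?D = "subtopology (powertop_real UNIV) (standard_simplex n)"
  have "continuous_map (prod_topology ?D unit_circle) B (\<lambda>(x, z). \<tau> x z)"
    using \<tau> unfolding singular_simplex_def free_loop_space_def
    by (intro compact_open_uncurry compact_Hausdorff_unit_circle) simp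
  then have F: "continuous_map (prod_topology ?D unit_interval) B ((\<lambda>(x, z). \<tau> x z) \<circ> (\<lambda>(x, t). (x, circle_param t)))"
    by (rule continuous_map_compose[OF quotient_imp_continuous_map[OF quotient_map_prod_circle_param]])
  have "contractible {0..1::real}"
    by (intro convex_imp_contractible convex_real_interval)
  then have "contractible_space (prod_topology ?D unit_interval)"
    unfolding contractible_space_prod_topology contractible_space_top_of_set
    using contractible_space_standard_simplex by blast
  then obtain l where l: "continuous_map (prod_topology ?D unit_interval) Y l"
    "\<And>d. d \<in> topspace (prod_topology ?D unit_interval) \<Longrightarrow>
      q (l d) = ((\<lambda>(x, z). \<tau> x z) \<circ> (\<lambda>(x, t). (x, circle_param t))) d"
    using F by (rule contractible_space_lift) blast
  have ql: "q (l (x, t)) = \<tau> x (circle_param t)" if "x \<in> standard_simplex n" "t \<in> {0..1}" for x t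
    using l(2)[of "(x, t)"] that by simp
  have end_cont: "continuous_map ?D Y (\<lambda>x. l (x, t))" if "t \<in> {0..1}" for t
  proof -
    have "continuous_map ?D (prod_topology ?D unit_interval) (\<lambda>x. (x, t))"
      using that by (simp add: continuous_map_pairwise comp_def continuous_map_id[unfolded id_def])
    from continuous_map_compose[OF this l(1)] show ?thesis by (simp add: comp_def)
  qed
  obtain g where g: "g \<in> carrier G" "\<forall>x\<in>topspace ?D. l (x, 1) = \<alpha> g (l (x, 0))"
    using lifts_differ_by_translation[OF connected_space_standard_simplex end_cont end_cont, of 0 1] ql by auto
  define \<sigma> where "\<sigma> = (\<lambda>x\<in>standard_simplex n. (g, \<lambda>t\<in>{0..1}. l (x, t)))"
  have "continuous_map ?D (twisted_paths Y \<alpha> g) (\<lambda>x. \<lambda>t\<in>{0..1}. l (x, t))"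
    using l(1) g(2) by (intro twisted_paths_curry) auto
  from continuous_map_compose[OF this continuous_map_component_injection[OF g(1), of "twisted_paths Y \<alpha>"]]
  have "continuous_map ?D (path_space G Y \<alpha>) \<sigma>"
    unfolding path_space_def by (rule continuous_map_eq) (simp add: \<sigma>_def)
  then have "singular_simplex n (path_space G Y \<alpha>) \<sigma>"
    by (simp add: singular_simplex_def \<sigma>_def)
  moreover have "simplex_map n loop_of_path \<sigma> = \<tau>"
  proof -
    have "loop_of_path (\<sigma> x) = \<tau> x" if x: "x \<in> standard_simplex n" for x
    proof -
      have "\<tau> x \<in> topspace (free_loop_space B)"
        using \<tau> x unfolding singular_simplex_def continuous_map_def by auto
      then have "\<tau> x \<in> extensional (sphere 0 1)"
        by (simp add: free_loop_space_def topspace_compact_open_topology)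
      then have "(\<lambda>z\<in>sphere 0 1. q (l (x, circle_angle z))) = \<tau> x"
        by (rule restrict_eq_extensional) (simp only: ql[OF x circle_angle_bounds] circle_param_angle)
      then show ?thesis
        unfolding \<sigma>_def loop_of_path_def using x circle_angle_bounds by (simp cong: restrict_cong)
    qed
    then show ?thesis
      using \<tau> unfolding simplex_map_def singular_simplex_def
      by (intro restrict_eq_extensional) auto
  qed
  ultimately show ?thesis by blast
qed

lemma loop_simplex_lift_unique:
  assumes \<sigma>: "singular_simplex n (path_space G Y \<alpha>) \<sigma>" and \<sigma>': "singular_simplex n (path_space G Y \<alpha>) \<sigma>'"
    and eq: "simplex_map n loop_of_path \<sigma> = simplex_map n loop_of_path \<sigma>'"
  shows "\<exists>h\<in>carrier G. \<sigma>' = simplex_map n (path_space_action G \<alpha> h) \<sigma>"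
proof -
  let ?D = "subtopology (powertop_real UNIV) (standard_simplex n)"
  let ?DI = "prod_topology ?D unit_interval"
  obtain g where g: "g \<in> carrier G"
    "\<And>x. x \<in> standard_simplex n \<Longrightarrow> \<sigma> x = (g, snd (\<sigma> x)) \<and> snd (\<sigma> x) \<in> topspace (twisted_paths Y \<alpha> g)"
    "continuous_map ?D (twisted_paths Y \<alpha> g) (snd \<circ> \<sigma>)"
    using \<sigma> by (rule singular_simplex_path_spaceE) blast
  obtain g' where g': "g' \<in> carrier G"
    "\<And>x. x \<in> standard_simplex n \<Longrightarrow> \<sigma>' x = (g', snd (\<sigma>' x)) \<and> snd (\<sigma>' x) \<in> topspace (twisted_paths Y \<alpha> g')"
    "continuous_map ?D (twisted_paths Y \<alpha> g') (snd \<circ> \<sigma>')"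
    using \<sigma>' by (rule singular_simplex_path_spaceE) blast
  define l where "l = (\<lambda>(x, t). (snd \<circ> \<sigma>) x t)"
  define l' where "l' = (\<lambda>(x, t). (snd \<circ> \<sigma>') x t)"
  have cont: "continuous_map ?DI Y l" "continuous_map ?DI Y l'"
    unfolding l_def l'_def by (rule twisted_paths_uncurry[OF g(3)], rule twisted_paths_uncurry[OF g'(3)])
  have conn: "connected_space ?DI"
    using connected_space_standard_simplex[of n]
    by (simp add: connected_space_prod_topology connected_space_subtopology)
  have "q (l d) = q (l' d)" if dD: "d \<in> topspace ?DI" for d
  proof -
    obtain x t where d: "d = (x, t)" "x \<in> standard_simplex n" "t \<in> {0..1}" using dD by (cases d) auto
    have "loop_of_path (\<sigma> x) = loop_of_path (\<sigma>' x)"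
      using fun_cong[OF eq, of x] d(2) by (simp add: simplex_map_def)
    then have "loop_of_path (g, snd (\<sigma> x)) (circle_param t) = loop_of_path (g', snd (\<sigma>' x)) (circle_param t)"
      using g(2)[OF d(2)] g'(2)[OF d(2)] by metis
    then show ?thesis
      unfolding loop_of_path_circle_param[OF g(1) conjunct2[OF g(2)[OF d(2)]] d(3)]
        loop_of_path_circle_param[OF g'(1) conjunct2[OF g'(2)[OF d(2)]] d(3)]
      by (simp add: d(1) l_def l'_def)
  qed
  then obtain h where h: "h \<in> carrier G" "\<forall>d\<in>topspace ?DI. l' d = \<alpha> h (l d)"
    using lifts_differ_by_translation[OF conn cont] by blast
  have pts: "snd (\<sigma>' x) t = \<alpha> h (snd (\<sigma> x) t)" if "x \<in> standard_simplex n" "t \<in> {0..1}" for x t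
    using h(2) that by (auto simp: l_def l'_def)
  have inY: "snd (\<sigma> x) t \<in> topspace Y" if "x \<in> standard_simplex n" "t \<in> {0..1}" for x t
    by (rule twisted_paths_closed[OF conjunct2[OF g(2)[OF that(1)]] that(2)])
  \<comment> \<open>Both \<open>h g\<close> and \<open>g' h\<close> map the start of a path of \<open>\<sigma>\<close> to the end of the corresponding path
    of \<open>\<sigma>'\<close>, so they are equal as the action is free.\<close>
  have "g' = h \<otimes> g \<otimes> inv h"
  proof -
    obtain x where x: "x \<in> standard_simplex n" using nonempty_standard_simplex by blast
    let ?y = "snd (\<sigma> x) 0"
    have y: "?y \<in> topspace Y" using inY[OF x] by simp
    have "snd (\<sigma> x) 1 = \<alpha> g ?y" "snd (\<sigma>' x) 1 = \<alpha> g' (snd (\<sigma>' x) 0)"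
      using g(2)[OF x] g'(2)[OF x] by (auto simp: topspace_twisted_paths)
    then have "\<alpha> h (\<alpha> g ?y) = \<alpha> g' (\<alpha> h ?y)"
      using pts[OF x, of 0] pts[OF x, of 1] by simp
    then have e: "\<alpha> (h \<otimes> g) ?y = \<alpha> (g' \<otimes> h) ?y"
      using h(1) g(1) g'(1) y by (simp add: action_mult)
    have "\<alpha> (inv (g' \<otimes> h) \<otimes> (h \<otimes> g)) ?y = \<alpha> (inv (g' \<otimes> h)) (\<alpha> (g' \<otimes> h) ?y)"
      using h(1) g(1) g'(1) y by (simp only: action_mult m_closed inv_closed e)
    also have "\<dots> = ?y"
      using h(1) g'(1) y by (intro action_inv) auto
    finally have "inv (g' \<otimes> h) \<otimes> (h \<otimes> g) = \<one>"
      using h(1) g(1) g'(1) y by (intro action_free[of _ ?y]) auto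
    then have "h \<otimes> g = g' \<otimes> h"
      using h(1) g(1) g'(1) by (metis inv_closed inv_equality inv_inv m_closed)
    then show ?thesis
      using h(1) g(1) g'(1) by (simp add: m_assoc)
  qed
  moreover have "snd (\<sigma>' x) = (\<lambda>t\<in>{0..1}. \<alpha> h (snd (\<sigma> x) t))" if x: "x \<in> standard_simplex n" for x
    using g'(2)[OF x] pts[OF x] by (intro restrict_eq_extensional[symmetric]) (auto simp: topspace_twisted_paths)
  ultimately have "path_space_action G \<alpha> h (\<sigma> x) = \<sigma>' x" if x: "x \<in> standard_simplex n" for x
    by (subst conjunct1[OF g(2)[OF x]], subst conjunct1[OF g'(2)[OF x]])
       (simp add: path_space_action_def x)
  then have "simplex_map n (path_space_action G \<alpha> h) \<sigma> = \<sigma>'"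
    using \<sigma>' unfolding simplex_map_def singular_simplex_def by (intro restrict_eq_extensional) auto
  then show ?thesis using h(1) by blast
qed

lemma loop_orbit_map:
  assumes "finite (carrier G)"
  shows "simplicial_orbit_map G (path_space G Y \<alpha>) (path_space_action G \<alpha>) (free_loop_space B) loop_of_path"
  unfolding simplicial_orbit_map_def simplicial_orbit_map_axioms_def
  using assms path_space_topological_action continuous_loop_of_path loop_of_path_action
    loop_simplex_lift loop_simplex_lift_unique by blast

end


section \<open>Contracting the factor of the universal bundle\<close>

lemma continuous_action_imp_topological_action:
  assumes "group G" "continuous_action G X \<phi>"
  shows "topological_action G X \<phi>"
proof -
  interpret group G by fact
  interpret group_action G "topspace X" \<phi>
    using assms(2) by (simp add: continuous_action_def)
  show ?thesis
  proof unfold_locales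
    show "continuous_map X X (\<phi> g)" if "g \<in> carrier G" for g
      using assms(2) that by (simp add: continuous_action_def)
    show "\<phi> \<one>\<^bsub>G\<^esub> x = x" if "x \<in> topspace X" for x
      using that by (metis id_eq_one restrict_apply')
  qed (rule composition_rule)
qed

definition diagonal_action ::
    "('g \<Rightarrow> 'e \<Rightarrow> 'e) \<Rightarrow> ('g \<Rightarrow> 'm \<Rightarrow> 'm) \<Rightarrow> 'g \<Rightarrow> 'e \<times> 'm \<Rightarrow> 'e \<times> 'm" where
  "diagonal_action \<epsilon> \<phi> = (\<lambda>g (e, x). (\<epsilon> g e, \<phi> g x))"

lemma topological_action_diagonal:
  assumes "topological_action G E \<epsilon>" "topological_action G M \<phi>"
  shows "topological_action G (prod_topology E M) (diagonal_action \<epsilon> \<phi>)"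
proof -
  interpret E: topological_action G E \<epsilon> by fact
  interpret M: topological_action G M \<phi> by fact
  show ?thesis
    by unfold_locales
       (auto simp: diagonal_action_def continuous_map_prod_top E.continuous_action_map
         M.continuous_action_map E.action_one M.action_one E.action_mult M.action_mult)
qed

lemma covering_action_diagonal:
  assumes G: "group G" and E: "universal_bundle G E \<epsilon>" and M: "topological_action G M \<phi>"
  shows "covering_action G (prod_topology E M) (diagonal_action \<epsilon> \<phi>)"
proof -
  have "topological_action G E \<epsilon>"
    using E G by (simp add: universal_bundle_def continuous_action_imp_topological_action)
  then interpret topological_action G "prod_topology E M" "diagonal_action \<epsilon> \<phi>"
    using M by (rule topological_action_diagonal)
  show ?thesis
  proof unfold_locales
    fix y assume "y \<in> topspace (prod_topology E M)"
    then obtain e x where y: "y = (e, x)" "e \<in> topspace E" "x \<in> topspace M" by auto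
    then obtain U where U: "openin E U" "e \<in> U" "\<forall>g\<in>carrier G. g \<noteq> \<one>\<^bsub>G\<^esub> \<longrightarrow> \<epsilon> g ` U \<inter> U = {}"
      using E unfolding universal_bundle_def by blast
    have "openin (prod_topology E M) (U \<times> topspace M)"
      using U(1) by (simp add: openin_prod_Times_iff)
    moreover have "diagonal_action \<epsilon> \<phi> g ` (U \<times> topspace M) \<inter> (U \<times> topspace M) = {}"
      if "g \<in> carrier G" "g \<noteq> \<one>\<^bsub>G\<^esub>" for g
    proof -
      have "\<epsilon> g ` U \<inter> U = {}" using U(3) that by blast
      then show ?thesis unfolding diagonal_action_def by fastforce
    qed
    ultimately show "\<exists>V. openin (prod_topology E M) V \<and> y \<in> V \<and>
        (\<forall>g\<in>carrier G. g \<noteq> \<one>\<^bsub>G\<^esub> \<longrightarrow> diagonal_action \<epsilon> \<phi> g ` V \<inter> V = {})"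
      using U(2) y by (intro exI[of _ "U \<times> topspace M"]) auto
  qed
qed

text \<open>The \<open>E\<close>-component of every twisted path will be deformed to a path that follows the contraction of \<open>E\<close>
  during \<open>[0, 1/3]\<close>, rests at the base point, and follows the contraction backwards during
  \<open>[2/3, 1]\<close>. The time parameter of the contraction along this path is \<open>ramp\<close>. The
  reparametrization \<open>stretch\<close> runs through the original path during the rest.\<close>

definition ramp :: "real \<Rightarrow> real" where
  "ramp t = min 1 (min (3 * t) (3 * (1 - t)))"

definition stretch :: "real \<Rightarrow> real" where
  "stretch t = max 0 (min 1 (3 * t - 1))"

lemma ramp_bounds: "t \<in> {0..1} \<Longrightarrow> ramp t \<in> {0..1}"
  by (auto simp: ramp_def)

lemma ramp_ends [simp]: "ramp 0 = 0" "ramp 1 = 0" "ramp (1/2) = 1"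
  by (simp_all add: ramp_def)

lemma stretch_ends [simp]: "stretch 0 = 0" "stretch 1 = 1"
  by (simp_all add: stretch_def)

lemma continuous_map_ramp: "continuous_map unit_interval unit_interval ramp"
proof -
  have "continuous_on {0..1} ramp"
    unfolding ramp_def by (intro continuous_intros)
  then show ?thesis
    using ramp_bounds by auto
qed

lemma continuous_map_min_ramp:
  "continuous_map (prod_topology unit_interval unit_interval) unit_interval (\<lambda>(s, t). min s (ramp t))"
proof -
  have "continuous_on ({0..1} \<times> {0..1}) (\<lambda>(s, t). min s (ramp t))"
    unfolding ramp_def split_def by (intro continuous_intros)
  then show ?thesis
    using ramp_bounds by (auto simp: min_def)
qed

lemma reparametrization_bounds:
  assumes "s \<in> {0..1}" "t \<in> {0..1}"
  shows "(1 - s) * t + s * stretch t \<in> {0..1}"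
proof -
  have "stretch t \<in> {0..1}" by (auto simp: stretch_def)
  then show ?thesis
    using assms convex_bound_le[of t 1 "stretch t" "1 - s" s] by simp
qed

lemma continuous_map_reparametrization:
  "continuous_map (prod_topology unit_interval unit_interval) unit_interval
     (\<lambda>(s, t). (1 - s) * t + s * stretch t)"
proof -
  have "continuous_on ({0..1} \<times> {0..1}) (\<lambda>(s, t). (1 - s) * t + s * stretch t)"
    unfolding stretch_def split_def by (intro continuous_intros)
  moreover have "(\<lambda>(s, t). (1 - s) * t + s * stretch t) \<in> {0..1} \<times> {0..1} \<rightarrow> {0..1}"
    by (rule funcsetI) (auto simp only: split_def mem_Times_iff intro!: reparametrization_bounds)
  ultimately show ?thesis by (simp only: prod_topology_subtopology_eu continuous_map_subtopology_eu)
qed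

locale contracted_bundle = E: topological_action G E \<epsilon> + M: topological_action G M \<phi>
  for G :: "('g, 'r) monoid_scheme" (structure)
    and E :: "'e topology" and \<epsilon> :: "'g \<Rightarrow> 'e \<Rightarrow> 'e"
    and M :: "'m topology" and \<phi> :: "'g \<Rightarrow> 'm \<Rightarrow> 'm" +
  fixes h :: "real \<times> 'e \<Rightarrow> 'e" and e0 :: 'e
  assumes contraction: "continuous_map (prod_topology unit_interval E) E h"
    and contraction_0 [simp]: "h (0, e) = e" and contraction_1 [simp]: "h (1, e) = e0"
    and e0: "e0 \<in> topspace E"
begin

abbreviation Y :: "('e \<times> 'm) topology" where "Y \<equiv> prod_topology E M"
abbreviation \<alpha> :: "'g \<Rightarrow> 'e \<times> 'm \<Rightarrow> 'e \<times> 'm" where "\<alpha> \<equiv> diagonal_action \<epsilon> \<phi>"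

sublocale Y: topological_action G Y \<alpha>
  by (rule topological_action_diagonal) unfold_locales

lemma contract_continuous:
  assumes "continuous_map S unit_interval r" "continuous_map S E f"
  shows "continuous_map S E (\<lambda>x. h (r x, f x))"
  using continuous_map_compose[OF continuous_map_pairedI[OF assms] contraction] by (simp add: comp_def)

text \<open>A path from \<open>e\<close> to \<open>g e\<close> through \<open>e\<^sub>0\<close> that depends continuously on \<open>e\<close>.\<close>

definition bridge :: "'g \<Rightarrow> 'e \<Rightarrow> real \<Rightarrow> 'e" where
  "bridge g e t = (if t \<le> 1/2 then h (ramp t, e) else h (ramp t, \<epsilon> g e))"

lemma bridge_ends [simp]: "bridge g e 0 = e" "bridge g e 1 = \<epsilon> g e"
  by (simp_all add: bridge_def)

lemma continuous_map_bridge: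
  assumes g: "g \<in> carrier G" and r: "continuous_map S unit_interval r" and f: "continuous_map S E f"
  shows "continuous_map S E (\<lambda>x. bridge g (f x) (r x))"
  unfolding bridge_def
proof (rule continuous_map_cases_le)
  show "continuous_map S euclideanreal r"
    using r by (simp add: continuous_map_in_subtopology)
  have ramp: "continuous_map S unit_interval (\<lambda>x. ramp (r x))"
    using continuous_map_compose[OF r continuous_map_ramp] by (simp add: comp_def)
  show "continuous_map (subtopology S {x \<in> topspace S. r x \<le> 1/2}) E (\<lambda>x. h (ramp (r x), f x))"
    by (intro continuous_map_from_subtopology contract_continuous ramp f)
  have "continuous_map S E (\<lambda>x. \<epsilon> g (f x))"
    using continuous_map_compose[OF f E.continuous_action_map[OF g]] by (simp add: comp_def)
  then show "continuous_map (subtopology S {x \<in> topspace S. 1/2 \<le> r x}) E (\<lambda>x. h (ramp (r x), \<epsilon> g (f x)))"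
    by (intro continuous_map_from_subtopology contract_continuous ramp)
  show "h (ramp (r x), f x) = h (ramp (r x), \<epsilon> g (f x))" if "r x = 1/2" for x
    by (simp only: that ramp_ends contraction_1)
qed simp

definition section_path :: "'g \<times> (real \<Rightarrow> 'm) \<Rightarrow> 'g \<times> (real \<Rightarrow> 'e \<times> 'm)" where
  "section_path = (\<lambda>(g, \<gamma>). (g, \<lambda>t\<in>{0..1}. (bridge g e0 t, \<gamma> t)))"

definition project_path :: "'g \<times> (real \<Rightarrow> 'e \<times> 'm) \<Rightarrow> 'g \<times> (real \<Rightarrow> 'm)" where
  "project_path = (\<lambda>(g, \<gamma>). (g, \<lambda>t\<in>{0..1}. snd (\<gamma> t)))"

lemma continuous_map_section_path: "continuous_map (path_space G M \<phi>) (path_space G Y \<alpha>) section_path"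
  unfolding path_space_def
proof (rule continuous_map_from_sum_topology)
  fix g assume g: "g \<in> carrier G"
  let ?T = "twisted_paths M \<phi> g"
  have "continuous_map (prod_topology ?T unit_interval) E (\<lambda>x. bridge g e0 (snd x))"
    using g e0 by (intro continuous_map_bridge continuous_map_snd) auto
  then have "continuous_map (prod_topology ?T unit_interval) Y (\<lambda>x. (bridge g e0 (snd x), (\<lambda>(\<gamma>, t). \<gamma> t) x))"
    using twisted_paths_evaluation by (rule continuous_map_pairedI)
  then have "continuous_map ?T (twisted_paths Y \<alpha> g)
      (\<lambda>\<gamma>. \<lambda>t\<in>{0..1}. (bridge g e0 (snd (\<gamma>, t)), (\<lambda>(\<gamma>, t). \<gamma> t) (\<gamma>, t)))"
    by (rule twisted_paths_curry) (auto simp: diagonal_action_def topspace_twisted_paths)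
  from continuous_map_compose[OF this continuous_map_component_injection[OF g, of "twisted_paths Y \<alpha>"]]
  show "continuous_map ?T (sum_topology (twisted_paths Y \<alpha>) (carrier G)) (\<lambda>\<gamma>. section_path (g, \<gamma>))"
    by (simp add: comp_def section_path_def)
qed

lemma continuous_map_project_path: "continuous_map (path_space G Y \<alpha>) (path_space G M \<phi>) project_path"
  unfolding path_space_def
proof (rule continuous_map_from_sum_topology)
  fix g assume g: "g \<in> carrier G"
  let ?T = "twisted_paths Y \<alpha> g"
  have "continuous_map (prod_topology ?T unit_interval) M (snd \<circ> (\<lambda>(\<gamma>, t). \<gamma> t))"
    using twisted_paths_evaluation continuous_map_snd by (rule continuous_map_compose)
  then have "continuous_map ?T (twisted_paths M \<phi> g) (\<lambda>\<gamma>. \<lambda>t\<in>{0..1}. (snd \<circ> (\<lambda>(\<gamma>, t). \<gamma> t)) (\<gamma>, t))"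
    by (rule twisted_paths_curry) (auto simp: diagonal_action_def topspace_twisted_paths split_def)
  from continuous_map_compose[OF this continuous_map_component_injection[OF g, of "twisted_paths M \<phi>"]]
  show "continuous_map ?T (sum_topology (twisted_paths M \<phi>) (carrier G)) (\<lambda>\<gamma>. project_path (g, \<gamma>))"
    by (simp add: comp_def project_path_def)
qed

lemma project_section_path:
  assumes "p \<in> topspace (path_space G M \<phi>)"
  shows "project_path (section_path p) = p"
proof -
  obtain g \<gamma> where p: "p = (g, \<gamma>)" "\<gamma> \<in> topspace (twisted_paths M \<phi> g)"
    using assms by (auto simp: topspace_path_space)
  have "(\<lambda>t\<in>{0..1}. snd ((\<lambda>t\<in>{0..1}. (bridge g e0 t, \<gamma> t)) t)) = \<gamma>"
    using p(2) by (intro restrict_eq_extensional) (auto simp: topspace_twisted_paths)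
  then show ?thesis
    by (simp add: p(1) project_path_def section_path_def)
qed

lemma project_path_equivariant:
  assumes k: "k \<in> carrier G" and p: "p \<in> topspace (path_space G Y \<alpha>)"
  shows "project_path (path_space_action G \<alpha> k p) = path_space_action G \<phi> k (project_path p)"
  by (cases p) (auto simp: project_path_def path_space_action_def diagonal_action_def split_def intro!: restrict_ext)

lemma path_space_homotopy:
  assumes "\<And>g. g \<in> carrier G \<Longrightarrow>
      continuous_map (prod_topology (prod_topology unit_interval (twisted_paths Y \<alpha> g)) unit_interval) Y (K g)"
    and "\<And>g s \<gamma>. g \<in> carrier G \<Longrightarrow> s \<in> {0..1} \<Longrightarrow> \<gamma> \<in> topspace (twisted_paths Y \<alpha> g) \<Longrightarrow>
      K g ((s, \<gamma>), 1) = \<alpha> g (K g ((s, \<gamma>), 0))"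
  shows "continuous_map (prod_topology unit_interval (path_space G Y \<alpha>)) (path_space G Y \<alpha>)
    (\<lambda>(s, (g, \<gamma>)). (g, \<lambda>t\<in>{0..1}. K g ((s, \<gamma>), t)))"
  unfolding path_space_def
proof (rule continuous_map_from_prod_sum_topology)
  fix g assume g: "g \<in> carrier G"
  have "continuous_map (prod_topology unit_interval (twisted_paths Y \<alpha> g)) (twisted_paths Y \<alpha> g)
      (\<lambda>x. \<lambda>t\<in>{0..1}. K g (x, t))"
    using assms g by (intro twisted_paths_curry) auto
  from continuous_map_compose[OF this continuous_map_component_injection[OF g, of "twisted_paths Y \<alpha>"]]
  show "continuous_map (prod_topology unit_interval (twisted_paths Y \<alpha> g))
      (sum_topology (twisted_paths Y \<alpha>) (carrier G))
      (\<lambda>(s, \<gamma>). case (s, (g, \<gamma>)) of (s, (g, \<gamma>)) \<Rightarrow> (g, \<lambda>t\<in>{0..1}. K g ((s, \<gamma>), t)))"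
    by (simp add: comp_def split_def)
qed

lemma homotopy_coordinates:
  fixes X :: "'t topology"
  defines "S \<equiv> prod_topology (prod_topology unit_interval X) unit_interval"
  shows "continuous_map S unit_interval (\<lambda>x. fst (fst x))" "continuous_map S X (\<lambda>x. snd (fst x))"
    "continuous_map S unit_interval snd"
  using continuous_map_compose[OF continuous_map_fst continuous_map_fst]
    continuous_map_compose[OF continuous_map_fst continuous_map_snd] continuous_map_snd
  unfolding S_def comp_def by blast+

text \<open>At time \<open>s\<close> the parameter of the contraction is cut off at \<open>s\<close>, and the original path is reparametrized so
  that it gets slower near its ends. At \<open>s = 1\<close> the original path only moves while it is contracted
  to \<open>e\<^sub>0\<close>, so that the \<open>E\<close>-component depends on its starting point only.\<close>

definition straighten :: "real \<times> 'g \<times> (real \<Rightarrow> 'e \<times> 'm) \<Rightarrow> 'g \<times> (real \<Rightarrow> 'e \<times> 'm)" where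
  "straighten = (\<lambda>(s, (g, \<gamma>)). (g, \<lambda>t\<in>{0..1}.
     (h (min s (ramp t), fst (\<gamma> ((1 - s) * t + s * stretch t))), snd (\<gamma> t))))"

text \<open>Here the starting point of the \<open>E\<close>-component is moved to \<open>e\<^sub>0\<close> along the contraction.\<close>

definition rebase :: "real \<times> 'g \<times> (real \<Rightarrow> 'e \<times> 'm) \<Rightarrow> 'g \<times> (real \<Rightarrow> 'e \<times> 'm)" where
  "rebase = (\<lambda>(s, (g, \<gamma>)). (g, \<lambda>t\<in>{0..1}. (bridge g (h (s, fst (\<gamma> 0))) t, snd (\<gamma> t))))"

lemma continuous_map_straighten:
  "continuous_map (prod_topology unit_interval (path_space G Y \<alpha>)) (path_space G Y \<alpha>) straighten"
proof -
  let ?K = "\<lambda>((s, \<gamma>), t). (h (min s (ramp t), fst (\<gamma> ((1 - s) * t + s * stretch t))), snd (\<gamma> t))"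
  have "continuous_map (prod_topology unit_interval (path_space G Y \<alpha>)) (path_space G Y \<alpha>)
      (\<lambda>(s, (g, \<gamma>)). (g, \<lambda>t\<in>{0..1}. ?K ((s, \<gamma>), t)))"
  proof (rule path_space_homotopy)
    fix g assume g: "g \<in> carrier G"
    let ?T = "twisted_paths Y \<alpha> g"
    let ?S = "prod_topology (prod_topology unit_interval ?T) unit_interval"
    note s = homotopy_coordinates(1)[of ?T] and \<gamma> = homotopy_coordinates(2)[of ?T]
      and t = homotopy_coordinates(3)[of ?T]
    note st = continuous_map_pairedI[OF s t]
    have "continuous_map ?S Y (\<lambda>x. snd (fst x) ((1 - fst (fst x)) * snd x + fst (fst x) * stretch (snd x)))"
      using continuous_map_compose[OF st continuous_map_reparametrization]
      by (intro twisted_paths_evaluate[OF \<gamma>]) (simp add: comp_def)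
    from continuous_map_compose[OF this continuous_map_fst]
    have "continuous_map ?S E (\<lambda>x. fst (snd (fst x) ((1 - fst (fst x)) * snd x + fst (fst x) * stretch (snd x))))"
      by (simp add: comp_def)
    moreover have "continuous_map ?S unit_interval (\<lambda>x. min (fst (fst x)) (ramp (snd x)))"
      using continuous_map_compose[OF st continuous_map_min_ramp] by (simp add: comp_def)
    ultimately have 1: "continuous_map ?S E (\<lambda>x. h (min (fst (fst x)) (ramp (snd x)),
        fst (snd (fst x) ((1 - fst (fst x)) * snd x + fst (fst x) * stretch (snd x)))))"
      by (intro contract_continuous)
    have 2: "continuous_map ?S M (\<lambda>x. snd (snd (fst x) (snd x)))"
      using continuous_map_compose[OF twisted_paths_evaluate[OF \<gamma> t] continuous_map_snd] by (simp add: comp_def)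
    show "continuous_map ?S Y ?K"
      using continuous_map_pairedI[OF 1 2] by (simp add: split_def)
    fix s \<gamma> assume "s \<in> {0..1::real}" "\<gamma> \<in> topspace ?T"
    then show "?K ((s, \<gamma>), 1) = \<alpha> g (?K ((s, \<gamma>), 0))"
      by (auto simp: topspace_twisted_paths diagonal_action_def split_def min_def)
  qed
  then show ?thesis by (simp add: straighten_def split_def)
qed

lemma continuous_map_rebase:
  "continuous_map (prod_topology unit_interval (path_space G Y \<alpha>)) (path_space G Y \<alpha>) rebase"
proof -
  let ?K = "\<lambda>g ((s, \<gamma>), t). (bridge g (h (s, fst (\<gamma> 0))) t, snd (\<gamma> t))"
  have "continuous_map (prod_topology unit_interval (path_space G Y \<alpha>)) (path_space G Y \<alpha>)
      (\<lambda>(s, (g, \<gamma>)). (g, \<lambda>t\<in>{0..1}. ?K g ((s, \<gamma>), t)))"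
  proof (rule path_space_homotopy)
    fix g assume g: "g \<in> carrier G"
    let ?T = "twisted_paths Y \<alpha> g"
    let ?S = "prod_topology (prod_topology unit_interval ?T) unit_interval"
    note s = homotopy_coordinates(1)[of ?T] and \<gamma> = homotopy_coordinates(2)[of ?T]
      and t = homotopy_coordinates(3)[of ?T]
    have "continuous_map ?S Y (\<lambda>x. snd (fst x) 0)"
      by (intro twisted_paths_evaluate[OF \<gamma>]) simp
    from continuous_map_compose[OF this continuous_map_fst]
    have "continuous_map ?S E (\<lambda>x. fst (snd (fst x) 0))"
      by (simp add: comp_def)
    then have 1: "continuous_map ?S E (\<lambda>x. bridge g (h (fst (fst x), fst (snd (fst x) 0))) (snd x))"
      by (intro continuous_map_bridge[OF g t] contract_continuous s)
    have 2: "continuous_map ?S M (\<lambda>x. snd (snd (fst x) (snd x)))"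
      using continuous_map_compose[OF twisted_paths_evaluate[OF \<gamma> t] continuous_map_snd] by (simp add: comp_def)
    show "continuous_map ?S Y (?K g)"
      using continuous_map_pairedI[OF 1 2] by (simp add: split_def)
    fix s \<gamma> assume "s \<in> {0..1::real}" "\<gamma> \<in> topspace ?T"
    then show "?K g ((s, \<gamma>), 1) = \<alpha> g (?K g ((s, \<gamma>), 0))"
      by (auto simp: topspace_twisted_paths diagonal_action_def split_def)
  qed
  then show ?thesis by (simp add: rebase_def split_def)
qed

lemma straighten_0:
  assumes "p \<in> topspace (path_space G Y \<alpha>)" shows "straighten (0, p) = p"
proof -
  obtain g \<gamma> where p: "p = (g, \<gamma>)" "\<gamma> \<in> topspace (twisted_paths Y \<alpha> g)"
    using assms by (auto simp: topspace_path_space)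
  have "min 0 (ramp t) = 0" if "t \<in> {0..1}" for t
    using ramp_bounds[OF that] by simp
  then have "(\<lambda>t\<in>{0..1}. (h (min 0 (ramp t), fst (\<gamma> t)), snd (\<gamma> t))) = \<gamma>"
    using p(2) by (intro restrict_eq_extensional) (auto simp: topspace_twisted_paths)
  then show ?thesis by (simp add: p(1) straighten_def)
qed

lemma straighten_1:
  assumes "p \<in> topspace (path_space G Y \<alpha>)" shows "straighten (1, p) = rebase (0, p)"
proof -
  obtain g \<gamma> where p: "p = (g, \<gamma>)" "\<gamma> \<in> topspace (twisted_paths Y \<alpha> g)"
    using assms by (auto simp: topspace_path_space)
  have end1: "fst (\<gamma> 1) = \<epsilon> g (fst (\<gamma> 0))"
    using p(2) by (simp add: topspace_twisted_paths diagonal_action_def split_def)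
  have "h (min 1 (ramp t), fst (\<gamma> (stretch t))) = bridge g (fst (\<gamma> 0)) t" if t: "t \<in> {0..1}" for t
  proof -
    have "min 1 (ramp t) = ramp t" using ramp_bounds[OF t] by simp
    moreover consider "t \<le> 1/3" | "1/3 \<le> t" "t \<le> 2/3" | "2/3 \<le> t" by linarith
    then have "h (ramp t, fst (\<gamma> (stretch t))) = bridge g (fst (\<gamma> 0)) t"
    proof cases
      case 1
      then have "stretch t = 0" by (simp add: stretch_def)
      then show ?thesis using 1 by (simp add: bridge_def)
    next
      case 2
      then have "ramp t = 1" by (simp add: ramp_def)
      then show ?thesis by (simp add: bridge_def)
    next
      case 3
      then have "stretch t = 1" by (simp add: stretch_def)
      then show ?thesis using 3 by (simp add: bridge_def end1)
    qed
    ultimately show ?thesis by simp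
  qed
  then show ?thesis
    by (auto simp: p(1) straighten_def rebase_def intro!: restrict_ext)
qed

lemma rebase_1: "rebase (1, p) = section_path (project_path p)"
  by (cases p) (auto simp: rebase_def section_path_def project_path_def intro!: restrict_ext)

text \<open>The two homotopies, one after the other, lead from the identity to \<open>section_path \<circ> project_path\<close>.\<close>

lemma cohomology_map_section_project:
  assumes y: "y \<in> carrier (cohomology (path_space G Y \<alpha>))"
  shows "cohomology_map (path_space G Y \<alpha>) (path_space G M \<phi>) project_path
    (cohomology_map (path_space G M \<phi>) (path_space G Y \<alpha>) section_path y) = y"
proof -
  let ?P = "path_space G Y \<alpha>"
  have hom: "cohomology_map ?P ?P (\<lambda>p. H (0, p)) y = cohomology_map ?P ?P (\<lambda>p. H (1, p)) y"
    if "continuous_map (prod_topology unit_interval ?P) ?P H" for H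
    using that by (intro cohomology_map_homotopic y) (auto simp: homotopic_with_def)
  have "cohomology_map ?P ?P (section_path \<circ> project_path) y = cohomology_map ?P ?P (\<lambda>p. rebase (1, p)) y"
    by (simp add: rebase_1 comp_def)
  also have "\<dots> = cohomology_map ?P ?P (\<lambda>p. rebase (0, p)) y"
    by (rule hom[OF continuous_map_rebase, symmetric])
  also have "\<dots> = cohomology_map ?P ?P (\<lambda>p. straighten (1, p)) y"
    by (rule fun_cong[OF cohomology_map_cong]) (simp add: straighten_1)
  also have "\<dots> = cohomology_map ?P ?P (\<lambda>p. straighten (0, p)) y"
    by (rule hom[OF continuous_map_straighten, symmetric])
  also have "\<dots> = y"
    by (rule cohomology_map_id[OF straighten_0 y])
  finally show ?thesis
    by (simp add: cohomology_map_compose[OF continuous_map_project_path continuous_map_section_path y])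
qed

lemma cohomology_map_project_section:
  assumes x: "x \<in> carrier (cohomology (path_space G M \<phi>))"
  shows "cohomology_map (path_space G M \<phi>) (path_space G Y \<alpha>) section_path
    (cohomology_map (path_space G Y \<alpha>) (path_space G M \<phi>) project_path x) = x"
  unfolding cohomology_map_compose[OF continuous_map_section_path continuous_map_project_path x]
  by (rule cohomology_map_id[OF _ x]) (simp add: project_section_path)

text \<open>The projection is equivariant, so its induced map commutes with the action on cohomology, and so does
  the inverse of that map, which is induced by the section.\<close>

lemma cohomology_map_section_bij:
  "bij_betw (cohomology_map (path_space G M \<phi>) (path_space G Y \<alpha>) section_path)
    (invariant_classes G (path_space G Y \<alpha>) (path_space_action G \<alpha>) :: (_, 'k::field) cochain set set)
    (invariant_classes G (path_space G M \<phi>) (path_space_action G \<phi>))"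
proof -
  let ?P = "path_space G Y \<alpha>" and ?Q = "path_space G M \<phi>"
  let ?S = "cohomology_map ?Q ?P section_path :: (_, 'k) cochain set \<Rightarrow> _"
    and ?R = "cohomology_map ?P ?Q project_path :: (_, 'k) cochain set \<Rightarrow> _"
  interpret P: topological_action G ?P "path_space_action G \<alpha>"
    by (rule Y.path_space_topological_action)
  interpret Q: topological_action G ?Q "path_space_action G \<phi>"
    by (rule M.path_space_topological_action)
  have equiv: "cohomology_map ?P ?P (path_space_action G \<alpha> k) (?R x) =
      ?R (cohomology_map ?Q ?Q (path_space_action G \<phi> k) x)"
    if k: "k \<in> carrier G" and x: "x \<in> carrier (cohomology ?Q)" for k x
    unfolding cohomology_map_compose[OF P.continuous_action_map[OF k] continuous_map_project_path x]
      cohomology_map_compose[OF continuous_map_project_path Q.continuous_action_map[OF k] x]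
    by (rule fun_cong[OF cohomology_map_cong]) (simp add: project_path_equivariant k)
  note closed = cohomology_map_closed[OF continuous_map_section_path]
    cohomology_map_closed[OF continuous_map_project_path]
  show ?thesis
  proof (rule bij_betw_byWitness[where f' = ?R])
    show "?S ` invariant_classes G ?P (path_space_action G \<alpha>) \<subseteq> invariant_classes G ?Q (path_space_action G \<phi>)"
    proof (rule image_subsetI)
      fix y :: "(_, 'k) cochain set"
      assume "y \<in> invariant_classes G ?P (path_space_action G \<alpha>)"
      then have y: "y \<in> carrier (cohomology ?P)"
        "\<And>k. k \<in> carrier G \<Longrightarrow> cohomology_map ?P ?P (path_space_action G \<alpha> k) y = y"
        by (auto simp: invariant_classes_def)
      have "cohomology_map ?Q ?Q (path_space_action G \<phi> k) (?S y) = ?S y" if k: "k \<in> carrier G" for k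
      proof -
        have "?R (cohomology_map ?Q ?Q (path_space_action G \<phi> k) (?S y)) = y"
          using equiv[OF k closed(1)[OF y(1)]] y(2)[OF k] by (simp add: cohomology_map_section_project[OF y(1)])
        then show ?thesis
          using cohomology_map_project_section[OF cohomology_map_closed[OF Q.continuous_action_map[OF k] closed(1)[OF y(1)]]]
          by simp
      qed
      then show "?S y \<in> invariant_classes G ?Q (path_space_action G \<phi>)"
        using closed(1)[OF y(1)] by (simp add: invariant_classes_def)
    qed
    show "?R ` invariant_classes G ?Q (path_space_action G \<phi>) \<subseteq> invariant_classes G ?P (path_space_action G \<alpha>)"
      using equiv closed(2) by (auto simp: invariant_classes_def)
  qed (auto simp: invariant_classes_def cohomology_map_section_project cohomology_map_project_section)
qed

end


section \<open>The isomorphism\<close>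

lemma cohomology_degree_subset_carrier: "cohomology_degree n X \<subseteq> carrier (cohomology X)"
  by (auto simp: cohomology_degree_eq carrier_cohomology)

lemma (in topological_action) carrier_cotensor:
  assumes "finite (carrier G)"
  shows "carrier (cotensor G X \<phi>) = invariant_classes G X \<phi>"
  using cotensor_condition_iff[OF assms] by (auto simp: cotensor_def invariant_classes_def)

text \<open>The operations of the cotensor product are restrictions of those on cohomology, so bijectivity onto the
  invariant classes is all that a map induced by a continuous one has to satisfy.\<close>

lemma (in topological_action) cohomology_map_graded_algebra_iso:
  assumes fin: "finite (carrier G)" and f: "continuous_map X L f"
    and bij: "bij_betw (cohomology_map X L f) (carrier (cohomology L :: ('k::field, ('b, 'k) cochain set) module))
      (invariant_classes G X \<phi>)"
  shows "cohomology_map X L f \<in> graded_algebra_iso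
    (cohomology L :: ('k, ('b, 'k) cochain set) module) (\<lambda>n. cohomology_degree n L)
    (cotensor G X \<phi>) (cotensor_degree G X \<phi>)"
proof -
  let ?f = "cohomology_map X L f :: ('b, 'k) cochain set \<Rightarrow> _"
  let ?H = "cohomology L :: ('k, ('b, 'k) cochain set) module"
  have ops: "mult (cotensor G X \<phi>) = mult (cohomology X)" "one (cotensor G X \<phi>) = one (cohomology X)"
    "add (cotensor G X \<phi>) = add (cohomology X)" "smult (cotensor G X \<phi>) = smult (cohomology X)"
    by (simp_all add: cotensor_def)
  note carrier = carrier_cotensor[OF fin]
  have "?f \<in> ring_hom ?H (cotensor G X \<phi>)"
    using cohomology_map_ring_hom[OF f, where 'k = 'k] bij_betw_imp_surj_on[OF bij]
    unfolding ring_hom_def carrier ops by blast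
  then have "?f \<in> ring_iso ?H (cotensor G X \<phi>)"
    using bij by (simp add: ring_iso_def carrier)
  moreover have "?f ` cohomology_degree n L = cotensor_degree G X \<phi> n" for n
  proof (intro equalityI subsetI)
    fix y assume "y \<in> ?f ` cohomology_degree n L"
    then show "y \<in> cotensor_degree G X \<phi> n"
      using cohomology_map_degree[OF f] cohomology_degree_subset_carrier bij_betwE[OF bij]
      unfolding cotensor_degree_def carrier by blast
  next
    fix y :: "('a, 'k) cochain set" assume y: "y \<in> cotensor_degree G X \<phi> n"
    then obtain x where x: "x \<in> carrier ?H" "y = ?f x"
      using bij_betw_imp_surj_on[OF bij] unfolding cotensor_degree_def carrier by blast
    have "?f x \<in> cohomology_degree n X"
      using y x(2) by (simp add: cotensor_degree_def)
    then obtain x' where "x' \<in> cohomology_degree n L" "?f x' = ?f x"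
      using cohomology_map_degree_preimage[OF f x(1)] by blast
    then show "y \<in> ?f ` cohomology_degree n L"
      using x(2) by (metis image_eqI)
  qed
  ultimately show ?thesis
    by (simp add: graded_algebra_iso_def cohomology_map_smult[OF f] ops)
qed

theorem corollary5p4:
  fixes G :: "('g, 'r) monoid_scheme"
    and M :: "'m topology" and \<phi> :: "'g \<Rightarrow> 'm \<Rightarrow> 'm"
    and E :: "'e topology" and \<epsilon> :: "'g \<Rightarrow> 'e \<Rightarrow> 'e"
  assumes "group G" and "finite (carrier G)"
    and "continuous_action G M \<phi>"
    and "universal_bundle G E \<epsilon>"
    and "locally_finite_cohomology TYPE('k::field) (path_space G M \<phi>)"
    and "(of_nat (order G) :: 'k) \<noteq> 0"
  shows "\<exists>f. f \<in> graded_algebra_iso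
    (cohomology (free_loop_space (borel_construction G E \<epsilon> M \<phi>)) ::
      ('k, (complex \<Rightarrow> ('e \<times> 'm) set, 'k) cochain set) module)
    (\<lambda>n. cohomology_degree n (free_loop_space (borel_construction G E \<epsilon> M \<phi>)))
    (cotensor G (path_space G M \<phi>) (path_space_action G \<phi>))
    (cotensor_degree G (path_space G M \<phi>) (path_space_action G \<phi>))"
proof -
  have "continuous_action G E \<epsilon>"
    using assms(4) by (simp add: universal_bundle_def)
  then have E: "topological_action G E \<epsilon>"
    by (rule continuous_action_imp_topological_action[OF assms(1)])
  have M: "topological_action G M \<phi>"
    using assms(1,3) by (rule continuous_action_imp_topological_action)
  obtain e0 where "homotopic_with (\<lambda>x. True) E E id (\<lambda>x. e0)"
    using assms(4) unfolding universal_bundle_def contractible_space_def by blast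
  then obtain h :: "real \<times> 'e \<Rightarrow> 'e" where h: "continuous_map (prod_topology unit_interval E) E h"
    "\<And>e. h (0, e) = e" "\<And>e. h (1, e) = e0"
    unfolding homotopic_with_def id_def by blast
  have "e0 \<in> topspace E"
  proof -
    obtain e where e: "e \<in> topspace E"
      using assms(4) unfolding universal_bundle_def by blast
    then have "h (1, e) \<in> topspace E"
      using continuous_map_image_subset_topspace[OF h(1)] by (force simp: image_subset_iff)
    then show ?thesis by (simp only: h(3))
  qed
  then interpret contracted_bundle G E \<epsilon> M \<phi> h e0
    using E M h by (simp add: contracted_bundle_def contracted_bundle_axioms_def)
  interpret covering_action G "prod_topology E M" "diagonal_action \<epsilon> \<phi>"
    using assms(1,4) M by (rule covering_action_diagonal)
  let ?L = "free_loop_space (borel_construction G E \<epsilon> M \<phi>)"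
  let ?P = "path_space G (prod_topology E M) (diagonal_action \<epsilon> \<phi>)"
  let ?Q = "path_space G M \<phi>"
  have B: "borel_construction G E \<epsilon> M \<phi> = orbit_space G (prod_topology E M) (diagonal_action \<epsilon> \<phi>)"
    by (simp add: borel_construction_def diagonal_action_def)
  interpret loops: simplicial_orbit_map G ?P "path_space_action G (diagonal_action \<epsilon> \<phi>)" ?L loop_of_path
    unfolding B by (rule loop_orbit_map[OF assms(2)])
  interpret paths: topological_action G ?Q "path_space_action G \<phi>"
    by (rule M.path_space_topological_action)
  let ?T = "cohomology_map ?P ?L loop_of_path :: (_, 'k) cochain set \<Rightarrow> _"
  let ?S = "cohomology_map ?Q ?P section_path :: (_, 'k) cochain set \<Rightarrow> _"
  have "bij_betw ?T (carrier (cohomology ?L :: ('k, (_, 'k) cochain set) module))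
      (invariant_classes G ?P (path_space_action G (diagonal_action \<epsilon> \<phi>)))"
    using loops.inj_on_cohomology_map_q[OF assms(6)] loops.cohomology_map_q_image[OF assms(6)]
    by (simp add: bij_betw_def)
  then have "bij_betw (?S \<circ> ?T) (carrier (cohomology ?L :: ('k, (_, 'k) cochain set) module))
      (invariant_classes G ?Q (path_space_action G \<phi>))"
    using cohomology_map_section_bij by (rule bij_betw_trans)
  moreover have "(?S \<circ> ?T) x = cohomology_map ?Q ?L (loop_of_path \<circ> section_path) x"
    if "x \<in> carrier (cohomology ?L)" for x
    using cohomology_map_compose[OF continuous_map_section_path loops.continuous_q that] by simp
  ultimately have "bij_betw (cohomology_map ?Q ?L (loop_of_path \<circ> section_path))
      (carrier (cohomology ?L :: ('k, (_, 'k) cochain set) module))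
      (invariant_classes G ?Q (path_space_action G \<phi>))"
    by (simp cong: bij_betw_cong)
  then have "cohomology_map ?Q ?L (loop_of_path \<circ> section_path) \<in> graded_algebra_iso
      (cohomology ?L :: ('k, (_, 'k) cochain set) module) (\<lambda>n. cohomology_degree n ?L)
      (cotensor G ?Q (path_space_action G \<phi>)) (cotensor_degree G ?Q (path_space_action G \<phi>))"
    using continuous_map_compose[OF continuous_map_section_path loops.continuous_q]
    by (intro paths.cohomology_map_graded_algebra_iso[OF assms(2)])
  then show ?thesis by blast
qed

end
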